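(* Let $(M,g)$ be a complete finite-dimensional Riemannian manifold, let $E\subseteq M$ be star-shaped at $p_0\in E$, let $f:E\to\mathbb{I}$, $f(p)=\langle f^c(p),f^w(p)\rangle$, be an interval-valued function and $g_1,\dots,g_m:E\to\mathbb{R}$. Consider the problem of minimizing $f(p)$ (with respect to $\leq^{\min}$) subject to $g_i(p)\le0$, $i\in\{1,\dots,m\}$, with feasible set $X=\{p\in E:g_i(p)\le 0,\ 1\le i\le m\}$. Let $p_0\in X$ and $J=\{i:g_i(p_0)=0\}$. Suppose that the constraints $g_i$, $i\in J$, are convex at $p_0$ and that $g_i$, $i\in\{1,\dots,m\}$, are directionally differentiable at $p_0$. Then the following hold. 1. Suppose that $f^c$ is directionally differentiable at $p_0$, convex at $p_0$, and non-constant on $X$ (in the sense defined in the context). If there exist real scalars $\mu_i\ge0$, $i\in\{1,\dots,m\}$, such that (i) $Df^c(p_0;X_{p_0})+\sum_{i=1}^m\mu_i\,Dg_i(p_0;X_{p_0})\ge0$ for all $X_{p_0}\in T_{p_0}(E)$, and (ii) $\mu_ig_i(p_0)=0$ for all $i\in\{1,\dots,m\}$, then $p_0$ is a strict optimal solution of the problem. 2. Suppose that $f^c$ is constant on $X$ (i.e. takes a single value on $X$) and that $f^w$ is directionally differentiable at $p_0$ and convex at $p_0$. If there exist real scalars $\mu_i\ge0$, $i\in\{1,\dots,m\}$, such that (i) $Df^w(p_0;X_{p_0})+\sum_{i=1}^m\mu_i\,Dg_i(p_0;X_{p_0})\ge0$ for all $X_{p_0}\in T_{p_0}(E)$, and (ii)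 $\mu_ig_i(p_0)=0$ for all $i\in\{1,\dots,m\}$, then $p_0$ is an optimal solution of the problem. Moreover, if $f^w$ is non-constant on $X$ (in the sense defined in the context), then $p_0$ is a strict optimal solution of the problem.
   Context: Intervals: $\mathbb{I}$ is the set of closed bounded intervals of $\mathbb{R}$. $T=[t^l,t^u]\in\mathbb{I}$ is written $T=\langle t^c,t^w\rangle$ with center $t^c=\frac{t^l+t^u}{2}$ and half-width $t^w=\frac{t^u-t^l}{2}\ge 0$. The total order $\leq^{\min}$: $T_1\leq^{\min}T_2$ iff $t_1^c<t_2^c$, or $t_1^c=t_2^c$ and $t_1^w\le t_2^w$; $T_1<^{\min}T_2$ iff $T_1\leq^{\min}T_2$ and $T_1\ne T_2$. An interval-valued function $f:E\to\mathbb{I}$ is written $f=\langle f^c,f^w\rangle$ with $f^c,f^w:E\to\mathbb{R}$ (center and half-width functions), $f^w\ge0$. Star-shaped: $E\subseteq M$ is star-shaped at $p_0\in E$ if for every $p\in E$ and every geodesic $\gamma:[0,1]\to M$ with $\gamma(0)=p_0$, $\gamma(1)=p$, one has $\gamma(s)\in E$ for all $s\in(0,1)$. Convexity at a point: for $E$ star-shaped at $p_0$, $h:E\to\mathbb{R}$ is convex at $p_0$ if $h(\gamma(s))\le(1-s)h(p_0)+s\,h(p)$ for all $p\in E$, every geodesic $\gamma:[0,1]\to M$ with $\gamma(0)=p_0$, $\gamma(1)=p$, and all $s\in(0,1)$. Tangent directions and directional derivative: $T_{p_0}(E)$ denotes the set of vectors $X_{p_0}\in T_{p_0}M$ for which there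 is a geodesic $\gamma:I\to M$, $I\subseteq\mathbb{R}$ an interval containing $[0,\varepsilon)$ for some $\varepsilon>0$, with $\gamma(I)\subseteq E$, $\gamma(0)=p_0$, $\dot\gamma(0)=X_{p_0}$. For such $X_{p_0}$ and $\gamma$, $Dh(p_0;X_{p_0})=\lim_{s\to0^+}\frac{h(\gamma(s))-h(p_0)}{s}$ if the limit exists; $h:E\to\mathbb{R}$ is directionally differentiable at $p_0$ if this limit exists for every $X_{p_0}\in T_{p_0}(E)$. Non-constant (paper's definition): a function $h$ is non-constant on $X$ if $h(p)\neq h(q)$ for all $p,q\in X$ with $p\ne q$. Optimal solution: $p_0\in X$ is an optimal solution if there is no $p\in X$ with $f(p)<^{\min}f(p_0)$; it is a strict optimal solution if there is no $p\in X$, $p\ne p_0$, with $f(p)\leq^{\min}f(p_0)$.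
   Formalization: The manifold M is additionally assumed to be connected (and of positive dimension, the one-point case being trivial); without connectedness the claim fails, because points of E in another component are not joined to p_0 by any geodesic. *)

theory Defs
  imports "HOL-Analysis.Analysis" "HOL-Library.Interval"
begin

section \<open>Smooth maps between Euclidean spaces\<close>

text \<open>Meaningful on open sets only: derivatives are taken in the whole space.\<close>

primrec Ck_on :: "nat \<Rightarrow> ('e::real_normed_vector \<Rightarrow> 'f::real_normed_vector) \<Rightarrow> 'e set \<Rightarrow> bool" where
  "Ck_on 0 = (\<lambda>f S. continuous_on S f)"
| "Ck_on (Suc k) = (\<lambda>f S. (\<forall>x\<in>S. f differentiable (at x)) \<and>
     (\<forall>v. Ck_on k (\<lambda>x. frechet_derivative f (at x) v) S))"

definition smooth_on :: "'e::real_normed_vector set \<Rightarrow> ('e \<Rightarrow> 'f::real_normed_vector) \<Rightarrow> bool" where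
  "smooth_on S f \<longleftrightarrow> (\<forall>k. Ck_on k f S)"


section \<open>Smooth manifolds\<close>

text \<open>The underlying set of the manifold is the whole type \<open>'a\<close>, whose topology is that of the
  manifold.  A chart is a pair of its domain and its coordinate map into the model space \<open>'e\<close>;
  the coordinate map is arbitrary outside of the domain.\<close>

type_synonym ('a, 'e) chart = "'a set \<times> ('a \<Rightarrow> 'e)"

abbreviation chart_dom :: "('a, 'e) chart \<Rightarrow> 'a set" where
  "chart_dom c \<equiv> fst c"

abbreviation chart_map :: "('a, 'e) chart \<Rightarrow> 'a \<Rightarrow> 'e" where
  "chart_map c \<equiv> snd c"

definition chart_inv :: "('a, 'e) chart \<Rightarrow> 'e \<Rightarrow> 'a" where
  "chart_inv c = inv_into (chart_dom c) (chart_map c)"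

definition transition :: "('a, 'e) chart \<Rightarrow> ('a, 'e) chart \<Rightarrow> 'e \<Rightarrow> 'e" where
  "transition c c' = chart_map c' \<circ> chart_inv c"

text \<open>An atlas need not be maximal.\<close>

locale smooth_manifold =
  fixes A :: "('a::{t2_space, second_countable_topology}, 'e::euclidean_space) chart set"
  assumes atlas_cover: "(\<Union>c\<in>A. chart_dom c) = UNIV"
    and atlas_open_dom: "c \<in> A \<Longrightarrow> open (chart_dom c)"
    and atlas_open_range: "c \<in> A \<Longrightarrow> open (chart_map c ` chart_dom c)"
    and atlas_homeomorphism: "c \<in> A \<Longrightarrow>
      homeomorphism (chart_dom c) (chart_map c ` chart_dom c) (chart_map c) (chart_inv c)"
    and atlas_compatible: "c \<in> A \<Longrightarrow> c' \<in> A \<Longrightarrow>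
      smooth_on (chart_map c ` (chart_dom c \<inter> chart_dom c')) (transition c c')"

text \<open>A tangent vector at \<open>p\<close> is given by its components in all charts around \<open>p\<close>, which are
  related by the derivatives of the chart transitions.  The value 0 for all other charts makes
  this representation unique.\<close>

type_synonym ('a, 'e) tangent_vector = "('a, 'e) chart \<Rightarrow> 'e"

definition tangent_space ::
    "('a, 'e::euclidean_space) chart set \<Rightarrow> 'a \<Rightarrow> ('a, 'e) tangent_vector set" where
  "tangent_space A p = {X.
     (\<forall>c. \<not> (c \<in> A \<and> p \<in> chart_dom c) \<longrightarrow> X c = 0) \<and>
     (\<forall>c\<in>A. \<forall>c'\<in>A. p \<in> chart_dom c \<inter> chart_dom c' \<longrightarrow>
        X c' = frechet_derivative (transition c c') (at (chart_map c p)) (X c))}"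

text \<open>The derivative is one-sided if \<open>t\<close> is an end point of the interval \<open>I\<close>.\<close>

definition has_velocity ::
    "('a, 'e::euclidean_space) chart set \<Rightarrow> real set \<Rightarrow> (real \<Rightarrow> 'a) \<Rightarrow> real \<Rightarrow>
      ('a, 'e) tangent_vector \<Rightarrow> bool" where
  "has_velocity A I \<gamma> t X \<longleftrightarrow> X \<in> tangent_space A (\<gamma> t) \<and>
     (\<forall>c\<in>A. \<gamma> t \<in> chart_dom c \<longrightarrow>
        ((chart_map c \<circ> \<gamma>) has_vector_derivative X c) (at t within I))"


section \<open>Riemannian manifolds and geodesics\<close>

text \<open>The metric is given by its components: \<open>G c x\<close> is the inner product on the tangent space at
  the point with coordinates \<open>x\<close>, expressed in the chart \<open>c\<close>.  As usual in Riemannian geometry,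
  manifolds are connected.\<close>

type_synonym ('a, 'e) metric_tensor = "('a, 'e) chart \<Rightarrow> 'e \<Rightarrow> 'e \<Rightarrow> 'e \<Rightarrow> real"

locale riemannian_manifold = smooth_manifold A
  for A :: "('a::{t2_space, second_countable_topology}, 'e::euclidean_space) chart set" +
  fixes G :: "('a, 'e) metric_tensor"
  assumes connected_manifold: "connected (UNIV :: 'a set)"
    and metric_bilinear: "c \<in> A \<Longrightarrow> x \<in> chart_map c ` chart_dom c \<Longrightarrow> bilinear (G c x)"
    and metric_sym: "c \<in> A \<Longrightarrow> x \<in> chart_map c ` chart_dom c \<Longrightarrow> G c x u v = G c x v u"
    and metric_pos: "c \<in> A \<Longrightarrow> x \<in> chart_map c ` chart_dom c \<Longrightarrow> u \<noteq> 0 \<Longrightarrow> G c x u u > 0"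
    and metric_smooth: "c \<in> A \<Longrightarrow> smooth_on (chart_map c ` chart_dom c) (\<lambda>x. G c x u v)"
    and metric_compatible: "c \<in> A \<Longrightarrow> c' \<in> A \<Longrightarrow> p \<in> chart_dom c \<inter> chart_dom c' \<Longrightarrow>
      G c (chart_map c p) u v =
      G c' (chart_map c' p)
        (frechet_derivative (transition c c') (at (chart_map c p)) u)
        (frechet_derivative (transition c c') (at (chart_map c p)) v)"

text \<open>The Christoffel symbols of the Levi-Civita connection, as a bilinear map
  \<open>u, v \<mapsto> \<Sum> i j k. \<Gamma>\<^sub>i\<^sub>j\<^sup>k u\<^sup>i v\<^sup>j e\<^sub>k\<close>, defined by the Koszul formula for coordinate vector fields:
  \<open>2 g(\<Gamma>(u, v), w) = \<partial>\<^sub>u g(v, w) + \<partial>\<^sub>v g(u, w) - \<partial>\<^sub>w g(u, v)\<close>.\<close>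

definition christoffel ::
    "('a, 'e::euclidean_space) metric_tensor \<Rightarrow> ('a, 'e) chart \<Rightarrow> 'e \<Rightarrow> 'e \<Rightarrow> 'e \<Rightarrow> 'e" where
  "christoffel G c x u v = (THE z. \<forall>w.
     2 * G c x z w =
       frechet_derivative (\<lambda>y. G c y v w) (at x) u
     + frechet_derivative (\<lambda>y. G c y u w) (at x) v
     - frechet_derivative (\<lambda>y. G c y u v) (at x) w)"

text \<open>The equation \<open>\<nabla>\<^bsub>\<gamma>'\<^esub> \<gamma>' = 0\<close> in every chart; \<open>v\<close> is the coordinate velocity.\<close>

definition geodesic ::
    "('a::topological_space, 'e::euclidean_space) chart set \<Rightarrow> ('a, 'e) metric_tensor \<Rightarrow>
      real set \<Rightarrow> (real \<Rightarrow> 'a) \<Rightarrow> bool" where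
  "geodesic A G I \<gamma> \<longleftrightarrow> continuous_on I \<gamma> \<and>
     (\<forall>c\<in>A. \<exists>v. \<forall>t\<in>I. \<gamma> t \<in> chart_dom c \<longrightarrow>
        ((chart_map c \<circ> \<gamma>) has_vector_derivative v t) (at t within I) \<and>
        (v has_vector_derivative - christoffel G c (chart_map c (\<gamma> t)) (v t) (v t)) (at t within I))"

text \<open>Geodesic completeness: the exponential map at every point is defined on the whole tangent
  space.  By the Hopf--Rinow theorem this is equivalent to completeness of the Riemannian
  distance.\<close>

locale complete_riemannian_manifold = riemannian_manifold A G
  for A :: "('a::{t2_space, second_countable_topology}, 'e::euclidean_space) chart set"
    and G :: "('a, 'e) metric_tensor" +
  assumes geodesically_complete: "X \<in> tangent_space A p \<Longrightarrow>
    \<exists>\<gamma>. geodesic A G UNIV \<gamma> \<and> \<gamma> 0 = p \<and> has_velocity A UNIV \<gamma> 0 X"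


section \<open>Star-shaped sets, convexity and directional derivatives\<close>

definition star_shaped ::
    "('a::topological_space, 'e::euclidean_space) chart set \<Rightarrow> ('a, 'e) metric_tensor \<Rightarrow>
      'a set \<Rightarrow> 'a \<Rightarrow> bool" where
  "star_shaped A G E p0 \<longleftrightarrow> p0 \<in> E \<and>
     (\<forall>p\<in>E. \<forall>\<gamma>. geodesic A G {0..1} \<gamma> \<and> \<gamma> 0 = p0 \<and> \<gamma> 1 = p \<longrightarrow> (\<forall>s\<in>{0<..<1}. \<gamma> s \<in> E))"

definition convex_at ::
    "('a::topological_space, 'e::euclidean_space) chart set \<Rightarrow> ('a, 'e) metric_tensor \<Rightarrow>
      'a set \<Rightarrow> ('a \<Rightarrow> real) \<Rightarrow> 'a \<Rightarrow> bool" where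
  "convex_at A G E h p0 \<longleftrightarrow>
     (\<forall>p\<in>E. \<forall>\<gamma>. geodesic A G {0..1} \<gamma> \<and> \<gamma> 0 = p0 \<and> \<gamma> 1 = p \<longrightarrow>
        (\<forall>s\<in>{0<..<1}. h (\<gamma> s) \<le> (1 - s) * h p0 + s * h p))"

definition geodesic_from ::
    "('a::topological_space, 'e::euclidean_space) chart set \<Rightarrow> ('a, 'e) metric_tensor \<Rightarrow>
      'a set \<Rightarrow> 'a \<Rightarrow> ('a, 'e) tangent_vector \<Rightarrow> real set \<Rightarrow> (real \<Rightarrow> 'a) \<Rightarrow> bool" where
  "geodesic_from A G E p0 X I \<gamma> \<longleftrightarrow>
     is_interval I \<and> (\<exists>\<epsilon>>0. {0..<\<epsilon>} \<subseteq> I) \<and> geodesic A G I \<gamma> \<and> \<gamma> ` I \<subseteq> E \<and>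
     \<gamma> 0 = p0 \<and> has_velocity A I \<gamma> 0 X"

definition tangent_directions ::
    "('a::topological_space, 'e::euclidean_space) chart set \<Rightarrow> ('a, 'e) metric_tensor \<Rightarrow>
      'a set \<Rightarrow> 'a \<Rightarrow> ('a, 'e) tangent_vector set" where
  "tangent_directions A G E p0 =
     {X \<in> tangent_space A p0. \<exists>I \<gamma>. geodesic_from A G E p0 X I \<gamma>}"

text \<open>Two geodesics with the same initial velocity agree for small \<open>s \<ge> 0\<close>, so the limit does not
  depend on the choice of \<open>\<gamma>\<close>.\<close>

definition has_dir_deriv ::
    "('a::topological_space, 'e::euclidean_space) chart set \<Rightarrow> ('a, 'e) metric_tensor \<Rightarrow>
      'a set \<Rightarrow> ('a \<Rightarrow> real) \<Rightarrow> 'a \<Rightarrow> ('a, 'e) tangent_vector \<Rightarrow> real \<Rightarrow> bool" where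
  "has_dir_deriv A G E h p0 X d \<longleftrightarrow>
     (\<forall>I \<gamma>. geodesic_from A G E p0 X I \<gamma> \<longrightarrow>
        ((\<lambda>s. (h (\<gamma> s) - h p0) / s) \<longlongrightarrow> d) (at_right 0))"

definition dir_deriv ::
    "('a::topological_space, 'e::euclidean_space) chart set \<Rightarrow> ('a, 'e) metric_tensor \<Rightarrow>
      'a set \<Rightarrow> ('a \<Rightarrow> real) \<Rightarrow> 'a \<Rightarrow> ('a, 'e) tangent_vector \<Rightarrow> real" where
  "dir_deriv A G E h p0 X = (THE d. has_dir_deriv A G E h p0 X d)"

definition dir_differentiable_at ::
    "('a::topological_space, 'e::euclidean_space) chart set \<Rightarrow> ('a, 'e) metric_tensor \<Rightarrow>
      'a set \<Rightarrow> ('a \<Rightarrow> real) \<Rightarrow> 'a \<Rightarrow> bool" where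
  "dir_differentiable_at A G E h p0 \<longleftrightarrow>
     (\<forall>X\<in>tangent_directions A G E p0. \<exists>d. has_dir_deriv A G E h p0 X d)"


section \<open>Interval-valued optimization\<close>

definition center :: "real interval \<Rightarrow> real" where
  "center T = (lower T + upper T) / 2"

definition half_width :: "real interval \<Rightarrow> real" where
  "half_width T = (upper T - lower T) / 2"

definition le_min :: "real interval \<Rightarrow> real interval \<Rightarrow> bool" (infix "\<le>min" 50) where
  "T1 \<le>min T2 \<longleftrightarrow> center T1 < center T2 \<or> center T1 = center T2 \<and> half_width T1 \<le> half_width T2"

definition less_min :: "real interval \<Rightarrow> real interval \<Rightarrow> bool" (infix "<min" 50) where
  "T1 <min T2 \<longleftrightarrow> T1 \<le>min T2 \<and> T1 \<noteq> T2"

text \<open>Stronger than the negation of being constant: this is injectivity on \<open>X\<close>.\<close>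

definition nonconstant_on :: "('a \<Rightarrow> real) \<Rightarrow> 'a set \<Rightarrow> bool" where
  "nonconstant_on h X \<longleftrightarrow> (\<forall>p\<in>X. \<forall>q\<in>X. p \<noteq> q \<longrightarrow> h p \<noteq> h q)"

definition feasible_set :: "'a set \<Rightarrow> nat \<Rightarrow> (nat \<Rightarrow> 'a \<Rightarrow> real) \<Rightarrow> 'a set" where
  "feasible_set E m g = {p \<in> E. \<forall>i\<in>{1..m}. g i p \<le> 0}"

definition optimal_solution :: "('a \<Rightarrow> real interval) \<Rightarrow> 'a set \<Rightarrow> 'a \<Rightarrow> bool" where
  "optimal_solution f X p0 \<longleftrightarrow> p0 \<in> X \<and> \<not> (\<exists>p\<in>X. f p <min f p0)"

definition strict_optimal_solution :: "('a \<Rightarrow> real interval) \<Rightarrow> 'a set \<Rightarrow> 'a \<Rightarrow> bool" where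
  "strict_optimal_solution f X p0 \<longleftrightarrow> p0 \<in> X \<and> \<not> (\<exists>p\<in>X. p \<noteq> p0 \<and> f p \<le>min f p0)"

text \<open>The scalars \<open>\<mu> i\<close> satisfy the optimality conditions at \<open>p0\<close> for the objective \<open>h\<close>.\<close>

definition kkt_multipliers ::
    "('a::topological_space, 'e::euclidean_space) chart set \<Rightarrow> ('a, 'e) metric_tensor \<Rightarrow>
      'a set \<Rightarrow> nat \<Rightarrow> (nat \<Rightarrow> 'a \<Rightarrow> real) \<Rightarrow> ('a \<Rightarrow> real) \<Rightarrow> 'a \<Rightarrow> (nat \<Rightarrow> real) \<Rightarrow> bool" where
  "kkt_multipliers A G E m g h p0 \<mu> \<longleftrightarrow>
     (\<forall>i\<in>{1..m}. \<mu> i \<ge> 0) \<and>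
     (\<forall>X\<in>tangent_directions A G E p0.
        dir_deriv A G E h p0 X + (\<Sum>i=1..m. \<mu> i * dir_deriv A G E (g i) p0 X) \<ge> 0) \<and>
     (\<forall>i\<in>{1..m}. \<mu> i * g i p0 = 0)"

end

(*
The heart of the matter is the Hopf-Rinow theorem: by completeness, every feasible p is joined to p0
by a geodesic, along which convexity bounds the directional derivatives at p0 by h(p) - h(p0); the
first-order condition and complementary slackness then give h(p0) <= h(p).

Hopf-Rinow is proved without exponential map or Gauss lemma, and completeness replaces every
existence theorem for differential equations.  In a chart, nearby points are joined by a slow geodesic,
found with the Banach fixed point theorem by shooting.  A slow geodesic minimizes energy because the
second-order terms of the energy are dominated by the square of the derivative of the deviation.
The distance is the infimum of the lengths of broken geodesics.  The equality case of the local
minimality excludes corners of minimizing curves, so that the usual continuation of a minimizing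
geodesic goes through.
*)

theory Submission
  imports Defs
begin

text \<open>No uniqueness or regular dependence of geodesics on their initial data is presupposed,
  so there is no exponential map to differentiate. Homogeneity takes its place: the Christoffel term
  is quadratic in the velocity, so slow geodesics in a coordinate ball are nearly straight, and two
  of them with a common start separate almost linearly. This makes the shooting map a contraction,
  whichever geodesics completeness supplies. Energy is compared instead of length because its first
  variation along a geodesic is an exact derivative. Choosing the corner time of a two-piece
  competitor in proportion to the lengths of its pieces turns the energy inequality into a triangle
  inequality, by which a broken geodesic is shortened piece by piece. A single constant
  \<open>K \<ge> 1\<close> controls the metric in a coordinate ball. The radii \<open>r\<close> and
  \<open>r'\<close> contain powers of \<open>K\<close> so that short paths fall under the
  comparison, while longer ones cannot compete.\<close>

section \<open>Estimates for a metric in coordinates\<close>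

text \<open>Finitely many basis vectors, so their constants add up. The weight \<open>W\<close>
  carries the size of arguments already treated, which allows iteration to multilinear
  families.\<close>

lemma linear_family_bound:
  fixes F :: "'s \<Rightarrow> 'e::euclidean_space \<Rightarrow> real"
  assumes lin: "\<And>s. s \<in> S \<Longrightarrow> linear (F s)" and W: "\<And>s. s \<in> S \<Longrightarrow> 0 \<le> W s"
    and bound: "\<And>i. i \<in> Basis \<Longrightarrow> \<exists>C. \<forall>s\<in>S. \<bar>F s i\<bar> \<le> C * W s"
  shows "\<exists>C. \<forall>s\<in>S. \<forall>u. \<bar>F s u\<bar> \<le> C * (W s * norm u)"
proof -
  obtain C where C: "\<And>i s. i \<in> Basis \<Longrightarrow> s \<in> S \<Longrightarrow> \<bar>F s i\<bar> \<le> C i * W s"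
    using bound by metis
  have "\<bar>F s u\<bar> \<le> (\<Sum>i\<in>Basis. C i) * (W s * norm u)" if s: "s \<in> S" for s u
  proof -
    have "F s u = F s (\<Sum>i\<in>Basis. (u \<bullet> i) *\<^sub>R i)"
      by (simp add: euclidean_representation)
    also have "\<dots> = (\<Sum>i\<in>Basis. (u \<bullet> i) * F s i)"
      using lin[OF s] by (simp add: linear_sum linear_cmul)
    finally have "\<bar>F s u\<bar> \<le> (\<Sum>i\<in>Basis. \<bar>(u \<bullet> i) * F s i\<bar>)"
      by simp
    also have "\<dots> \<le> (\<Sum>i\<in>Basis. norm u * (C i * W s))"
      unfolding abs_mult using C s by (intro sum_mono mult_mono Basis_le_norm) auto
    finally show ?thesis
      by (simp add: sum_distrib_left sum_distrib_right mult_ac)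
  qed
  then show ?thesis by blast
qed

text \<open>Compactness bounds the derivative on each basis vector, hence its operator norm; the
  mean value inequality on the convex ball then gives the Lipschitz constant.\<close>

lemma Ck_on_1_bounded_lipschitz:
  fixes f :: "'e::euclidean_space \<Rightarrow> real"
  assumes f: "Ck_on 1 f U" and U: "cball y R \<subseteq> U"
  shows "\<exists>C. \<forall>x\<in>cball y R. \<bar>f x\<bar> \<le> C \<and> (\<forall>x'\<in>cball y R. \<bar>f x - f x'\<bar> \<le> C * norm (x - x'))"
proof -
  have der: "(f has_derivative frechet_derivative f (at x)) (at x)" if "x \<in> U" for x
    using f that frechet_derivative_works by auto
  have cd: "continuous_on (cball y R) (\<lambda>x. frechet_derivative f (at x) v)" for v
    using f by (intro continuous_on_subset[OF _ U]) simp
  have "\<exists>C. \<forall>x\<in>cball y R. \<forall>u. \<bar>frechet_derivative f (at x) u\<bar> \<le> C * (1 * norm u)"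
  proof (rule linear_family_bound)
    fix i :: 'e assume "i \<in> Basis"
    have "bounded ((\<lambda>x. frechet_derivative f (at x) i) ` cball y R)"
      using cd compact_cball compact_continuous_image compact_imp_bounded by blast
    then show "\<exists>C. \<forall>s\<in>cball y R. \<bar>frechet_derivative f (at s) i\<bar> \<le> C * 1"
      by (auto simp: bounded_iff)
  next
    fix x assume "x \<in> cball y R"
    then show "linear (frechet_derivative f (at x))"
      using der U has_derivative_linear by blast
  qed auto
  then obtain C where "\<forall>x\<in>cball y R. \<forall>u. \<bar>frechet_derivative f (at x) u\<bar> \<le> C * (1 * norm u)"
    by blast
  then have C: "\<And>x u. x \<in> cball y R \<Longrightarrow> \<bar>frechet_derivative f (at x) u\<bar> \<le> C * norm u"
    by simp
  have "\<bar>f x - f x'\<bar> \<le> C * norm (x - x')" if "x \<in> cball y R" "x' \<in> cball y R" for x x'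
  proof -
    have "norm (f x - f x') \<le> C * norm (x - x')"
    proof (rule differentiable_bound)
      show "onorm (frechet_derivative f (at x)) \<le> C" if "x \<in> cball y R" for x
        using C[OF that] by (intro onorm_le) auto
    next
      fix x assume "x \<in> cball y R"
      then show "(f has_derivative frechet_derivative f (at x)) (at x within cball y R)"
        using der U has_derivative_at_withinI by blast
    qed (use that in auto)
    then show ?thesis by simp
  qed
  moreover have "continuous_on (cball y R) f"
    using U by (intro continuous_at_imp_continuous_on ballI has_derivative_continuous[OF der]) auto
  then have "bounded (f ` cball y R)"
    using compact_cball compact_continuous_image compact_imp_bounded by blast
  then obtain D where "\<forall>x\<in>cball y R. \<bar>f x\<bar> \<le> D"
    unfolding bounded_iff by auto
  ultimately have "\<forall>x\<in>cball y R. \<bar>f x\<bar> \<le> max C D \<and> (\<forall>x'\<in>cball y R. \<bar>f x - f x'\<bar> \<le> max C D * norm (x - x'))"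
    by (meson max.cobounded1 max.cobounded2 mult_right_mono norm_ge_zero order_trans)
  then show ?thesis by blast
qed

lemma bilinear_expansion:
  assumes "bilinear B"
  shows "B u v = (\<Sum>i\<in>Basis. \<Sum>j\<in>Basis. (u \<bullet> i) * (v \<bullet> j) * (B i j :: real))"
proof -
  have "B u v = B (\<Sum>i\<in>Basis. (u \<bullet> i) *\<^sub>R i) (\<Sum>j\<in>Basis. (v \<bullet> j) *\<^sub>R j)"
    by (simp add: euclidean_representation)
  also have "\<dots> = (\<Sum>i\<in>Basis. \<Sum>j\<in>Basis. (u \<bullet> i) * (v \<bullet> j) * B i j)"
    by (simp add: bilinear_sum[OF assms] bilinear_lmul[OF assms] bilinear_rmul[OF assms]
        sum.cartesian_product mult_ac)
  finally show ?thesis .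
qed

text \<open>The linear case twice: in \<open>u\<close> for each basis vector \<open>j\<close>, then
  in \<open>v\<close>, with \<open>u\<close> moved into the index and \<open>norm u\<close> into the
  weight.\<close>

lemma bilinear_family_bound:
  fixes F :: "'s \<Rightarrow> 'e::euclidean_space \<Rightarrow> 'e \<Rightarrow> real"
  assumes bil: "\<And>s. s \<in> S \<Longrightarrow> bilinear (F s)" and W: "\<And>s. s \<in> S \<Longrightarrow> 0 \<le> W s"
    and bound: "\<And>i j. i \<in> Basis \<Longrightarrow> j \<in> Basis \<Longrightarrow> \<exists>C. \<forall>s\<in>S. \<bar>F s i j\<bar> \<le> C * W s"
  shows "\<exists>C. \<forall>s\<in>S. \<forall>u v. \<bar>F s u v\<bar> \<le> C * (W s * norm u * norm v)"
proof -
  have "\<exists>C. \<forall>s\<in>S \<times> UNIV. \<forall>v. \<bar>F (fst s) (snd s) v\<bar> \<le> C * ((W (fst s) * norm (snd s)) * norm v)"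
  proof (rule linear_family_bound)
    fix j :: 'e assume j: "j \<in> Basis"
    have "\<exists>C. \<forall>s\<in>S. \<forall>u. \<bar>F s u j\<bar> \<le> C * (W s * norm u)"
    proof (rule linear_family_bound)
      show "\<exists>C. \<forall>s\<in>S. \<bar>F s i j\<bar> \<le> C * W s" if "i \<in> Basis" for i
        using bound[OF that j] .
    qed (use W bil bilinear_def in blast)+
    then show "\<exists>C. \<forall>s\<in>S \<times> UNIV. \<bar>F (fst s) (snd s) j\<bar> \<le> C * (W (fst s) * norm (snd s))"
      by (elim ex_forward) auto
  next
    fix s assume "s \<in> S \<times> (UNIV :: 'e set)"
    then show "linear (F (fst s) (snd s))" "0 \<le> W (fst s) * norm (snd s)"
      using bil[of "fst s"] W by (auto simp: bilinear_def)
  qed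
  then show ?thesis by (elim ex_forward) auto
qed

section \<open>A Riemannian metric in coordinates and its Christoffel form\<close>

locale coordinate_metric =
  fixes U :: "'e::euclidean_space set" and g :: "'e \<Rightarrow> 'e \<Rightarrow> 'e \<Rightarrow> real"
  assumes open_U: "open U"
    and bilinear_g: "x \<in> U \<Longrightarrow> bilinear (g x)"
    and g_sym: "x \<in> U \<Longrightarrow> g x u v = g x v u"
    and g_pos: "x \<in> U \<Longrightarrow> u \<noteq> 0 \<Longrightarrow> g x u u > 0"
    and g_smooth: "smooth_on U (\<lambda>x. g x u v)"
begin

definition dg :: "'e \<Rightarrow> 'e \<Rightarrow> 'e \<Rightarrow> 'e \<Rightarrow> real" where
  "dg x w u v = frechet_derivative (\<lambda>y. g y u v) (at x) w"

text \<open>Only the diagonal of the Christoffel form enters the geodesic equation. The two equal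
  terms stay unmerged so that the body matches that of \<open>christoffel G c x u u\<close>.\<close>

definition \<Gamma> :: "'e \<Rightarrow> 'e \<Rightarrow> 'e" where
  "\<Gamma> x u = (THE z. \<forall>w. 2 * g x z w = dg x u u w + dg x u u w - dg x w u u)"

lemma g_has_derivative: "x \<in> U \<Longrightarrow> ((\<lambda>y. g y u v) has_derivative (\<lambda>w. dg x w u v)) (at x)"
  using g_smooth[of u v] frechet_derivative_works
  unfolding smooth_on_def dg_def by (metis Ck_on.simps(2))

lemma linear_dg1: "x \<in> U \<Longrightarrow> linear (\<lambda>w. dg x w u v)"
  using g_has_derivative has_derivative_linear by blast

lemma g_bilinear_simps:
  assumes "x \<in> U"
  shows "g x (u + u') v = g x u v + g x u' v" "g x v (u + u') = g x v u + g x v u'"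
    "g x (u - u') v = g x u v - g x u' v" "g x v (u - u') = g x v u - g x v u'"
    "g x (a *\<^sub>R u) v = a * g x u v" "g x v (a *\<^sub>R u) = a * g x v u"
    "g x (- u) v = - g x u v" "g x v (- u) = - g x v u" "g x 0 v = 0" "g x v 0 = 0"
  using bilinear_ladd[OF bilinear_g[OF assms], of u u' v] bilinear_radd[OF bilinear_g[OF assms], of v u u']
    bilinear_lsub[OF bilinear_g[OF assms], of u u' v] bilinear_rsub[OF bilinear_g[OF assms], of v u u']
    bilinear_lmul[OF bilinear_g[OF assms], of a u v] bilinear_rmul[OF bilinear_g[OF assms], of v a u]
    bilinear_lneg[OF bilinear_g[OF assms], of u v] bilinear_rneg[OF bilinear_g[OF assms], of v u]
    bilinear_lzero[OF bilinear_g[OF assms], of v] bilinear_rzero[OF bilinear_g[OF assms], of v]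
  by (simp_all only: real_scaleR_def)

text \<open>Derivatives at \<open>x\<close> see only the values on the open set \<open>U\<close>, so
  algebraic identities of \<open>g\<close> pass to \<open>dg\<close>.\<close>

lemma dg_eqI:
  assumes "x \<in> U" "(f has_derivative f') (at x)" "\<And>y. y \<in> U \<Longrightarrow> f y = g y u v"
  shows "dg x w u v = f' w"
proof -
  have "((\<lambda>y. g y u v) has_derivative f') (at x)"
    by (rule has_derivative_transform_within_open[OF assms(2) open_U assms(1,3)])
  from has_derivative_unique[OF g_has_derivative[OF assms(1)] this] show ?thesis
    by (rule fun_cong)
qed

lemma bilinear_dg:
  assumes "x \<in> U"
  shows "bilinear (dg x w)"
proof -
  note d = g_has_derivative[OF assms]
  have "dg x w (u + u') v = dg x w u v + dg x w u' v" for u u' v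
    using has_derivative_add[OF d d] by (rule dg_eqI[OF assms]) (simp add: g_bilinear_simps)
  moreover have "dg x w v (u + u') = dg x w v u + dg x w v u'" for u u' v
    using has_derivative_add[OF d d] by (rule dg_eqI[OF assms]) (simp add: g_bilinear_simps)
  moreover have "dg x w (a *\<^sub>R u) v = a * dg x w u v" for a u v
    using has_derivative_mult_right[OF d] by (rule dg_eqI[OF assms]) (simp add: g_bilinear_simps)
  moreover have "dg x w v (a *\<^sub>R u) = a * dg x w v u" for a u v
    using has_derivative_mult_right[OF d] by (rule dg_eqI[OF assms]) (simp add: g_bilinear_simps)
  ultimately show ?thesis
    unfolding bilinear_def by (auto intro!: linearI)
qed

lemma \<Gamma>_exists1:
  assumes "x \<in> U"
  shows "\<exists>!z. \<forall>w. 2 * g x z w = dg x u u w + dg x u u w - dg x w u u"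
proof (rule ex_ex1I)
  \<comment> \<open>The metric as an operator: \<open>A z\<close> represents \<open>g x z\<close>
    through the Euclidean inner product. Positivity makes \<open>A\<close> injective, hence
    surjective in finite dimension, so the functional \<open>k\<close> below is represented by some
    vector.\<close>
  define A where "A z = (\<Sum>j\<in>Basis. g x z j *\<^sub>R j)" for z
  have A_inner: "A z \<bullet> w = g x z w" for z w
  proof -
    have "g x z w = g x z (\<Sum>j\<in>Basis. (w \<bullet> j) *\<^sub>R j)"
      by (simp add: euclidean_representation)
    also have "\<dots> = (\<Sum>j\<in>Basis. (w \<bullet> j) * g x z j)"
      using bilinear_g[OF assms] unfolding bilinear_def by (simp add: linear_sum linear_cmul)
    finally show ?thesis
      by (simp add: A_def inner_sum_left inner_commute[of w] mult.commute)
  qed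
  have lin: "linear A"
    using assms by (auto intro!: linearI simp: A_def g_bilinear_simps sum.distrib scaleR_add_left scaleR_sum_right)
  moreover have "inj A"
    unfolding linear_injective_0[OF lin] using g_pos[OF assms] A_inner
    by (metis inner_zero_left order_less_irrefl)
  ultimately have "surj A"
    using linear_injective_imp_surjective by blast
  define k where "k w = (dg x u u w + dg x u u w - dg x w u u) / 2" for w
  have lk: "linear k"
    unfolding k_def
    by (auto intro!: linearI simp: linear_add[OF linear_dg1[OF assms]] linear_cmul[OF linear_dg1[OF assms]]
        bilinear_radd[OF bilinear_dg[OF assms]] bilinear_rmul[OF bilinear_dg[OF assms]] field_simps)
  obtain z where z: "A z = (\<Sum>j\<in>Basis. k j *\<^sub>R j)"
    using \<open>surj A\<close> by (metis surj_def)
  have "g x z w = k w" for w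
  proof -
    have "k w = k (\<Sum>j\<in>Basis. (w \<bullet> j) *\<^sub>R j)"
      by (simp add: euclidean_representation)
    also have "\<dots> = A z \<bullet> w"
      using lk by (simp add: z linear_sum linear_cmul inner_sum_left inner_commute[of w] mult.commute)
    finally show ?thesis using A_inner by simp
  qed
  then have "2 * g x z w = dg x u u w + dg x u u w - dg x w u u" for w
    unfolding k_def by (metis nonzero_mult_div_cancel_left times_divide_eq_right zero_neq_numeral)
  then show "\<exists>z. \<forall>w. 2 * g x z w = dg x u u w + dg x u u w - dg x w u u"
    by blast
next
  fix z z'
  assume "\<forall>w. 2 * g x z w = dg x u u w + dg x u u w - dg x w u u"
    "\<forall>w. 2 * g x z' w = dg x u u w + dg x u u w - dg x w u u"
  then have "2 * g x z (z - z') = 2 * g x z' (z - z')" by presburger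
  then have "g x (z - z') (z - z') = 0"
    by (simp add: g_bilinear_simps(3)[OF assms])
  then show "z = z'" using g_pos[OF assms, of "z - z'"] by fastforce
qed

lemma koszul: "x \<in> U \<Longrightarrow> 2 * g x (\<Gamma> x u) w = 2 * dg x u u w - dg x w u u"
  using theI'[OF \<Gamma>_exists1, of x u] unfolding \<Gamma>_def by auto

text \<open>The right-hand side of the Koszul formula is quadratic in \<open>u\<close>, and the
  representing vector is unique. Affine reparametrization of geodesics rests on this.\<close>

lemma \<Gamma>_scale:
  assumes "x \<in> U"
  shows "\<Gamma> x (a *\<^sub>R u) = a\<^sup>2 *\<^sub>R \<Gamma> x u"
proof -
  have "a\<^sup>2 * (2 * g x (\<Gamma> x u) w) = a\<^sup>2 * (2 * dg x u u w - dg x w u u)" for w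
    using koszul[OF assms] by simp
  then have "2 * g x (a\<^sup>2 *\<^sub>R \<Gamma> x u) w =
     dg x (a *\<^sub>R u) (a *\<^sub>R u) w + dg x (a *\<^sub>R u) (a *\<^sub>R u) w - dg x w (a *\<^sub>R u) (a *\<^sub>R u)" for w
    by (simp add: g_bilinear_simps[OF assms] linear_cmul[OF linear_dg1[OF assms]]
        bilinear_lmul[OF bilinear_dg[OF assms]] bilinear_rmul[OF bilinear_dg[OF assms]]
        power2_eq_square algebra_simps)
  then show ?thesis
    unfolding \<Gamma>_def[of x "a *\<^sub>R u"] using \<Gamma>_exists1[OF assms, of "a *\<^sub>R u"] by (intro the1_equality) auto
qed

section \<open>Uniform estimates over a closed ball\<close>

lemma g_bound_lipschitz:
  assumes D: "cball y R \<subseteq> U"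
  shows "\<exists>C. \<forall>x\<in>cball y R. \<forall>u v. \<bar>g x u v\<bar> \<le> C * (norm u * norm v)"
    "\<exists>C. \<forall>x\<in>cball y R. \<forall>x'\<in>cball y R. \<forall>u v. \<bar>g x u v - g x' u v\<bar> \<le> C * (norm (x - x') * norm u * norm v)"
proof -
  have 1: "\<exists>C. \<forall>x\<in>cball y R. \<bar>g x u v\<bar> \<le> C \<and> (\<forall>x'\<in>cball y R. \<bar>g x u v - g x' u v\<bar> \<le> C * norm (x - x'))" for u v
    using Ck_on_1_bounded_lipschitz[OF _ D] g_smooth smooth_on_def by blast
  have "\<exists>C. \<forall>x\<in>cball y R. \<forall>u v. \<bar>g x u v\<bar> \<le> C * (1 * norm u * norm v)"
  proof (rule bilinear_family_bound)
    fix i j :: 'e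
    show "\<exists>C. \<forall>s\<in>cball y R. \<bar>g s i j\<bar> \<le> C * 1"
      using 1[of i j] by (elim ex_forward) auto
  qed (use D bilinear_g in auto)
  then show "\<exists>C. \<forall>x\<in>cball y R. \<forall>u v. \<bar>g x u v\<bar> \<le> C * (norm u * norm v)" by simp
  \<comment> \<open>Indexing by pairs of points, with their distance as weight, turns the Lipschitz
    estimate into a bound for a bilinear family.\<close>
  have "\<exists>C. \<forall>s\<in>cball y R \<times> cball y R. \<forall>u v. \<bar>g (fst s) u v - g (snd s) u v\<bar> \<le>
      C * (norm (fst s - snd s) * norm u * norm v)"
  proof (rule bilinear_family_bound)
    fix s assume "s \<in> cball y R \<times> cball y R"
    then have "fst s \<in> U" "snd s \<in> U" using D by auto
    then show "bilinear (\<lambda>u v. g (fst s) u v - g (snd s) u v)"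
      using bilinear_g unfolding bilinear_def by (auto intro!: linear_compose_sub)
  next
    fix i j :: 'e
    show "\<exists>C. \<forall>s\<in>cball y R \<times> cball y R. \<bar>g (fst s) i j - g (snd s) i j\<bar> \<le> C * norm (fst s - snd s)"
      using 1[of i j] by (elim ex_forward) auto
  qed auto
  then show "\<exists>C. \<forall>x\<in>cball y R. \<forall>x'\<in>cball y R. \<forall>u v. \<bar>g x u v - g x' u v\<bar> \<le> C * (norm (x - x') * norm u * norm v)"
    by (elim ex_forward) auto
qed

lemma dg_bound_lipschitz:
  assumes D: "cball y R \<subseteq> U"
  shows "\<exists>C. \<forall>x\<in>cball y R. \<forall>w u v. \<bar>dg x w u v\<bar> \<le> C * (norm w * norm u * norm v)"
    "\<exists>C. \<forall>x\<in>cball y R. \<forall>x'\<in>cball y R. \<forall>w u v.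
       \<bar>dg x w u v - dg x' w u v\<bar> \<le> C * (norm (x - x') * norm w * norm u * norm v)"
proof -
  have "Ck_on 2 (\<lambda>x. g x u v) U" for u v using g_smooth smooth_on_def by blast
  then have "Ck_on 1 (\<lambda>x. dg x w u v) U" for w u v
    by (simp add: dg_def numeral_2_eq_2)
  then have 1: "\<exists>C. \<forall>x\<in>cball y R. \<bar>dg x w u v\<bar> \<le> C \<and> (\<forall>x'\<in>cball y R. \<bar>dg x w u v - dg x' w u v\<bar> \<le> C * norm (x - x'))" for w u v
    using Ck_on_1_bounded_lipschitz[OF _ D] by blast
  have 2: "\<exists>C. \<forall>s\<in>cball y R. \<forall>w. \<bar>dg s w u v\<bar> \<le> C * (1 * norm w)" for u v
  proof (rule linear_family_bound)
    fix i :: 'e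
    show "\<exists>C. \<forall>s\<in>cball y R. \<bar>dg s i u v\<bar> \<le> C * 1"
      using 1[of i u v] by (elim ex_forward) auto
  qed (use D linear_dg1 in auto)
  have "\<exists>C. \<forall>s\<in>cball y R \<times> UNIV. \<forall>u v. \<bar>dg (fst s) (snd s) u v\<bar> \<le> C * (norm (snd s) * norm u * norm v)"
  proof (rule bilinear_family_bound)
    fix i j :: 'e
    show "\<exists>C. \<forall>s\<in>cball y R \<times> UNIV. \<bar>dg (fst s) (snd s) i j\<bar> \<le> C * norm (snd s)"
      using 2[of i j] by (elim ex_forward) auto
  qed (use D bilinear_dg in auto)
  then show "\<exists>C. \<forall>x\<in>cball y R. \<forall>w u v. \<bar>dg x w u v\<bar> \<le> C * (norm w * norm u * norm v)"
    by (elim ex_forward) auto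
  have 3: "\<exists>C. \<forall>s\<in>cball y R \<times> cball y R. \<forall>w. \<bar>dg (fst s) w u v - dg (snd s) w u v\<bar> \<le> C * (norm (fst s - snd s) * norm w)" for u v
  proof (rule linear_family_bound)
    fix i :: 'e
    show "\<exists>C. \<forall>s\<in>cball y R \<times> cball y R. \<bar>dg (fst s) i u v - dg (snd s) i u v\<bar> \<le> C * norm (fst s - snd s)"
      using 1[of i u v] by (elim ex_forward) auto
  next
    fix s assume "s \<in> cball y R \<times> cball y R"
    then have "fst s \<in> U" "snd s \<in> U" using D by auto
    then show "linear (\<lambda>w. dg (fst s) w u v - dg (snd s) w u v)"
      by (intro linear_compose_sub linear_dg1)
  qed auto
  have "\<exists>C. \<forall>s\<in>(cball y R \<times> cball y R) \<times> UNIV. \<forall>u v. \<bar>dg (fst (fst s)) (snd s) u v - dg (snd (fst s)) (snd s) u v\<bar> \<le>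
      C * ((norm (fst (fst s) - snd (fst s)) * norm (snd s)) * norm u * norm v)"
  proof (rule bilinear_family_bound)
    fix s assume "s \<in> (cball y R \<times> cball y R) \<times> (UNIV :: 'e set)"
    then have "fst (fst s) \<in> U" "snd (fst s) \<in> U" using D by auto
    then show "bilinear (\<lambda>u v. dg (fst (fst s)) (snd s) u v - dg (snd (fst s)) (snd s) u v)"
      using bilinear_dg unfolding bilinear_def by (auto intro!: linear_compose_sub)
  next
    fix i j :: 'e
    show "\<exists>C. \<forall>s\<in>(cball y R \<times> cball y R) \<times> UNIV.
      \<bar>dg (fst (fst s)) (snd s) i j - dg (snd (fst s)) (snd s) i j\<bar> \<le> C * (norm (fst (fst s) - snd (fst s)) * norm (snd s))"
      using 3[of i j] by auto
  qed auto
  then show "\<exists>C. \<forall>x\<in>cball y R. \<forall>x'\<in>cball y R. \<forall>w u v.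
       \<bar>dg x w u v - dg x' w u v\<bar> \<le> C * (norm (x - x') * norm w * norm u * norm v)"
    by (elim ex_forward) auto
qed

text \<open>Minimize \<open>g\<close> over the compact set of unit vectors at points of the ball,
  then extend to all vectors by homogeneity.\<close>

lemma g_coercive:
  assumes D: "cball y R \<subseteq> U"
  shows "\<exists>C. \<forall>x\<in>cball y R. \<forall>u. (norm u)\<^sup>2 \<le> C * g x u u"
proof -
  have cont: "continuous_on (cball y R) (\<lambda>x. g x u v)" for u v
    using D by (intro continuous_at_imp_continuous_on ballI has_derivative_continuous[OF g_has_derivative]) auto
  have "continuous_on (cball y R \<times> sphere 0 1) (\<lambda>s. g (fst s) (snd s) (snd s))"
  proof -
    have "continuous_on (cball y R \<times> sphere 0 1)
       (\<lambda>s. \<Sum>i\<in>Basis. \<Sum>j\<in>Basis. (snd s \<bullet> i) * (snd s \<bullet> j) * g (fst s) i j)"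
      by (intro continuous_intros continuous_on_compose2[OF cont]) auto
    then show ?thesis
      using D by (subst continuous_on_cong[OF refl]) (auto intro!: bilinear_expansion bilinear_g)
  qed
  moreover have "compact (cball y R \<times> sphere (0::'e) 1)"
    by (simp add: compact_Times)
  ultimately have comp: "compact ((\<lambda>s. g (fst s) (snd s) (snd s)) ` (cball y R \<times> sphere 0 1))"
    using compact_continuous_image by blast
  show ?thesis
  proof (cases "cball y R \<times> sphere (0::'e) 1 = {}")
    \<comment> \<open>Unit vectors exist, so here the ball itself is empty and the claim is
      vacuous.\<close>
    case True
    have "\<exists>v::'e. norm v = 1" using norm_Basis SOME_Basis by blast
    then have "cball y R = {}" using True by auto
    then show ?thesis by blast
  next
    case False
    then obtain s where s: "s \<in> cball y R \<times> sphere 0 1"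
      and min: "\<And>t. t \<in> cball y R \<times> sphere 0 1 \<Longrightarrow> g (fst s) (snd s) (snd s) \<le> g (fst t) (snd t) (snd t)"
      using compact_attains_inf[OF comp] by auto
    define c where "c = g (fst s) (snd s) (snd s)"
    have "c > 0" using s D unfolding c_def by (intro g_pos) auto
    have "(norm u)\<^sup>2 \<le> (1 / c) * g x u u" if x: "x \<in> cball y R" for x u
    proof (cases "u = 0")
      case True
      then show ?thesis using x D by (auto simp: g_bilinear_simps)
    next
      case False
      have "c \<le> g x ((1 / norm u) *\<^sub>R u) ((1 / norm u) *\<^sub>R u)"
        using min[of "(x, (1 / norm u) *\<^sub>R u)"] x False unfolding c_def by simp
      also have "\<dots> = g x u u / (norm u)\<^sup>2"
        using x D by (auto simp: g_bilinear_simps power2_eq_square)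
      finally show ?thesis using \<open>c > 0\<close> False by (simp add: field_simps)
    qed
    then show ?thesis by blast
  qed
qed

text \<open>The remainder is of second order because \<open>dg\<close> is Lipschitz: along the
  segment it varies by at most a multiple of the length of the segment.\<close>

lemma g_taylor:
  assumes D: "cball y R \<subseteq> U"
  shows "\<exists>C. \<forall>x\<in>cball y R. \<forall>x'\<in>cball y R. \<forall>u.
      \<bar>g x' u u - g x u u - dg x (x' - x) u u\<bar> \<le> C * ((norm (x' - x))\<^sup>2 * (norm u)\<^sup>2)"
proof -
  obtain C where C: "\<And>x x' w u v. x \<in> cball y R \<Longrightarrow> x' \<in> cball y R \<Longrightarrow>
       \<bar>dg x w u v - dg x' w u v\<bar> \<le> C * (norm (x - x') * norm w * norm u * norm v)"
    using dg_bound_lipschitz(2)[OF D] by blast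
  have "\<bar>g b u u - g a u u - dg a (b - a) u u\<bar> \<le> \<bar>C\<bar> * ((norm (b - a))\<^sup>2 * (norm u)\<^sup>2)"
    if a: "a \<in> cball y R" and b: "b \<in> cball y R" for a b u
  proof -
    have sub: "closed_segment a b \<subseteq> cball y R"
      using a b by (simp add: closed_segment_subset)
    have "norm (g b u u - g a u u - dg a (b - a) u u) \<le> norm (b - a) * (\<bar>C\<bar> * (norm (b - a) * (norm u)\<^sup>2))"
    proof (rule differentiable_bound_linearization[where S = "closed_segment a b" and f = "\<lambda>x. g x u u" and f' = "\<lambda>x w. dg x w u u"])
      show "a + t *\<^sub>R (b - a) \<in> closed_segment a b" if "t \<in> {0..1}" for t
        using that by (auto simp: closed_segment_def algebra_simps intro!: exI[of _ t])
      fix x assume x: "x \<in> closed_segment a b"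
      then show "((\<lambda>x. g x u u) has_derivative (\<lambda>w. dg x w u u)) (at x within closed_segment a b)"
        using g_has_derivative sub D has_derivative_at_withinI by blast
      have "norm (x - a) \<le> norm (b - a)"
        using x segment_bound(1) by blast
      then have "\<bar>C\<bar> * (norm (x - a) * (norm u)\<^sup>2) \<le> \<bar>C\<bar> * (norm (b - a) * (norm u)\<^sup>2)"
        by (intro mult_left_mono mult_right_mono) auto
      moreover have "\<bar>dg x w u u - dg a w u u\<bar> \<le> (\<bar>C\<bar> * (norm (x - a) * (norm u)\<^sup>2)) * norm w" for w
      proof -
        have "\<bar>dg x w u u - dg a w u u\<bar> \<le> C * (norm (x - a) * norm w * norm u * norm u)"
          using C[of x a w u u] x a sub by blast
        also have "\<dots> \<le> \<bar>C\<bar> * (norm (x - a) * norm w * norm u * norm u)"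
          by (intro mult_right_mono) auto
        finally show ?thesis by (simp add: power2_eq_square mult_ac)
      qed
      ultimately have "\<bar>dg x w u u - dg a w u u\<bar> \<le> (\<bar>C\<bar> * (norm (b - a) * (norm u)\<^sup>2)) * norm w" for w
        by (meson mult_right_mono norm_ge_zero order_trans)
      then show "onorm ((\<lambda>w. dg x w u u) - (\<lambda>w. dg a w u u)) \<le> \<bar>C\<bar> * (norm (b - a) * (norm u)\<^sup>2)"
        by (intro onorm_le) (simp add: fun_diff_def)
    qed auto
    then show ?thesis by (simp add: power2_eq_square mult_ac)
  qed
  then show ?thesis by blast
qed

text \<open>Subtract the Koszul identities of the two vectors, test with their difference
  \<open>w\<close> and apply coercivity; one factor \<open>norm w\<close> cancels. The powers of
  \<open>\<rho>\<close> are what makes slow geodesics nearly straight.\<close>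

lemma \<Gamma>_lipschitz:
  assumes D: "cball y R \<subseteq> U"
  shows "\<exists>C. \<forall>x\<in>cball y R. \<forall>x'\<in>cball y R. \<forall>u u' \<rho>. norm u \<le> \<rho> \<longrightarrow> norm u' \<le> \<rho> \<longrightarrow>
      norm (\<Gamma> x u - \<Gamma> x' u') \<le> C * (\<rho>\<^sup>2 * norm (x - x') + \<rho> * norm (u - u'))"
proof -
  obtain A where A: "\<And>x u. x \<in> cball y R \<Longrightarrow> (norm u)\<^sup>2 \<le> A * g x u u"
    using g_coercive[OF D] by blast
  obtain B where B: "\<And>x x' u v. x \<in> cball y R \<Longrightarrow> x' \<in> cball y R \<Longrightarrow>
      \<bar>g x u v - g x' u v\<bar> \<le> B * (norm (x - x') * norm u * norm v)"
    using g_bound_lipschitz(2)[OF D] by blast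
  obtain C where C: "\<And>x w u v. x \<in> cball y R \<Longrightarrow> \<bar>dg x w u v\<bar> \<le> C * (norm w * norm u * norm v)"
    using dg_bound_lipschitz(1)[OF D] by blast
  obtain E where E: "\<And>x x' w u v. x \<in> cball y R \<Longrightarrow> x' \<in> cball y R \<Longrightarrow>
       \<bar>dg x w u v - dg x' w u v\<bar> \<le> E * (norm (x - x') * norm w * norm u * norm v)"
    using dg_bound_lipschitz(2)[OF D] by blast
  define K where "K = \<bar>A\<bar> + \<bar>B\<bar> + \<bar>C\<bar> + \<bar>E\<bar>"
  have K: "0 \<le> K" "A \<le> K" "B \<le> K" "C \<le> K" "E \<le> K" unfolding K_def by auto
  have cancel: "n \<le> c" if "n\<^sup>2 \<le> c * n" "0 \<le> n" "0 \<le> c" for n c :: real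
    using that by (cases "n = 0") (auto simp: power2_eq_square)
  have "norm (\<Gamma> x u - \<Gamma> x' u') \<le> (6 * K\<^sup>2 + 4 * K ^ 4) * (\<rho>\<^sup>2 * norm (x - x') + \<rho> * norm (u - u'))"
    if x: "x \<in> cball y R" "x' \<in> cball y R" and u: "norm u \<le> \<rho>" "norm u' \<le> \<rho>" for x x' u u' \<rho>
  proof -
    have xU: "x \<in> U" "x' \<in> U" using x D by auto
    have \<rho>: "0 \<le> \<rho>" using u norm_ge_zero order_trans by blast
    have gK: "(norm w)\<^sup>2 \<le> K * g z w w" if "z \<in> cball y R" for w z
    proof -
      have "0 \<le> g z w w" using g_pos[of z w] that D by (cases "w = 0") (auto simp: g_bilinear_simps less_imp_le)
      then show ?thesis using A[OF that, of w] mult_right_mono[OF K(2)] by (meson order_trans)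
    qed
    have dK: "\<bar>dg z w a b\<bar> \<le> K * (\<alpha> * \<beta> * \<gamma>)" if "z \<in> cball y R" "norm w \<le> \<alpha>" "norm a \<le> \<beta>" "norm b \<le> \<gamma>" for z w a b \<alpha> \<beta> \<gamma>
    proof -
      have "0 \<le> \<alpha>" "0 \<le> \<beta>" "0 \<le> \<gamma>" using that norm_ge_zero order_trans by blast+
      then have "C * (norm w * norm a * norm b) \<le> K * (\<alpha> * \<beta> * \<gamma>)"
        using that K by (intro mult_mono) auto
      then show ?thesis using C[OF that(1), of w a b] by linarith
    qed
    have eK: "\<bar>dg x w a b - dg x' w a b\<bar> \<le> K * (norm (x - x') * \<alpha> * \<beta> * \<gamma>)" if "norm w \<le> \<alpha>" "norm a \<le> \<beta>" "norm b \<le> \<gamma>" for w a b \<alpha> \<beta> \<gamma>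
    proof -
      have "0 \<le> \<alpha>" "0 \<le> \<beta>" "0 \<le> \<gamma>" using that norm_ge_zero order_trans by blast+
      then have "E * (norm (x - x') * norm w * norm a * norm b) \<le> K * (norm (x - x') * \<alpha> * \<beta> * \<gamma>)"
        using that K by (intro mult_mono) auto
      then show ?thesis using E[OF x, of w a b] by linarith
    qed
    define z z' w where "z = \<Gamma> x u" and "z' = \<Gamma> x' u'" and "w = z - z'"
    define n d e where "n = norm w" and "d = norm (x - x')" and "e = norm (u - u')"
    have n: "0 \<le> n" "0 \<le> d" "0 \<le> e" unfolding n_def d_def e_def by auto
    \<comment> \<open>The size of \<open>z'\<close> matters because its Koszul identity holds at
      \<open>x'\<close>; evaluating it with the metric at \<open>x\<close> costs a term proportional
      to \<open>norm z'\<close>.\<close>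
    have z': "norm z' \<le> 2 * K\<^sup>2 * \<rho>\<^sup>2"
    proof (rule cancel)
      have "2 * g x' z' z' \<le> 3 * (K * (\<rho> * \<rho> * norm z'))"
        using koszul[OF xU(2), of u' z'] dK[OF x(2) u(2) u(2), of z' "norm z'"]
          dK[OF x(2) _ u(2) u(2), of z' "norm z'"] unfolding z'_def by (simp add: mult_ac)
      moreover have "0 \<le> K * (\<rho> * \<rho> * norm z')"
        using K \<rho> by simp
      ultimately have "g x' z' z' \<le> 2 * (K * (\<rho> * \<rho> * norm z'))"
        by linarith
      then have "K * g x' z' z' \<le> K * (2 * (K * (\<rho> * \<rho> * norm z')))"
        using K by (intro mult_left_mono)
      moreover have "(norm z')\<^sup>2 \<le> K * g x' z' z'" using gK x by blast
      ultimately show "(norm z')\<^sup>2 \<le> 2 * K\<^sup>2 * \<rho>\<^sup>2 * norm z'"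
        by (simp add: power2_eq_square mult_ac)
    qed auto
    have "n \<le> K * (3 * K * d * \<rho>\<^sup>2 + 6 * K * \<rho> * e + 4 * K ^ 3 * \<rho>\<^sup>2 * d)"
    proof (rule cancel)
      have "2 * g x w w = (2 * g x z w - 2 * g x' z' w) + 2 * (g x' z' w - g x z' w)"
        unfolding w_def using xU by (simp add: g_bilinear_simps)
      moreover have "2 * g x z w - 2 * g x' z' w = 2 * (dg x u u w - dg x' u' u' w) - (dg x w u u - dg x' w u' u')"
        using koszul xU unfolding z_def z'_def by simp
      moreover have "dg x u u w - dg x' u' u' w = (dg x u u w - dg x' u u w) + dg x' (u - u') u w + dg x' u' (u - u') w"
        using linear_diff[OF linear_dg1[OF xU(2)], of u u' u w] bilinear_lsub[OF bilinear_dg[OF xU(2)], of u' u u' w] by simp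
      moreover have "dg x w u u - dg x' w u' u' = (dg x w u u - dg x' w u u) + dg x' w (u - u') u + dg x' w u' (u - u')"
        using bilinear_lsub[OF bilinear_dg[OF xU(2)], of w u u' u] bilinear_rsub[OF bilinear_dg[OF xU(2)], of w u' u u'] by simp
      moreover have "\<bar>dg x u u w - dg x' u u w\<bar> \<le> K * (d * \<rho> * \<rho> * n)" "\<bar>dg x w u u - dg x' w u u\<bar> \<le> K * (d * n * \<rho> * \<rho>)"
        unfolding d_def n_def by (intro eK u order_refl)+
      moreover have "\<bar>dg x' (u - u') u w\<bar> \<le> K * (e * \<rho> * n)" "\<bar>dg x' u' (u - u') w\<bar> \<le> K * (\<rho> * e * n)"
        "\<bar>dg x' w (u - u') u\<bar> \<le> K * (n * e * \<rho>)" "\<bar>dg x' w u' (u - u')\<bar> \<le> K * (n * \<rho> * e)"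
        unfolding e_def n_def by (intro dK u x order_refl)+
      moreover have "\<bar>g x' z' w - g x z' w\<bar> \<le> K * (d * (2 * K\<^sup>2 * \<rho>\<^sup>2) * n)"
      proof -
        have "B * (norm (x' - x) * norm z' * norm w) \<le> K * (d * (2 * K\<^sup>2 * \<rho>\<^sup>2) * n)"
          unfolding d_def n_def using K z' by (intro mult_mono) (auto simp: norm_minus_commute)
        then show ?thesis using B[OF x(2) x(1), of z' w] by linarith
      qed
      ultimately have "2 * g x w w \<le> 3 * (K * (d * \<rho> * \<rho> * n)) + 6 * (K * (e * \<rho> * n)) + 2 * (K * (d * (2 * K\<^sup>2 * \<rho>\<^sup>2) * n))"
        by (simp add: mult_ac abs_le_iff)
      moreover have "0 \<le> g x w w"
        using g_pos[OF xU(1), of w] xU by (cases "w = 0") (auto simp: g_bilinear_simps less_imp_le)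
      ultimately have "g x w w \<le> 3 * (K * (d * \<rho> * \<rho> * n)) + 6 * (K * (e * \<rho> * n)) + 2 * (K * (d * (2 * K\<^sup>2 * \<rho>\<^sup>2) * n))"
        by linarith
      then have "K * g x w w \<le> K * (3 * (K * (d * \<rho> * \<rho> * n)) + 6 * (K * (e * \<rho> * n)) + 2 * (K * (d * (2 * K\<^sup>2 * \<rho>\<^sup>2) * n)))"
        using K by (intro mult_left_mono)
      moreover have "n\<^sup>2 \<le> K * g x w w" unfolding n_def using gK x by blast
      ultimately show "n\<^sup>2 \<le> K * (3 * K * d * \<rho>\<^sup>2 + 6 * K * \<rho> * e + 4 * K ^ 3 * \<rho>\<^sup>2 * d) * n"
        by (simp add: power2_eq_square power3_eq_cube algebra_simps)
    qed (use n K \<rho> in auto)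
    also have "\<dots> \<le> (6 * K\<^sup>2 + 4 * K ^ 4) * (\<rho>\<^sup>2 * d + \<rho> * e)"
    proof -
      have "0 \<le> 3 * K\<^sup>2 * (d * \<rho>\<^sup>2)" "0 \<le> 4 * K ^ 4 * (\<rho> * e)" using n K \<rho> by auto
      then show ?thesis by (simp add: algebra_simps power2_eq_square power4_eq_xxxx power3_eq_cube)
    qed
    finally show ?thesis
      unfolding n_def w_def z_def z'_def d_def e_def .
  qed
  then show ?thesis by (intro exI[of _ "6 * K\<^sup>2 + 4 * K ^ 4"]) (auto simp: mult_ac)
qed

lemma uniform_estimates:
  assumes D: "cball y R \<subseteq> U"
  obtains K where "1 \<le> K"
    "\<And>x u. x \<in> cball y R \<Longrightarrow> (norm u)\<^sup>2 \<le> K * g x u u"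
    "\<And>x u v. x \<in> cball y R \<Longrightarrow> \<bar>g x u v\<bar> \<le> K * (norm u * norm v)"
    "\<And>x x' u v. x \<in> cball y R \<Longrightarrow> x' \<in> cball y R \<Longrightarrow>
      \<bar>g x u v - g x' u v\<bar> \<le> K * (norm (x - x') * norm u * norm v)"
    "\<And>x x' u. x \<in> cball y R \<Longrightarrow> x' \<in> cball y R \<Longrightarrow>
      \<bar>g x' u u - g x u u - dg x (x' - x) u u\<bar> \<le> K * ((norm (x' - x))\<^sup>2 * (norm u)\<^sup>2)"
    "\<And>x x' u u' \<rho>. x \<in> cball y R \<Longrightarrow> x' \<in> cball y R \<Longrightarrow> norm u \<le> \<rho> \<Longrightarrow> norm u' \<le> \<rho> \<Longrightarrow>
      norm (\<Gamma> x u - \<Gamma> x' u') \<le> K * (\<rho>\<^sup>2 * norm (x - x') + \<rho> * norm (u - u'))"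
proof -
  obtain A where A: "\<And>x u. x \<in> cball y R \<Longrightarrow> (norm u)\<^sup>2 \<le> A * g x u u"
    using g_coercive[OF D] by blast
  obtain B where B: "\<And>x u v. x \<in> cball y R \<Longrightarrow> \<bar>g x u v\<bar> \<le> B * (norm u * norm v)"
    using g_bound_lipschitz(1)[OF D] by blast
  obtain C where C: "\<And>x x' u v. x \<in> cball y R \<Longrightarrow> x' \<in> cball y R \<Longrightarrow>
      \<bar>g x u v - g x' u v\<bar> \<le> C * (norm (x - x') * norm u * norm v)"
    using g_bound_lipschitz(2)[OF D] by blast
  obtain E where E: "\<And>x x' u. x \<in> cball y R \<Longrightarrow> x' \<in> cball y R \<Longrightarrow>
      \<bar>g x' u u - g x u u - dg x (x' - x) u u\<bar> \<le> E * ((norm (x' - x))\<^sup>2 * (norm u)\<^sup>2)"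
    using g_taylor[OF D] by blast
  obtain F where F: "\<And>x x' u u' \<rho>. x \<in> cball y R \<Longrightarrow> x' \<in> cball y R \<Longrightarrow> norm u \<le> \<rho> \<Longrightarrow> norm u' \<le> \<rho> \<Longrightarrow>
      norm (\<Gamma> x u - \<Gamma> x' u') \<le> F * (\<rho>\<^sup>2 * norm (x - x') + \<rho> * norm (u - u'))"
    using \<Gamma>_lipschitz[OF D] by blast
  define K where "K = 1 + \<bar>A\<bar> + \<bar>B\<bar> + \<bar>C\<bar> + \<bar>E\<bar> + \<bar>F\<bar>"
  have K: "1 \<le> K" "A \<le> K" "B \<le> K" "C \<le> K" "E \<le> K" "F \<le> K" unfolding K_def by auto
  show ?thesis
  proof (rule that[OF K(1)])
    fix x u :: 'e assume x: "x \<in> cball y R"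
    have "0 \<le> g x u u"
      using g_pos[of x u] x D by (cases "u = 0") (auto simp: g_bilinear_simps less_imp_le)
    then show "(norm u)\<^sup>2 \<le> K * g x u u"
      using A[OF x, of u] mult_right_mono[OF K(2)] by (meson order_trans)
  next
    fix x u v :: 'e assume "x \<in> cball y R"
    then show "\<bar>g x u v\<bar> \<le> K * (norm u * norm v)"
      by (intro order_trans[OF B] mult_right_mono K) auto
  next
    fix x x' u v :: 'e assume "x \<in> cball y R" "x' \<in> cball y R"
    then show "\<bar>g x u v - g x' u v\<bar> \<le> K * (norm (x - x') * norm u * norm v)"
      by (intro order_trans[OF C] mult_right_mono K) auto
  next
    fix x x' u :: 'e assume "x \<in> cball y R" "x' \<in> cball y R"
    then show "\<bar>g x' u u - g x u u - dg x (x' - x) u u\<bar> \<le> K * ((norm (x' - x))\<^sup>2 * (norm u)\<^sup>2)"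
      by (intro order_trans[OF E] mult_right_mono K) auto
  next
    fix x x' u u' :: 'e and \<rho> :: real
    assume x: "x \<in> cball y R" "x' \<in> cball y R" and u: "norm u \<le> \<rho>" "norm u' \<le> \<rho>"
    have "0 \<le> \<rho>" using u norm_ge_zero order_trans by blast
    then have "F * (\<rho>\<^sup>2 * norm (x - x') + \<rho> * norm (u - u')) \<le> K * (\<rho>\<^sup>2 * norm (x - x') + \<rho> * norm (u - u'))"
      by (intro mult_right_mono[OF K(6)]) simp
    then show "norm (\<Gamma> x u - \<Gamma> x' u') \<le> K * (\<rho>\<^sup>2 * norm (x - x') + \<rho> * norm (u - u'))"
      using F[OF x u] by linarith
  qed
qed

section \<open>Derivatives along curves and the geodesic equation in coordinates\<close>

lemma g_curve_derivative:
  assumes x: "(x has_vector_derivative x') (at t)" and v: "(v has_vector_derivative v') (at t)"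
    and h: "(h has_vector_derivative h') (at t)" and U: "x t \<in> U"
  shows "((\<lambda>s. g (x s) (v s) (h s)) has_real_derivative
     dg (x t) x' (v t) (h t) + g (x t) v' (h t) + g (x t) (v t) h') (at t)"
proof -
  have gij: "((\<lambda>s. g (x s) i j) has_real_derivative dg (x t) x' i j) (at t)" for i j
  proof -
    have "((\<lambda>y. g y i j) \<circ> x has_vector_derivative dg (x t) x' i j) (at t)"
      by (rule vector_derivative_diff_chain_within[OF x has_derivative_at_withinI[OF g_has_derivative[OF U]]])
    then show ?thesis
      by (simp add: has_real_derivative_iff_has_vector_derivative o_def)
  qed
  have vi: "((\<lambda>s. v s \<bullet> i) has_real_derivative v' \<bullet> i) (at t)" for i
    using bounded_linear.has_vector_derivative[OF bounded_linear_inner_left v]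
    by (simp add: has_real_derivative_iff_has_vector_derivative)
  have hi: "((\<lambda>s. h s \<bullet> i) has_real_derivative h' \<bullet> i) (at t)" for i
    using bounded_linear.has_vector_derivative[OF bounded_linear_inner_left h]
    by (simp add: has_real_derivative_iff_has_vector_derivative)
  have "((\<lambda>s. \<Sum>i\<in>Basis. \<Sum>j\<in>Basis. (v s \<bullet> i) * (h s \<bullet> j) * g (x s) i j) has_real_derivative
      (\<Sum>i\<in>Basis. \<Sum>j\<in>Basis. (v' \<bullet> i * (h t \<bullet> j) + h' \<bullet> j * (v t \<bullet> i)) * g (x t) i j +
         dg (x t) x' i j * ((v t \<bullet> i) * (h t \<bullet> j)))) (at t)"
    by (intro DERIV_sum DERIV_mult vi hi gij)
  also have "(\<Sum>i\<in>Basis. \<Sum>j\<in>Basis. (v' \<bullet> i * (h t \<bullet> j) + h' \<bullet> j * (v t \<bullet> i)) * g (x t) i j +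
         dg (x t) x' i j * ((v t \<bullet> i) * (h t \<bullet> j))) =
      dg (x t) x' (v t) (h t) + g (x t) v' (h t) + g (x t) (v t) h'"
    unfolding bilinear_expansion[OF bilinear_g[OF U], of v'] bilinear_expansion[OF bilinear_g[OF U], of "v t"]
      bilinear_expansion[OF bilinear_dg[OF U], of _ "v t"]
    by (simp add: sum.distrib algebra_simps)
  finally have "((\<lambda>s. \<Sum>i\<in>Basis. \<Sum>j\<in>Basis. (v s \<bullet> i) * (h s \<bullet> j) * g (x s) i j) has_real_derivative
      dg (x t) x' (v t) (h t) + g (x t) v' (h t) + g (x t) (v t) h') (at t)" .
  moreover have "isCont x t"
    using x by (rule has_vector_derivative_continuous)
  then have "\<forall>\<^sub>F s in nhds t. x s \<in> U"
    using topological_tendstoD[OF _ open_U U] by (simp add: isCont_def tendsto_at_iff_tendsto_nhds)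
  then have "\<forall>\<^sub>F s in nhds t. (\<Sum>i\<in>Basis. \<Sum>j\<in>Basis. (v s \<bullet> i) * (h s \<bullet> j) * g (x s) i j) = g (x s) (v s) (h s)"
    by (rule eventually_mono) (rule bilinear_expansion[OF bilinear_g, symmetric])
  ultimately show ?thesis
    by (subst DERIV_cong_ev[OF refl _ refl, symmetric])
qed

definition coord_geodesic :: "(real \<Rightarrow> 'e) \<Rightarrow> (real \<Rightarrow> 'e) \<Rightarrow> real \<Rightarrow> bool" where
  "coord_geodesic x v t \<longleftrightarrow> x t \<in> U \<and> (x has_vector_derivative v t) (at t) \<and>
     (v has_vector_derivative - \<Gamma> (x t) (v t)) (at t)"

text \<open>The Koszul formula turns the geodesic equation into the Euler--Lagrange equation of the energy.\<close>

lemma momentum_derivative: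
  assumes "coord_geodesic x v t" and h: "(h has_vector_derivative h') (at t)"
  shows "((\<lambda>s. 2 * g (x s) (v s) (h s)) has_real_derivative
     dg (x t) (h t) (v t) (v t) + 2 * g (x t) (v t) h') (at t)"
proof -
  have U: "x t \<in> U" using assms coord_geodesic_def by blast
  have "((\<lambda>s. 2 * g (x s) (v s) (h s)) has_real_derivative
     2 * (dg (x t) (v t) (v t) (h t) + g (x t) (- \<Gamma> (x t) (v t)) (h t) + g (x t) (v t) h')) (at t)"
    using assms unfolding coord_geodesic_def by (intro DERIV_cmult g_curve_derivative) auto
  then show ?thesis
    using koszul[OF U, of "v t" "h t"] by (simp add: g_bilinear_simps[OF U] algebra_simps)
qed

text \<open>The Koszul formula tested with the velocity itself shows that the two Christoffel terms
  cancel the derivative of the metric.\<close>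

lemma speed_derivative:
  assumes "coord_geodesic x v t"
  shows "((\<lambda>s. g (x s) (v s) (v s)) has_real_derivative 0) (at t)"
proof -
  have U: "x t \<in> U" using assms coord_geodesic_def by blast
  have "((\<lambda>s. g (x s) (v s) (v s)) has_real_derivative
     (dg (x t) (v t) (v t) (v t) + g (x t) (- \<Gamma> (x t) (v t)) (v t) + g (x t) (v t) (- \<Gamma> (x t) (v t)))) (at t)"
    using assms unfolding coord_geodesic_def by (intro g_curve_derivative) auto
  then show ?thesis
    using koszul[OF U, of "v t" "v t"] g_sym[OF U, of "v t"] by (simp add: g_bilinear_simps[OF U])
qed

end

section \<open>Slow geodesics in a coordinate ball\<close>

text \<open>The mean value inequality for \<open>f\<close> minus the uniform motion with velocity
  \<open>c\<close>.\<close>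

lemma curve_deviation_bound:
  fixes f :: "real \<Rightarrow> 'e::real_normed_vector"
  assumes f: "\<And>s. s \<in> {0..1} \<Longrightarrow> (f has_vector_derivative f' s) (at s)"
    and B: "\<And>s. s \<in> {0..1} \<Longrightarrow> norm (f' s - c) \<le> B" and t: "t \<in> {0..1}"
  shows "norm (f t - f 0 - t *\<^sub>R c) \<le> B"
proof -
  define F where "F s = f s - s *\<^sub>R c" for s
  have F: "(F has_derivative (\<lambda>h. h *\<^sub>R (f' s - c))) (at s within {0..1})" if s: "s \<in> {0..1}" for s
  proof -
    have "(F has_vector_derivative f' s - (s *\<^sub>R 0 + 1 *\<^sub>R c)) (at s)"
      unfolding F_def[abs_def]
      by (rule has_vector_derivative_diff[OF f[OF s] has_vector_derivative_scaleR[OF DERIV_ident has_vector_derivative_const]])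
    then show ?thesis
      unfolding has_vector_derivative_def by (simp add: has_derivative_at_withinI)
  qed
  have on: "onorm (\<lambda>h. h *\<^sub>R (f' s - c)) \<le> B" if s: "s \<in> {0..1}" for s
  proof (rule onorm_le)
    show "norm (h *\<^sub>R (f' s - c)) \<le> B * norm h" for h
      using mult_right_mono[OF B[OF s], of "\<bar>h\<bar>"] by (simp add: mult.commute)
  qed
  have "norm (F t - F 0) \<le> B * norm (t - 0)"
    by (rule differentiable_bound[OF convex_closed_interval F on]) (use t in auto)
  also have "\<dots> \<le> B * 1"
  proof (rule mult_left_mono)
    show "0 \<le> B" using order_trans[OF norm_ge_zero B[OF t]] .
  qed (use t in simp)
  finally show ?thesis by (simp add: F_def algebra_simps)
qed

text \<open>One constant serves all estimates; \<open>K_ge_1\<close> allows lower powers of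
  \<open>K\<close> to be absorbed into higher ones.\<close>

locale chart_ball = coordinate_metric U g
  for U :: "'e::euclidean_space set" and g :: "'e \<Rightarrow> 'e \<Rightarrow> 'e \<Rightarrow> real" +
  fixes y :: 'e and R K :: real
  assumes R_pos: "0 < R" and K_ge_1: "1 \<le> K" and cball_subset: "cball y R \<subseteq> U"
    and coercive: "x \<in> cball y R \<Longrightarrow> (norm u)\<^sup>2 \<le> K * g x u u"
    and g_bound: "x \<in> cball y R \<Longrightarrow> \<bar>g x u v\<bar> \<le> K * (norm u * norm v)"
    and g_lipschitz: "x \<in> cball y R \<Longrightarrow> x' \<in> cball y R \<Longrightarrow>
      \<bar>g x u v - g x' u v\<bar> \<le> K * (norm (x - x') * norm u * norm v)"
    and g_quadratic: "x \<in> cball y R \<Longrightarrow> x' \<in> cball y R \<Longrightarrow>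
      \<bar>g x' u u - g x u u - dg x (x' - x) u u\<bar> \<le> K * ((norm (x' - x))\<^sup>2 * (norm u)\<^sup>2)"
    and \<Gamma>_lip: "x \<in> cball y R \<Longrightarrow> x' \<in> cball y R \<Longrightarrow> norm u \<le> \<rho> \<Longrightarrow> norm u' \<le> \<rho> \<Longrightarrow>
      norm (\<Gamma> x u - \<Gamma> x' u') \<le> K * (\<rho>\<^sup>2 * norm (x - x') + \<rho> * norm (u - u'))"

lemma (in coordinate_metric) chart_ball_exists:
  assumes "y \<in> U"
  obtains R K where "chart_ball U g y R K"
proof -
  obtain R where R: "0 < R" "cball y R \<subseteq> U"
    using open_U assms open_contains_cball by blast
  show ?thesis
  proof (rule uniform_estimates[OF R(2)])
    fix K assume "1 \<le> K"
      "\<And>x u. x \<in> cball y R \<Longrightarrow> (norm u)\<^sup>2 \<le> K * g x u u"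
      "\<And>x u v. x \<in> cball y R \<Longrightarrow> \<bar>g x u v\<bar> \<le> K * (norm u * norm v)"
      "\<And>x x' u v. x \<in> cball y R \<Longrightarrow> x' \<in> cball y R \<Longrightarrow>
        \<bar>g x u v - g x' u v\<bar> \<le> K * (norm (x - x') * norm u * norm v)"
      "\<And>x x' u. x \<in> cball y R \<Longrightarrow> x' \<in> cball y R \<Longrightarrow>
        \<bar>g x' u u - g x u u - dg x (x' - x) u u\<bar> \<le> K * ((norm (x' - x))\<^sup>2 * (norm u)\<^sup>2)"
      "\<And>x x' u u' \<rho>. x \<in> cball y R \<Longrightarrow> x' \<in> cball y R \<Longrightarrow> norm u \<le> \<rho> \<Longrightarrow> norm u' \<le> \<rho> \<Longrightarrow>
        norm (\<Gamma> x u - \<Gamma> x' u') \<le> K * (\<rho>\<^sup>2 * norm (x - x') + \<rho> * norm (u - u'))"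
    with R have "chart_ball U g y R K"
      by unfold_locales
    then show ?thesis by (rule that)
  qed
qed

context chart_ball begin

text \<open>A substitute for Gronwall's inequality. Let \<open>M\<close> be the maximal velocity
  difference on the unit interval; slowness lets that difference change by at most
  \<open>M / 4\<close>, so \<open>M\<close> is at most 4/3 of the initial difference, whence the
  factor 1/3.\<close>

lemma slow_geodesics_deviation:
  assumes x1: "\<And>t. t \<in> {0..1} \<Longrightarrow> coord_geodesic x1 v1 t \<and> x1 t \<in> cball y R \<and> norm (v1 t) \<le> \<rho>"
    and x2: "\<And>t. t \<in> {0..1} \<Longrightarrow> coord_geodesic x2 v2 t \<and> x2 t \<in> cball y R \<and> norm (v2 t) \<le> \<rho>"
    and start: "x1 0 = x2 0" and \<rho>: "8 * K * \<rho> \<le> 1" and t: "t \<in> {0..1}"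
  shows "norm ((x1 t - x2 t) - t *\<^sub>R (v1 0 - v2 0)) \<le> norm (v1 0 - v2 0) / 3"
proof -
  define h w where "h t = x1 t - x2 t" and "w t = v1 t - v2 t" for t
  have h: "(h has_vector_derivative w t) (at t)" if "t \<in> {0..1}" for t
    using x1[OF that] x2[OF that] unfolding h_def[abs_def] w_def coord_geodesic_def
    by (auto intro!: has_vector_derivative_diff)
  have w: "(w has_vector_derivative (\<Gamma> (x2 t) (v2 t) - \<Gamma> (x1 t) (v1 t))) (at t)" if "t \<in> {0..1}" for t
    using has_vector_derivative_diff[of v1 "- \<Gamma> (x1 t) (v1 t)" "at t" v2 "- \<Gamma> (x2 t) (v2 t)"]
      x1[OF that] x2[OF that]
    unfolding w_def[abs_def] coord_geodesic_def by simp
  have "continuous_on {0..1} (\<lambda>t. norm (w t))"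
    using w has_vector_derivative_continuous by (intro continuous_on_norm continuous_at_imp_continuous_on) blast
  then obtain s where s: "s \<in> {0..1}" and max: "\<forall>t\<in>{0..1}. norm (w t) \<le> norm (w s)"
    using continuous_attains_sup[of "{0..1::real}" "\<lambda>t. norm (w t)"] by auto
  define M where "M = norm (w s)"
  have M: "0 \<le> M" by (simp add: M_def)
  have hM: "norm (h t) \<le> M" if "t \<in> {0..1}" for t
    using curve_deviation_bound[OF h, of 0 M t] max that start by (auto simp: M_def h_def)
  have "norm (v1 0) \<le> \<rho>" using x1[of 0] by simp
  then have "0 \<le> \<rho>" using norm_ge_zero order_trans by blast
  have "\<rho> \<le> K * \<rho>" using K_ge_1 \<open>0 \<le> \<rho>\<close> by (simp add: mult_le_cancel_right1)
  then have "\<rho> \<le> 1" using \<rho> by simp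
  have wM: "norm ((\<Gamma> (x2 t) (v2 t) - \<Gamma> (x1 t) (v1 t)) - 0) \<le> M / 4" if t: "t \<in> {0..1}" for t
  proof -
    have "norm (\<Gamma> (x2 t) (v2 t) - \<Gamma> (x1 t) (v1 t)) \<le> K * (\<rho>\<^sup>2 * norm (x2 t - x1 t) + \<rho> * norm (v2 t - v1 t))"
      using x1[OF t] x2[OF t] by (intro \<Gamma>_lip) auto
    also have "\<dots> \<le> K * (\<rho> * M + \<rho> * M)"
    proof -
      have "\<rho>\<^sup>2 * norm (x2 t - x1 t) \<le> \<rho> * M"
        using hM[OF t] \<open>0 \<le> \<rho>\<close> \<open>\<rho> \<le> 1\<close> M unfolding power2_eq_square h_def
        by (intro mult_mono) (auto simp: norm_minus_commute mult_left_le)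
      moreover have "\<rho> * norm (v2 t - v1 t) \<le> \<rho> * M"
        using max t \<open>0 \<le> \<rho>\<close> unfolding w_def M_def
        by (intro mult_left_mono) (auto simp: norm_minus_commute)
      ultimately show ?thesis
        using K_ge_1 by (intro mult_left_mono) linarith+
    qed
    also have "\<dots> = (8 * K * \<rho>) * (M / 4)" by simp
    also have "\<dots> \<le> 1 * (M / 4)" using M \<rho> by (intro mult_right_mono) auto
    finally show ?thesis by simp
  qed
  have w0: "norm (w t - w 0) \<le> M / 4" if t: "t \<in> {0..1}" for t
    using curve_deviation_bound[OF w wM t] by simp
  have "M \<le> norm (w 0) + M / 4"
    using w0[OF s] norm_triangle_sub[of "w s" "w 0"] unfolding M_def by linarith
  moreover have "norm (h t - h 0 - t *\<^sub>R w 0) \<le> M / 4"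
    by (rule curve_deviation_bound[OF h w0 t])
  ultimately show ?thesis
    using start by (simp add: h_def w_def)
qed

text \<open>Fixed points of \<open>T\<close> are the initial velocities that hit \<open>b\<close>.
  The contraction comes from comparing individual geodesics, so the family may be chosen arbitrarily
  for each \<open>u\<close>.\<close>

lemma geodesic_shooting:
  assumes x: "\<And>u t. norm u \<le> r \<Longrightarrow> t \<in> {0..1} \<Longrightarrow>
      coord_geodesic (x u) (v u) t \<and> x u t \<in> cball y R \<and> norm (v u t) \<le> K * norm u"
    and init: "\<And>u. norm u \<le> r \<Longrightarrow> x u 0 = a \<and> v u 0 = u"
    and r: "0 \<le> r" "8 * K * (K * r) \<le> 1" and b: "norm (b - a) \<le> r / 2"
  obtains u where "norm u \<le> r" "x u 1 = b" "norm u \<le> 2 * norm (b - a)"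
proof -
  define T where "T u = u - x u 1 + b" for u
  have contr: "dist (T u) (T w) \<le> 1/3 * dist u w" if "norm u \<le> r" "norm w \<le> r" for u w
  proof -
    have "norm ((x u 1 - x w 1) - 1 *\<^sub>R (v u 0 - v w 0)) \<le> norm (v u 0 - v w 0) / 3"
    proof (rule slow_geodesics_deviation[where \<rho> = "K * r"])
      have "K * norm z \<le> K * r" if "norm z \<le> r" for z :: 'e
        using K_ge_1 that by (intro mult_left_mono) auto
      then show "coord_geodesic (x u) (v u) t \<and> x u t \<in> cball y R \<and> norm (v u t) \<le> K * r"
        "coord_geodesic (x w) (v w) t \<and> x w t \<in> cball y R \<and> norm (v w t) \<le> K * r" if "t \<in> {0..1}" for t
        using x that \<open>norm u \<le> r\<close> \<open>norm w \<le> r\<close> order_trans by blast+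
    qed (use r init that in auto)
    then show ?thesis
      using init that by (simp add: T_def dist_norm norm_minus_commute algebra_simps)
  qed
  \<comment> \<open>At \<open>u = 0\<close> the velocity bound \<open>K * norm u\<close> vanishes
    and the geodesic rests at \<open>a\<close>. This anchors the self-map estimate:
    \<open>norm (T u)\<close> is at most \<open>r / 2 + r / 3\<close>.\<close>
  have x0: "x 0 1 = a"
  proof -
    have "norm (x 0 1 - x 0 0 - 1 *\<^sub>R 0) \<le> 0"
    proof (rule curve_deviation_bound)
      fix s :: real assume "s \<in> {0..1}"
      then show "(x 0 has_vector_derivative v 0 s) (at s)" "norm (v 0 s - 0) \<le> 0"
        using x[of 0 s] r by (auto simp: coord_geodesic_def)
    qed auto
    then show ?thesis using init[of 0] r by simp
  qed
  have le: "norm (T u) \<le> norm (b - a) + norm u / 3" if "norm u \<le> r" for u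
    using contr[OF that, of 0] r x0 norm_triangle_sub[of "T u" "T 0"] by (simp add: T_def dist_norm)
  have "\<exists>!u\<in>cball 0 r. T u = u"
  proof (rule Banach_fix)
    show "complete (cball 0 r :: 'e set)" by (simp add: compact_imp_complete)
    show "T ` cball 0 r \<subseteq> cball 0 r"
    proof (intro image_subsetI)
      fix u :: 'e assume "u \<in> cball 0 r"
      then have "norm u \<le> r" by simp
      then have "norm (T u) \<le> r" using le[of u] b r(1) by linarith
      then show "T u \<in> cball 0 r" by simp
    qed
    show "dist (T u) (T w) \<le> 1/3 * dist u w" if "u \<in> cball 0 r" "w \<in> cball 0 r" for u w
      using contr that by auto
  qed (use r in auto)
  then obtain u where u: "norm u \<le> r" "T u = u" by auto
  show ?thesis
  proof (rule that[OF u(1)])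
    show "x u 1 = b" using u(2) by (simp add: T_def)
    show "norm u \<le> 2 * norm (b - a)" using le[OF u(1)] norm_ge_zero[of "b - a"] unfolding u(2) by linarith
  qed
qed

text \<open>Beyond the first variation, the energy density gains \<open>g (x + h) w w\<close>, which
  is at least \<open>(norm w)\<^sup>2 / K\<close>. Half of this absorbs the mixed error term in
  \<open>h\<close> and \<open>w\<close>, the other half pays for the term weighted by
  \<open>\<phi>\<close>.\<close>

lemma energy_density_bound:
  assumes x: "x \<in> cball y R" and c: "x + h \<in> cball y R" and v: "norm v \<le> \<rho>"
    and \<rho>: "24 * K ^ 4 * \<rho>\<^sup>2 \<le> 1" and \<phi>: "\<bar>\<phi>\<bar> \<le> 1/2"
  shows "g (x + h) (v + w) (v + w) - g x v v - (dg x h v v + 2 * g x v w) -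
      (1 / (2 * K)) * (- (norm h)\<^sup>2 + 2 * \<phi> * (h \<bullet> w)) \<ge> (norm h)\<^sup>2 / (4 * K)"
proof -
  define H D q where "H = norm h" and "D = norm w" and "q = h \<bullet> w"
  have pos: "0 \<le> H" "0 \<le> D" "1 \<le> K" "0 < K" using K_ge_1 unfolding H_def D_def by auto
  have xU: "x \<in> U" "x + h \<in> U" using x c cball_subset by auto
  have "0 \<le> \<rho>" using v norm_ge_zero order_trans by blast
  have "\<bar>g (x + h) v v - g x v v - dg x h v v\<bar> \<le> K * (H\<^sup>2 * (norm v)\<^sup>2)"
    using g_quadratic[OF x c, of v] by (simp add: H_def)
  also have "\<dots> \<le> K * (H\<^sup>2 * \<rho>\<^sup>2)"
    using v pos by (intro mult_left_mono power_mono) auto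
  finally have 1: "\<bar>g (x + h) v v - g x v v - dg x h v v\<bar> \<le> K * (H\<^sup>2 * \<rho>\<^sup>2)" .
  have "\<bar>g (x + h) v w - g x v w\<bar> \<le> K * (H * norm v * D)"
    using g_lipschitz[OF c x, of v w] by (simp add: H_def D_def)
  also have "\<dots> \<le> K * (H * \<rho> * D)"
    using v pos by (intro mult_left_mono mult_right_mono) auto
  finally have 2: "\<bar>g (x + h) v w - g x v w\<bar> \<le> K * (H * \<rho> * D)" .
  have 3: "D\<^sup>2 \<le> K * g (x + h) w w" using coercive[OF c] by (simp add: D_def)
  have 4: "g (x + h) (v + w) (v + w) = g (x + h) v v + 2 * g (x + h) v w + g (x + h) w w"
    using g_sym[OF xU(2), of v w] by (simp add: g_bilinear_simps[OF xU(2)])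
  define S where "S = g (x + h) (v + w) (v + w) - g x v v - (dg x h v v + 2 * g x v w)"
  have S: "K * S \<ge> D\<^sup>2 - K * (K * (H\<^sup>2 * \<rho>\<^sup>2)) - 2 * (K * (K * (H * \<rho> * D)))"
  proof -
    have "S \<ge> g (x + h) w w - K * (H\<^sup>2 * \<rho>\<^sup>2) - 2 * (K * (H * \<rho> * D))"
      unfolding S_def 4 using 1 2 by linarith
    then have "K * (g (x + h) w w - K * (H\<^sup>2 * \<rho>\<^sup>2) - 2 * (K * (H * \<rho> * D))) \<le> K * S"
      using pos by (intro mult_left_mono) auto
    then show ?thesis using 3 by (simp add: algebra_simps)
  qed
  \<comment> \<open>Completing the square; \<open>\<bar>\<phi>\<bar> \<le> 1/2\<close> limits the
    loss to a quarter of \<open>H\<^sup>2\<close>.\<close>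
  have 5: "D\<^sup>2 - 2 * \<phi> * q + H\<^sup>2 / 4 \<ge> 0"
  proof -
    have "0 \<le> (norm (w - \<phi> *\<^sub>R h))\<^sup>2" by simp
    also have "\<dots> = D\<^sup>2 - 2 * \<phi> * q + \<phi>\<^sup>2 * H\<^sup>2"
      unfolding D_def H_def q_def power2_norm_eq_inner
      by (simp add: inner_diff_left inner_diff_right inner_commute power2_eq_square algebra_simps)
    also have "\<phi>\<^sup>2 * H\<^sup>2 \<le> (1/2)\<^sup>2 * H\<^sup>2"
      using \<phi> by (intro mult_right_mono) (auto intro: abs_le_square_iff[THEN iffD1] simp del: power_divide)
    finally show ?thesis by (simp add: power2_eq_square)
  qed
  have 6: "4 * (K * (K * (H * \<rho> * D))) \<le> D\<^sup>2 + 4 * K ^ 4 * \<rho>\<^sup>2 * H\<^sup>2"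
    using sum_squares_bound[of "2 * K\<^sup>2 * \<rho> * H" D] by (simp add: power2_eq_square power4_eq_xxxx mult_ac)
  \<comment> \<open>Origin of the 24 in the hypothesis on \<open>\<rho>\<close>: both error terms
    together are at most \<open>6 * K ^ 4 * \<rho>\<^sup>2 * H\<^sup>2\<close>, which must stay
    below a quarter of \<open>H\<^sup>2\<close>.\<close>
  have 7: "2 * (K * (K * (H\<^sup>2 * \<rho>\<^sup>2))) + 4 * K ^ 4 * \<rho>\<^sup>2 * H\<^sup>2 \<le> H\<^sup>2 / 4"
  proof -
    have "K\<^sup>2 \<le> K ^ 4" using pos by (intro power_increasing) auto
    then have "K\<^sup>2 * (\<rho>\<^sup>2 * H\<^sup>2) \<le> K ^ 4 * (\<rho>\<^sup>2 * H\<^sup>2)" by (intro mult_right_mono) auto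
    moreover have "24 * K ^ 4 * \<rho>\<^sup>2 * H\<^sup>2 \<le> 1 * H\<^sup>2" using \<rho> by (intro mult_right_mono) auto
    ultimately show ?thesis by (simp add: power2_eq_square mult_ac)
  qed
  have "2 * (K * S) - (- H\<^sup>2 + 2 * \<phi> * q) \<ge> H\<^sup>2 / 2"
    using S 5 6 7 by linarith
  then have "S - (1 / (2 * K)) * (- H\<^sup>2 + 2 * \<phi> * q) \<ge> H\<^sup>2 / (4 * K)"
    using pos by (simp add: field_simps)
  then show ?thesis unfolding S_def H_def q_def .
qed

lemma continuous_on_g:
  assumes "continuous_on S x" "continuous_on S v" "continuous_on S h" "x ` S \<subseteq> U"
  shows "continuous_on S (\<lambda>t. g (x t) (v t) (h t))"
proof -
  have "continuous_on U (\<lambda>y. g y i j)" for i j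
    by (intro continuous_at_imp_continuous_on ballI has_derivative_continuous[OF g_has_derivative])
  then have "continuous_on S (\<lambda>t. g (x t) i j)" for i j
    using continuous_on_compose2 assms(1,4) by blast
  then have "continuous_on S (\<lambda>t. \<Sum>i\<in>Basis. \<Sum>j\<in>Basis. (v t \<bullet> i) * (h t \<bullet> j) * g (x t) i j)"
    using assms(2,3) by (intro continuous_on_sum continuous_on_mult continuous_on_inner continuous_on_const)
  then show ?thesis
    using assms by (subst continuous_on_cong[OF refl]) (auto intro!: bilinear_expansion bilinear_g)
qed

text \<open>The derivative of the function \<open>\<Psi>\<close> in the proof is the difference of the energy densities up to
  terms that integrate to 0; the weight \<open>1/2 - t\<close> yields a pointwise Poincare inequality.\<close>

lemma slow_geodesic_minimizes_energy:
  assumes x: "\<And>t. t \<in> {0..1} \<Longrightarrow> coord_geodesic x v t \<and> x t \<in> cball y R \<and> norm (v t) \<le> \<rho>"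
    and e: "\<And>t. t \<in> {0..1} \<Longrightarrow> g (x t) (v t) (v t) = e"
    and \<rho>: "24 * K ^ 4 * \<rho>\<^sup>2 \<le> 1"
    and \<theta>: "0 < \<theta>" "\<theta> < 1"
    and c: "continuous_on {0..1} c" "\<And>t. t \<in> {0..1} \<Longrightarrow> c t \<in> cball y R" "c 0 = x 0" "c 1 = x 1"
    and c1: "\<And>t. 0 < t \<Longrightarrow> t < \<theta> \<Longrightarrow> (c has_vector_derivative c' t) (at t) \<and> g (c t) (c' t) (c' t) = a"
    and c2: "\<And>t. \<theta> < t \<Longrightarrow> t < 1 \<Longrightarrow> (c has_vector_derivative c' t) (at t) \<and> g (c t) (c' t) (c' t) = b"
  shows "e \<le> \<theta> * a + (1 - \<theta>) * b"
    and "\<theta> * a + (1 - \<theta>) * b \<le> e \<Longrightarrow> t \<in> {0..1} \<Longrightarrow> t \<noteq> \<theta> \<Longrightarrow> c t = x t"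
proof -
  define h where "h t = c t - x t" for t
  \<comment> \<open>The accumulated energy of the competitor, of density \<open>a\<close> before the
    corner and \<open>b\<close> after it.\<close>
  define W where "W t = (if t \<le> \<theta> then a * t else a * \<theta> + b * (t - \<theta>))" for t
  define \<Psi> where "\<Psi> t = W t - e * t - 2 * g (x t) (v t) (h t) - (1 / (2 * K)) * ((1/2 - t) * (h t \<bullet> h t))" for t
  have "h 0 = 0" "h 1 = 0" using c by (auto simp: h_def)
  have U: "x t \<in> U" if "t \<in> {0..1}" for t using x that by (auto simp: coord_geodesic_def)
  \<comment> \<open>The momentum and weight terms vanish with \<open>h\<close> at both ends, so
    \<open>\<Psi> 1\<close> is exactly the difference of the total energies.\<close>
  have \<Psi>0: "\<Psi> 0 = 0" using U[of 0] \<theta> \<open>h 0 = 0\<close> by (simp add: \<Psi>_def W_def g_bilinear_simps)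
  have \<Psi>1: "\<Psi> 1 = \<theta> * a + (1 - \<theta>) * b - e"
    using U[of 1] \<theta> \<open>h 1 = 0\<close> by (simp add: \<Psi>_def W_def g_bilinear_simps algebra_simps)
  have cx: "continuous_on {0..1} x"
  proof (intro continuous_at_imp_continuous_on ballI)
    fix t :: real assume "t \<in> {0..1}"
    from x[OF this] show "isCont x t"
      unfolding coord_geodesic_def using has_vector_derivative_continuous by blast
  qed
  have cv: "continuous_on {0..1} v"
  proof (intro continuous_at_imp_continuous_on ballI)
    fix t :: real assume "t \<in> {0..1}"
    from x[OF this] show "isCont v t"
      unfolding coord_geodesic_def using has_vector_derivative_continuous by blast
  qed
  have "continuous_on {0..1} W"
    unfolding W_def
    by (rule continuous_on_cases_le[where h = "\<lambda>t. t"]) (auto intro!: continuous_intros)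
  then have cont: "continuous_on {0..1} \<Psi>"
    unfolding \<Psi>_def h_def using cx cv c(1) U by (intro continuous_intros continuous_on_g) auto
  have der: "\<exists>D. (\<Psi> has_real_derivative D) (at t) \<and> (norm (h t))\<^sup>2 / (4 * K) \<le> D"
    if t: "0 < t" "t < 1" "t \<noteq> \<theta>" for t
  proof -
    define E where "E = (if t < \<theta> then a else b)"
    have tI: "t \<in> {0..1}" using t by auto
    have c': "(c has_vector_derivative c' t) (at t)" "g (c t) (c' t) (c' t) = E"
      using c1[of t] c2[of t] t by (cases "t < \<theta>"; auto simp: E_def)+
    define w where "w = c' t - v t"
    have h: "(h has_vector_derivative w) (at t)"
      using x[OF tI] c'(1) unfolding h_def[abs_def] w_def coord_geodesic_def
      by (auto intro!: has_vector_derivative_diff)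
    have W: "(W has_real_derivative E) (at t)"
    proof (cases "t < \<theta>")
      case True
      have "((\<lambda>t. a * t) has_real_derivative E) (at t)"
        using True by (auto simp: E_def intro!: derivative_eq_intros)
      then show ?thesis
        by (rule has_field_derivative_transform_within_open[where S = "{..<\<theta>}"])
          (use True in \<open>auto simp: W_def\<close>)
    next
      case False
      have "((\<lambda>t. a * \<theta> + b * (t - \<theta>)) has_real_derivative E) (at t)"
        using False by (auto simp: E_def intro!: derivative_eq_intros)
      then show ?thesis
        by (rule has_field_derivative_transform_within_open[where S = "{\<theta><..}"])
          (use False t in \<open>auto simp: W_def\<close>)
    qed
    have hh: "((\<lambda>t. h t \<bullet> h t) has_real_derivative 2 * (h t \<bullet> w)) (at t)"
      using bounded_bilinear.has_vector_derivative[OF bounded_bilinear_inner h h]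
      by (simp add: has_real_derivative_iff_has_vector_derivative inner_commute)
    have "(\<Psi> has_real_derivative E - e * 1 - (dg (x t) (h t) (v t) (v t) + 2 * g (x t) (v t) w)
       - (1 / (2 * K)) * ((0 - 1) * (h t \<bullet> h t) + 2 * (h t \<bullet> w) * (1/2 - t))) (at t)"
      unfolding \<Psi>_def[abs_def] using x[OF tI]
      by (intro DERIV_diff DERIV_cmult DERIV_mult W hh momentum_derivative h DERIV_const DERIV_ident) auto
    moreover have "(1 / (2 * K)) * ((0 - 1) * (h t \<bullet> h t) + 2 * (h t \<bullet> w) * (1/2 - t)) =
       (1 / (2 * K)) * (- (norm (h t))\<^sup>2 + 2 * (1/2 - t) * (h t \<bullet> w))"
      by (simp add: power2_norm_eq_inner)
    moreover have "g (x t + h t) (v t + w) (v t + w) - g (x t) (v t) (v t)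
       - (dg (x t) (h t) (v t) (v t) + 2 * g (x t) (v t) w)
       - (1 / (2 * K)) * (- (norm (h t))\<^sup>2 + 2 * (1/2 - t) * (h t \<bullet> w)) \<ge> (norm (h t))\<^sup>2 / (4 * K)"
      using x[OF tI] c(2)[OF tI] \<rho> t
      by (intro energy_density_bound[where \<rho> = \<rho>]) (auto simp: h_def abs_if)
    moreover have "g (x t + h t) (v t + w) (v t + w) = E" "g (x t) (v t) (v t) = e"
      using c'(2) e[OF tI] by (auto simp: h_def w_def)
    ultimately show ?thesis by (metis mult_1_right)
  qed
  have nonneg: "0 \<le> (norm z)\<^sup>2 / (4 * K)" for z :: 'e using K_ge_1 by simp
  \<comment> \<open>The competitor may have a corner at \<open>\<theta>\<close>; monotonicity is
    therefore shown on each side and joined at the common value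
    \<open>\<Psi> \<theta>\<close>.\<close>
  have mono1: "\<Psi> s \<le> \<Psi> t" if "0 \<le> s" "s \<le> t" "t \<le> \<theta>" for s t
  proof (rule DERIV_nonneg_imp_increasing_open[OF \<open>s \<le> t\<close>])
    show "\<exists>D. (\<Psi> has_real_derivative D) (at z) \<and> 0 \<le> D" if "s < z" "z < t" for z
      using der[of z] nonneg[of "h z"] that \<open>0 \<le> s\<close> \<open>t \<le> \<theta>\<close> \<theta> by fastforce
    show "continuous_on {s..t} \<Psi>" by (rule continuous_on_subset[OF cont]) (use that \<theta> in auto)
  qed
  have mono2: "\<Psi> s \<le> \<Psi> t" if "\<theta> \<le> s" "s \<le> t" "t \<le> 1" for s t
  proof (rule DERIV_nonneg_imp_increasing_open[OF \<open>s \<le> t\<close>])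
    show "\<exists>D. (\<Psi> has_real_derivative D) (at z) \<and> 0 \<le> D" if "s < z" "z < t" for z
      using der[of z] nonneg[of "h z"] that \<open>\<theta> \<le> s\<close> \<open>t \<le> 1\<close> \<theta> by fastforce
    show "continuous_on {s..t} \<Psi>" by (rule continuous_on_subset[OF cont]) (use that \<theta> in auto)
  qed
  show "e \<le> \<theta> * a + (1 - \<theta>) * b"
    using mono1[of 0 \<theta>] mono2[of \<theta> 1] \<theta> \<Psi>0 \<Psi>1 by simp
  assume le: "\<theta> * a + (1 - \<theta>) * b \<le> e" and t: "t \<in> {0..1}" "t \<noteq> \<theta>"
  \<comment> \<open>Without excess energy the increasing function \<open>\<Psi>\<close> has no room
    between its end values and vanishes; its derivative, which dominates a multiple of the square of
    \<open>norm (h t)\<close>, is then 0.\<close>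
  have zero: "\<Psi> s = 0" if s: "s \<in> {0..1}" for s
  proof (cases "s \<le> \<theta>")
    case True
    then show ?thesis using mono1[of 0 s] mono1[of s \<theta>] mono2[of \<theta> 1] s \<theta> \<Psi>0 \<Psi>1 le by auto
  next
    case False
    then show ?thesis using mono1[of 0 \<theta>] mono2[of \<theta> s] mono2[of s 1] s \<theta> \<Psi>0 \<Psi>1 le by auto
  qed
  show "c t = x t"
  proof (cases "t = 0 \<or> t = 1")
    case True
    then show ?thesis using c by auto
  next
    case False
    then have "0 < t" "t < 1" using t by auto
    then obtain D where D: "(\<Psi> has_real_derivative D) (at t)" "(norm (h t))\<^sup>2 / (4 * K) \<le> D"
      using der t by blast
    have "((\<lambda>_. 0) has_real_derivative D) (at t)"
      using D(1) by (rule has_field_derivative_transform_within_open[where S = "{0<..<1}"])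
        (use \<open>0 < t\<close> \<open>t < 1\<close> zero in auto)
    then have "D = 0" using DERIV_const DERIV_unique by blast
    then have "(norm (h t))\<^sup>2 \<le> 0" using D(2) K_ge_1 by (simp add: field_simps)
    then show ?thesis by (simp add: h_def)
  qed
qed

end

section \<open>Geodesics on manifolds\<close>

context smooth_manifold begin

lemma chart_inv_map: "c \<in> A \<Longrightarrow> p \<in> chart_dom c \<Longrightarrow> chart_inv c (chart_map c p) = p"
  using atlas_homeomorphism by (auto simp: homeomorphism_def)

lemma chart_map_inj: "c \<in> A \<Longrightarrow> p \<in> chart_dom c \<Longrightarrow> q \<in> chart_dom c \<Longrightarrow> chart_map c p = chart_map c q \<Longrightarrow> p = q"
  using chart_inv_map by metis

lemma continuous_on_chart_map: "c \<in> A \<Longrightarrow> continuous_on (chart_dom c) (chart_map c)"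
  and continuous_on_chart_inv: "c \<in> A \<Longrightarrow> continuous_on (chart_map c ` chart_dom c) (chart_inv c)"
  using atlas_homeomorphism by (auto simp: homeomorphism_def)

lemma open_chart_image:
  assumes "c \<in> A" "open D"
  shows "open (chart_map c ` (chart_dom c \<inter> D))"
proof -
  have "chart_map c ` (chart_dom c \<inter> D) = chart_map c ` chart_dom c \<inter> chart_inv c -` D"
    using chart_inv_map[OF assms(1)] by force
  then show ?thesis
    using continuous_open_preimage[OF continuous_on_chart_inv atlas_open_range] assms by metis
qed

lemma open_chart_preimage:
  assumes "c \<in> A" "open S"
  shows "open (chart_dom c \<inter> chart_map c -` S)"
  using continuous_open_preimage[OF continuous_on_chart_map atlas_open_dom] assms by blast

lemma transition_apply: "c \<in> A \<Longrightarrow> p \<in> chart_dom c \<Longrightarrow> transition c c' (chart_map c p) = chart_map c' p"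
  by (simp add: transition_def chart_inv_map)

lemma transition_has_derivative:
  assumes "c \<in> A" "c' \<in> A" "p \<in> chart_dom c \<inter> chart_dom c'"
  shows "(transition c c' has_derivative frechet_derivative (transition c c') (at (chart_map c p))) (at (chart_map c p))"
proof -
  have "Ck_on 1 (transition c c') (chart_map c ` (chart_dom c \<inter> chart_dom c'))"
    using atlas_compatible assms smooth_on_def by blast
  then have "transition c c' differentiable (at (chart_map c p))" using assms by simp
  then show ?thesis by (simp add: frechet_derivative_works)
qed

lemma velocity_change_of_chart:
  assumes \<gamma>: "continuous_on UNIV \<gamma>" and c: "c \<in> A" "c' \<in> A" "\<gamma> t \<in> chart_dom c" "\<gamma> t \<in> chart_dom c'"
    and v: "((chart_map c \<circ> \<gamma>) has_vector_derivative v) (at t)"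
  shows "((chart_map c' \<circ> \<gamma>) has_vector_derivative
    frechet_derivative (transition c c') (at (chart_map c (\<gamma> t))) v) (at t)"
proof -
  have "(transition c c' \<circ> (chart_map c \<circ> \<gamma>) has_vector_derivative
      frechet_derivative (transition c c') (at (chart_map c (\<gamma> t))) v) (at t)"
    using has_derivative_at_withinI[OF transition_has_derivative[of c c' "\<gamma> t"]] c
    by (intro vector_derivative_diff_chain_within[OF v]) simp
  then show ?thesis
  proof (rule has_vector_derivative_transform_within_open)
    show "open (\<gamma> -` chart_dom c)"
      using \<gamma> atlas_open_dom[OF c(1)] by (simp add: continuous_on_open_vimage)
  qed (use c in \<open>auto simp: transition_apply\<close>)
qed

lemma transition_trans:
  assumes "c \<in> A" "c' \<in> A" "c'' \<in> A" "p \<in> chart_dom c" "p \<in> chart_dom c'" "p \<in> chart_dom c''"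
  shows "frechet_derivative (transition c c'') (at (chart_map c p)) u =
    frechet_derivative (transition c' c'') (at (chart_map c' p))
      (frechet_derivative (transition c c') (at (chart_map c p)) u)"
proof -
  have "(transition c' c'' \<circ> transition c c' has_derivative
      frechet_derivative (transition c' c'') (at (chart_map c' p)) \<circ>
      frechet_derivative (transition c c') (at (chart_map c p))) (at (chart_map c p))"
    using transition_has_derivative[of c c' p] transition_has_derivative[of c' c'' p] assms
    by (intro diff_chain_at) (auto simp: transition_apply)
  moreover have "open (chart_map c ` (chart_dom c \<inter> chart_dom c'))"
    using assms atlas_open_dom by (intro open_chart_image) auto
  ultimately have "(transition c c'' has_derivative
      frechet_derivative (transition c' c'') (at (chart_map c' p)) \<circ>
      frechet_derivative (transition c c') (at (chart_map c p))) (at (chart_map c p))"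
    by (rule has_derivative_transform_within_open) (use assms in \<open>auto simp: transition_apply\<close>)
  from has_derivative_unique[OF transition_has_derivative[OF assms(1,3)] this] assms(4,6)
  show ?thesis by simp
qed

lemma transition_self:
  assumes "c \<in> A" "p \<in> chart_dom c"
  shows "frechet_derivative (transition c c) (at (chart_map c p)) u = u"
proof -
  have "((\<lambda>x. x) has_derivative (\<lambda>x. x)) (at (chart_map c p))" by (rule has_derivative_ident)
  then have id: "(transition c c has_derivative (\<lambda>x. x)) (at (chart_map c p))"
    by (rule has_derivative_transform_within_open[OF _ atlas_open_range[OF assms(1)]])
      (use assms(2) in \<open>auto simp: transition_apply[OF assms(1)]\<close>)
  have "p \<in> chart_dom c \<inter> chart_dom c" using assms by simp
  note d = transition_has_derivative[OF assms(1,1) this]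
  have "frechet_derivative (transition c c) (at (chart_map c p)) = (\<lambda>x. x)"
    by (rule has_derivative_unique[OF d id])
  then show ?thesis by (rule fun_cong)
qed

text \<open>Transport the prescribed component by the transition derivatives; their cocycle rule
  makes the family consistent.\<close>

lemma tangent_vector_exists:
  assumes c: "c \<in> A" "p \<in> chart_dom c"
  obtains X where "X \<in> tangent_space A p" "X c = u"
proof
  define X where "X c' = (if c' \<in> A \<and> p \<in> chart_dom c'
     then frechet_derivative (transition c c') (at (chart_map c p)) u else 0)" for c'
  show "X \<in> tangent_space A p"
    unfolding tangent_space_def
  proof (intro CollectI conjI allI ballI impI)
    fix c' c'' assume "c' \<in> A" "c'' \<in> A" "p \<in> chart_dom c' \<inter> chart_dom c''"
    then show "X c'' = frechet_derivative (transition c' c'') (at (chart_map c' p)) (X c')"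
      using transition_trans[of c c' c'' p u] c by (simp add: X_def)
  qed (auto simp: X_def)
  show "X c = u" using c by (simp add: X_def transition_self)
qed

end

section \<open>Geodesics across charts: speed, reparametrization, concatenation\<close>

context riemannian_manifold begin

lemma coordinate_metric_chart: "c \<in> A \<Longrightarrow> coordinate_metric (chart_map c ` chart_dom c) (G c)"
  using atlas_open_range metric_bilinear metric_sym metric_pos metric_smooth
  by unfold_locales auto

lemma christoffel_eq: "c \<in> A \<Longrightarrow> christoffel G c x u u = coordinate_metric.\<Gamma> (G c) x u"
  using coordinate_metric_chart[of c]
  by (simp add: christoffel_def coordinate_metric.\<Gamma>_def coordinate_metric.dg_def)

abbreviation coord_velocity :: "('a, 'e) chart \<Rightarrow> (real \<Rightarrow> 'a) \<Rightarrow> real \<Rightarrow> 'e" where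
  "coord_velocity c \<gamma> t \<equiv> vector_derivative (chart_map c \<circ> \<gamma>) (at t)"

text \<open>In \<open>geodesic\<close> the velocity is only an existential witness. On the open set
  of times spent in the chart it agrees with \<open>coord_velocity\<close>, so its derivative can be
  transferred.\<close>

lemma geodesic_in_chart:
  assumes \<gamma>: "geodesic A G UNIV \<gamma>" and c: "c \<in> A" and t: "\<gamma> t \<in> chart_dom c"
  shows "coordinate_metric.coord_geodesic (chart_map c ` chart_dom c) (G c) (chart_map c \<circ> \<gamma>) (coord_velocity c \<gamma>) t"
proof -
  interpret coordinate_metric "chart_map c ` chart_dom c" "G c" by (rule coordinate_metric_chart[OF c])
  obtain v where v: "\<And>t. \<gamma> t \<in> chart_dom c \<Longrightarrow> ((chart_map c \<circ> \<gamma>) has_vector_derivative v t) (at t)"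
     "\<And>t. \<gamma> t \<in> chart_dom c \<Longrightarrow> (v has_vector_derivative - christoffel G c (chart_map c (\<gamma> t)) (v t) (v t)) (at t)"
    using \<gamma> c unfolding geodesic_def by (metis UNIV_I)
  have eq: "coord_velocity c \<gamma> t = v t" if "\<gamma> t \<in> chart_dom c" for t
    using v(1)[OF that] by (rule vector_derivative_at)
  have "(coord_velocity c \<gamma> has_vector_derivative - \<Gamma> (chart_map c (\<gamma> t)) (v t)) (at t)"
    using v(2)[OF t] unfolding christoffel_eq[OF c]
  proof (rule has_vector_derivative_transform_within_open)
    show "open (\<gamma> -` chart_dom c)"
      using \<gamma> atlas_open_dom[OF c] by (simp add: geodesic_def continuous_on_open_vimage)
  qed (use t eq in auto)
  then show ?thesis
    using v(1)[OF t] t eq[OF t] by (auto simp: coord_geodesic_def)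
qed

lemma geodesic_coord_velocity:
  assumes \<gamma>: "geodesic A G UNIV \<gamma>" and c: "c \<in> A" and t: "\<gamma> t \<in> chart_dom c"
  shows "((chart_map c \<circ> \<gamma>) has_vector_derivative coord_velocity c \<gamma> t) (at t)"
  using geodesic_in_chart[OF assms] by (simp add: coordinate_metric.coord_geodesic_def[OF coordinate_metric_chart[OF c]])

lemma geodesic_velocity_change:
  assumes \<gamma>: "geodesic A G UNIV \<gamma>" and c: "c \<in> A" "c' \<in> A" "\<gamma> t \<in> chart_dom c" "\<gamma> t \<in> chart_dom c'"
  shows "coord_velocity c' \<gamma> t = frechet_derivative (transition c c') (at (chart_map c (\<gamma> t))) (coord_velocity c \<gamma> t)"
  using velocity_change_of_chart[OF _ c geodesic_coord_velocity[OF \<gamma> c(1) c(3)]] \<gamma>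
  by (intro vector_derivative_at) (simp add: geodesic_def)

text \<open>The speed \<open>L\<close> may be 0, which admits constant curves.\<close>

definition constant_speed_geodesic :: "(real \<Rightarrow> 'a) \<Rightarrow> real \<Rightarrow> bool" where
  "constant_speed_geodesic \<gamma> L \<longleftrightarrow> geodesic A G UNIV \<gamma> \<and> 0 \<le> L \<and>
     (\<forall>t. \<forall>c\<in>A. \<gamma> t \<in> chart_dom c \<longrightarrow>
        G c (chart_map c (\<gamma> t)) (coord_velocity c \<gamma> t) (coord_velocity c \<gamma> t) = L\<^sup>2)"

lemma constant_speed_geodesicD:
  assumes "constant_speed_geodesic \<gamma> L"
  shows "geodesic A G UNIV \<gamma>" "0 \<le> L" "continuous_on UNIV \<gamma>"
    and "c \<in> A \<Longrightarrow> \<gamma> t \<in> chart_dom c \<Longrightarrow>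
      G c (chart_map c (\<gamma> t)) (coord_velocity c \<gamma> t) (coord_velocity c \<gamma> t) = L\<^sup>2"
  using assms by (auto simp: constant_speed_geodesic_def geodesic_def)

lemma geodesic_constant_speed:
  assumes \<gamma>: "geodesic A G UNIV \<gamma>"
  obtains L where "constant_speed_geodesic \<gamma> L"
proof -
  define e where "e c t = G c (chart_map c (\<gamma> t)) (coord_velocity c \<gamma> t) (coord_velocity c \<gamma> t)" for c t
  have "\<exists>c\<in>A. \<gamma> t \<in> chart_dom c" for t using atlas_cover by blast
  \<comment> \<open>One chart for each time. The energy density does not depend on the chart, so
    near every time the function agrees with that of a fixed chart, where its derivative
    vanishes.\<close>
  then obtain C where C: "\<And>t. C t \<in> A" "\<And>t. \<gamma> t \<in> chart_dom (C t)" by metis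
  have indep: "e c t = e c' t" if "c \<in> A" "c' \<in> A" "\<gamma> t \<in> chart_dom c" "\<gamma> t \<in> chart_dom c'" for c c' t
    using metric_compatible[of c c' "\<gamma> t"] that geodesic_velocity_change[OF \<gamma> that] by (simp add: e_def)
  have "((\<lambda>t. e (C t) t) has_real_derivative 0) (at t)" for t
  proof -
    have "((\<lambda>s. e (C t) s) has_real_derivative 0) (at t)"
      using coordinate_metric.speed_derivative[OF coordinate_metric_chart geodesic_in_chart[OF \<gamma>]] C
      unfolding e_def[abs_def] by fastforce
    then show ?thesis
    proof (rule has_field_derivative_transform_within_open)
      show "open (\<gamma> -` chart_dom (C t))"
        using \<gamma> atlas_open_dom[OF C(1)] by (simp add: geodesic_def continuous_on_open_vimage)
    qed (use C indep in auto)
  qed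
  then have const: "e (C s) s = e (C t) t" for s t using DERIV_isconst_all by blast
  define L where "L = sqrt (e (C 0) 0)"
  have "0 \<le> e (C 0) 0"
  proof (cases "coord_velocity (C 0) \<gamma> 0 = 0")
    case True
    then show ?thesis
      using coordinate_metric.g_bilinear_simps(9)[OF coordinate_metric_chart[OF C(1)[of 0]], of "chart_map (C 0) (\<gamma> 0)"] C(2)
      by (simp add: e_def)
  next
    case False
    then show ?thesis using metric_pos[OF C(1)[of 0]] C(2) by (auto simp: e_def intro: less_imp_le)
  qed
  then have "L\<^sup>2 = e (C 0) 0" "0 \<le> L" by (auto simp: L_def)
  then have "constant_speed_geodesic \<gamma> L"
    using \<gamma> indep const C unfolding constant_speed_geodesic_def e_def by metis
  then show ?thesis by (rule that)
qed

text \<open>Both sides of the geodesic equation scale with the square of \<open>a\<close>. Negative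
  \<open>a\<close> reverses the curve, and \<open>a = 0\<close> makes it constant.\<close>

lemma constant_speed_geodesic_affine:
  assumes \<gamma>: "constant_speed_geodesic \<gamma> L"
  shows "constant_speed_geodesic (\<lambda>s. \<gamma> (a * s + b)) (\<bar>a\<bar> * L)"
    and "c \<in> A \<Longrightarrow> \<gamma> (a * s + b) \<in> chart_dom c \<Longrightarrow>
      coord_velocity c (\<lambda>s. \<gamma> (a * s + b)) s = a *\<^sub>R coord_velocity c \<gamma> (a * s + b)"
proof -
  have geo: "geodesic A G UNIV \<gamma>" using \<gamma> constant_speed_geodesic_def by blast
  let ?\<sigma> = "\<lambda>s. \<gamma> (a * s + b)"
  have aff: "((\<lambda>s. a * s + b) has_vector_derivative a) (at s)" for s
    unfolding has_real_derivative_iff_has_vector_derivative[symmetric]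
    by (auto intro!: derivative_eq_intros)
  have d1: "((chart_map c \<circ> ?\<sigma>) has_vector_derivative a *\<^sub>R coord_velocity c \<gamma> (a * s + b)) (at s)"
    if "c \<in> A" "?\<sigma> s \<in> chart_dom c" for c s
    using vector_diff_chain_at[OF aff geodesic_coord_velocity[OF geo that]] by (simp add: o_def)
  have d2: "((\<lambda>s. a *\<^sub>R coord_velocity c \<gamma> (a * s + b)) has_vector_derivative
      - christoffel G c (chart_map c (?\<sigma> s)) (a *\<^sub>R coord_velocity c \<gamma> (a * s + b)) (a *\<^sub>R coord_velocity c \<gamma> (a * s + b))) (at s)"
    if c: "c \<in> A" "?\<sigma> s \<in> chart_dom c" for c s
  proof -
    interpret coordinate_metric "chart_map c ` chart_dom c" "G c" by (rule coordinate_metric_chart[OF c(1)])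
    have "(coord_velocity c \<gamma> has_vector_derivative - \<Gamma> (chart_map c (?\<sigma> s)) (coord_velocity c \<gamma> (a * s + b))) (at (a * s + b))"
      using geodesic_in_chart[OF geo c] by (simp add: coord_geodesic_def)
    then have "((\<lambda>s. coord_velocity c \<gamma> (a * s + b)) has_vector_derivative
       a *\<^sub>R (- \<Gamma> (chart_map c (?\<sigma> s)) (coord_velocity c \<gamma> (a * s + b)))) (at s)"
      using vector_diff_chain_at[OF aff] by (fastforce simp: o_def)
    from bounded_linear.has_vector_derivative[OF bounded_linear_scaleR_right this, of a]
    show ?thesis using c by (simp add: christoffel_eq \<Gamma>_scale power2_eq_square)
  qed
  have "continuous_on UNIV ?\<sigma>"
  proof (rule continuous_on_compose2[where g = \<gamma> and f = "\<lambda>s. a * s + b"])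
    show "continuous_on UNIV \<gamma>" using geo by (simp add: geodesic_def)
  qed (auto intro!: continuous_intros)
  moreover have "\<exists>v. \<forall>t\<in>UNIV. ?\<sigma> t \<in> chart_dom c \<longrightarrow>
      ((chart_map c \<circ> ?\<sigma>) has_vector_derivative v t) (at t) \<and>
      (v has_vector_derivative - christoffel G c (chart_map c (?\<sigma> t)) (v t) (v t)) (at t)" if "c \<in> A" for c
    using d1[OF that] d2[OF that] by (intro exI[of _ "\<lambda>s. a *\<^sub>R coord_velocity c \<gamma> (a * s + b)"]) blast
  ultimately have "geodesic A G UNIV ?\<sigma>"
    unfolding geodesic_def by blast
  show vel: "coord_velocity c ?\<sigma> s = a *\<^sub>R coord_velocity c \<gamma> (a * s + b)" if "c \<in> A" "?\<sigma> s \<in> chart_dom c" for c s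
    using vector_derivative_at[OF d1[OF that]] .
  have "G c (chart_map c (?\<sigma> s)) (coord_velocity c ?\<sigma> s) (coord_velocity c ?\<sigma> s) = (\<bar>a\<bar> * L)\<^sup>2"
    if c: "c \<in> A" "?\<sigma> s \<in> chart_dom c" for c s
  proof -
    interpret coordinate_metric "chart_map c ` chart_dom c" "G c" by (rule coordinate_metric_chart[OF c(1)])
    show ?thesis
      using vel[OF c] c \<gamma> by (simp add: constant_speed_geodesic_def g_bilinear_simps power2_eq_square)
  qed
  then show "constant_speed_geodesic ?\<sigma> (\<bar>a\<bar> * L)"
    using \<open>geodesic A G UNIV ?\<sigma>\<close> \<gamma> by (simp add: constant_speed_geodesic_def)
qed

text \<open>Every piece has constant speed, so lengths are finite sums of speed times duration.
  Pieces come from geodesics on the whole line, the form in which completeness provides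
  them.\<close>

inductive broken_geodesic :: "'a \<Rightarrow> 'a \<Rightarrow> real \<Rightarrow> bool" for p where
  base: "broken_geodesic p p 0"
| step: "broken_geodesic p (\<gamma> 0) K \<Longrightarrow> constant_speed_geodesic \<gamma> L \<Longrightarrow> 0 \<le> t \<Longrightarrow>
    broken_geodesic p (\<gamma> t) (K + L * t)"

lemma broken_geodesic_nonneg: "broken_geodesic p q L \<Longrightarrow> 0 \<le> L"
  by (induction rule: broken_geodesic.induct) (auto simp: constant_speed_geodesic_def)

lemma broken_geodesic_trans:
  assumes "broken_geodesic q z L" "broken_geodesic p q K"
  shows "broken_geodesic p z (K + L)"
  using assms
proof (induction rule: broken_geodesic.induct)
  case (step \<gamma> K' L t)
  then show ?case using broken_geodesic.step[of p \<gamma> "K + K'" L t] by (simp add: add.assoc)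
qed simp

lemma broken_geodesic_segment:
  assumes "constant_speed_geodesic \<gamma> L" "s \<le> t"
  shows "broken_geodesic (\<gamma> s) (\<gamma> t) (L * (t - s))"
  using step[OF base constant_speed_geodesic_affine(1)[OF assms(1), of 1 s], of "t - s"] assms(2)
  by simp

definition geodesic_dist :: "'a \<Rightarrow> 'a \<Rightarrow> real" where
  "geodesic_dist p q = Inf {L. broken_geodesic p q L}"

lemma geodesic_dist_le: "broken_geodesic p q L \<Longrightarrow> geodesic_dist p q \<le> L"
  unfolding geodesic_dist_def using broken_geodesic_nonneg
  by (intro cInf_lower) (auto intro!: bdd_belowI[of _ 0])

end

context complete_riemannian_manifold begin

text \<open>Completeness enters here, in place of solving the geodesic equation.\<close>

lemma geodesic_exists:
  assumes c: "c \<in> A" "p \<in> chart_dom c"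
  obtains \<gamma> L where "constant_speed_geodesic \<gamma> L" "\<gamma> 0 = p" "coord_velocity c \<gamma> 0 = u"
proof -
  obtain X where X: "X \<in> tangent_space A p" "X c = u"
    using tangent_vector_exists[OF c] by blast
  obtain \<gamma> where \<gamma>: "geodesic A G UNIV \<gamma>" "\<gamma> 0 = p" "has_velocity A UNIV \<gamma> 0 X"
    using geodesically_complete[OF X(1)] by blast
  have "coord_velocity c \<gamma> 0 = u"
    using \<gamma> c X by (intro vector_derivative_at) (auto simp: has_velocity_def)
  moreover obtain L where "constant_speed_geodesic \<gamma> L"
    using geodesic_constant_speed[OF \<gamma>(1)] .
  ultimately show ?thesis using that \<gamma>(2) by blast
qed

end

section \<open>Short geodesics in a chart\<close>

text \<open>These are not normal coordinates: \<open>c\<close> is any atlas chart around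
  \<open>y\<close>, together with a coordinate ball on which the uniform estimates hold.\<close>

locale normal_chart = complete_riemannian_manifold A G
  for A :: "('a::{t2_space, second_countable_topology}, 'e::euclidean_space) chart set"
    and G :: "('a, 'e) metric_tensor" +
  fixes c :: "('a, 'e) chart" and y :: 'a and R K :: real
  assumes chart_in_atlas: "c \<in> A" and center_in_dom: "y \<in> chart_dom c"
    and chart_ball: "chart_ball (chart_map c ` chart_dom c) (G c) (chart_map c y) R K"

lemma (in complete_riemannian_manifold) normal_chart_exists:
  obtains c R K where "normal_chart A G c y R K"
proof -
  obtain c where c: "c \<in> A" "y \<in> chart_dom c" using atlas_cover by blast
  obtain R K where "chart_ball (chart_map c ` chart_dom c) (G c) (chart_map c y) R K"
    using coordinate_metric.chart_ball_exists[OF coordinate_metric_chart[OF c(1)], of "chart_map c y"] c(2) by blast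
  then have "normal_chart A G c y R K"
    using c complete_riemannian_manifold_axioms by (intro normal_chart.intro normal_chart_axioms.intro)
  then show ?thesis by (rule that)
qed

sublocale normal_chart \<subseteq> ball: chart_ball "chart_map c ` chart_dom c" "G c" "chart_map c y" R K
  by (rule chart_ball)

context normal_chart begin

abbreviation \<phi> :: "'a \<Rightarrow> 'e" where "\<phi> \<equiv> chart_map c"

definition B :: "real \<Rightarrow> 'a set" where
  "B s = chart_dom c \<inter> \<phi> -` ball (\<phi> y) s"

lemma B_iff: "p \<in> B s \<longleftrightarrow> p \<in> chart_dom c \<and> dist (\<phi> y) (\<phi> p) < s"
  by (auto simp: B_def)

lemma open_B: "open (B s)"
  unfolding B_def using chart_in_atlas by (intro open_chart_preimage) auto

lemma B_in_cball: "p \<in> B R \<Longrightarrow> \<phi> p \<in> cball (\<phi> y) R"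
  by (auto simp: B_iff)

text \<open>Radius of the tangent vectors whose geodesics are slow enough for the estimates.\<close>

definition r :: real where "r = min (R / (8 * K\<^sup>2)) (1 / (8 * K ^ 3))"

lemma K_pos: "0 < K" using ball.K_ge_1 by simp

lemma r_pos: "0 < r"
  using ball.R_pos K_pos by (simp add: r_def)

text \<open>In order: slowness for the deviation and shooting estimates at coordinate speed
  \<open>K * r\<close>, slowness for the energy comparison, a bound for the coordinate displacement
  in unit time, and room inside the ball.\<close>

lemma r_bounds: "8 * K * (K * r) \<le> 1" "24 * K ^ 4 * (K * r)\<^sup>2 \<le> 1" "K * (K * r) \<le> R / 8" "r \<le> R / 8"
proof -
  note K = ball.K_ge_1
  have "r \<le> 1 / (8 * K ^ 3)" "r \<le> R / (8 * K\<^sup>2)" by (auto simp: r_def)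
  then have 1: "8 * (K ^ 3 * r) \<le> 1" and 2: "8 * (K\<^sup>2 * r) \<le> R"
    using K by (auto simp: field_simps)
  have "K\<^sup>2 * r \<le> K ^ 3 * r" using K r_pos by (intro mult_right_mono power_increasing) auto
  then show "8 * K * (K * r) \<le> 1" using 1 by (simp add: power2_eq_square)
  have "(8 * (K ^ 3 * r))\<^sup>2 \<le> 1" using 1 K r_pos by (intro power_le_one) auto
  then show "24 * K ^ 4 * (K * r)\<^sup>2 \<le> 1"
    by (simp add: power_mult_distrib power2_eq_square power4_eq_xxxx power3_eq_cube mult_ac)
  show "K * (K * r) \<le> R / 8" using 2 by (simp add: power2_eq_square mult_ac)
  have "1 * r \<le> K\<^sup>2 * r" using K r_pos by (intro mult_right_mono one_le_power) auto
  then show "r \<le> R / 8" using 2 by simp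
qed

section \<open>Confinement of geodesics to the coordinate ball\<close>

lemma coord_velocity_le:
  assumes \<gamma>: "constant_speed_geodesic \<gamma> L" and t: "\<gamma> t \<in> B R"
  shows "norm (coord_velocity c \<gamma> t) \<le> K * L"
proof (rule power2_le_imp_le)
  have "0 \<le> L" using \<gamma> by (simp add: constant_speed_geodesic_def)
  then show "0 \<le> K * L" using K_pos by simp
  have "(norm (coord_velocity c \<gamma> t))\<^sup>2 \<le> K * L\<^sup>2"
    using ball.coercive[OF B_in_cball[OF t], of "coord_velocity c \<gamma> t"]
      constant_speed_geodesicD(4)[OF \<gamma> chart_in_atlas, of t] t
    by (simp add: B_iff)
  also have "\<dots> \<le> K\<^sup>2 * L\<^sup>2"
    using ball.K_ge_1 by (intro mult_right_mono) (auto simp: power2_eq_square)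
  finally show "(norm (coord_velocity c \<gamma> t))\<^sup>2 \<le> (K * L)\<^sup>2" by (simp add: power_mult_distrib)
qed

lemma displacement_le:
  assumes \<gamma>: "constant_speed_geodesic \<gamma> L" and t: "0 \<le> t" and B: "\<And>s. 0 \<le> s \<Longrightarrow> s \<le> t \<Longrightarrow> \<gamma> s \<in> B R"
  shows "dist (\<phi> (\<gamma> 0)) (\<phi> (\<gamma> t)) \<le> K * L * t"
proof -
  have geo: "geodesic A G UNIV \<gamma>" using \<gamma> constant_speed_geodesic_def by blast
  have "norm ((\<phi> \<circ> \<gamma>) t - (\<phi> \<circ> \<gamma>) 0) \<le> (K * L) * norm (t - 0)"
  proof (rule differentiable_bound[where S = "{0..t}" and f' = "\<lambda>s h. h *\<^sub>R coord_velocity c \<gamma> s"])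
    fix s assume "s \<in> {0..t}"
    then have s: "\<gamma> s \<in> B R" using B by auto
    have "((\<phi> \<circ> \<gamma>) has_vector_derivative coord_velocity c \<gamma> s) (at s)"
      using s by (intro geodesic_coord_velocity[OF geo chart_in_atlas]) (simp add: B_iff)
    then show "((\<phi> \<circ> \<gamma>) has_derivative (\<lambda>h. h *\<^sub>R coord_velocity c \<gamma> s)) (at s within {0..t})"
      unfolding has_vector_derivative_def by (rule has_derivative_at_withinI)
    show "onorm (\<lambda>h. h *\<^sub>R coord_velocity c \<gamma> s) \<le> K * L"
    proof (rule onorm_le)
      show "norm (h *\<^sub>R coord_velocity c \<gamma> s) \<le> K * L * norm h" for h
        using mult_right_mono[OF coord_velocity_le[OF \<gamma> s], of "\<bar>h\<bar>"] by (simp add: mult.commute)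
    qed
  qed (use t in auto)
  then show ?thesis using t by (simp add: dist_norm norm_minus_commute)
qed

lemma compact_chart_cball: "s \<le> R \<Longrightarrow> compact (chart_inv c ` cball (\<phi> y) s)"
proof (rule compact_continuous_image)
  assume "s \<le> R"
  then have "cball (\<phi> y) s \<subseteq> \<phi> ` chart_dom c"
    using ball.cball_subset by auto
  then show "continuous_on (cball (\<phi> y) s) (chart_inv c)"
    using continuous_on_chart_inv[OF chart_in_atlas] continuous_on_subset by blast
qed simp

lemma chart_inv_cball:
  assumes "s \<le> R" "x \<in> cball (\<phi> y) s"
  shows "chart_inv c x \<in> chart_dom c" "\<phi> (chart_inv c x) = x"
proof -
  have "x \<in> \<phi> ` chart_dom c" using assms ball.cball_subset by auto
  then show "chart_inv c x \<in> chart_dom c" "\<phi> (chart_inv c x) = x"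
    using chart_inv_map[OF chart_in_atlas] by auto
qed

text \<open>At the first exit time the curve would still be in a compact subset of the chart domain.\<close>

lemma geodesic_stays:
  assumes \<gamma>: "constant_speed_geodesic \<gamma> L" and \<gamma>0: "\<gamma> 0 \<in> chart_dom c"
    and T: "0 \<le> T" and R: "dist (\<phi> y) (\<phi> (\<gamma> 0)) + K * L * T < R" and t: "0 \<le> t" "t \<le> T"
  shows "\<gamma> t \<in> B R" "dist (\<phi> (\<gamma> 0)) (\<phi> (\<gamma> t)) \<le> K * L * t"
proof -
  have L: "0 \<le> K * L" using \<gamma> K_pos by (simp add: constant_speed_geodesic_def)
  have cont: "continuous_on UNIV \<gamma>" using \<gamma> by (simp add: constant_speed_geodesic_def geodesic_def)
  have all: "\<gamma> t \<in> B R" if t: "0 \<le> t" "t \<le> T" for t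
  proof (rule ccontr)
    assume bad: "\<gamma> t \<notin> B R"
    define S where "S = {0..T} \<inter> \<gamma> -` (- B R)"
    have "closed S"
      unfolding S_def using cont open_B by (intro closed_Int closed_vimage) auto
    moreover have "t \<in> S" "bdd_below S" using bad t by (auto simp: S_def)
    ultimately have "Inf S \<in> S" using closed_contains_Inf by blast
    define s where "s = Inf S"
    have s: "0 \<le> s" "s \<le> T" "\<gamma> s \<notin> B R" using \<open>Inf S \<in> S\<close> by (auto simp: s_def S_def)
    have before: "\<gamma> q \<in> B R" if "0 \<le> q" "q < s" for q
    proof (rule ccontr)
      assume "\<gamma> q \<notin> B R"
      then have "q \<in> S" using that s by (auto simp: S_def)
      then show False using cInf_lower[OF _ \<open>bdd_below S\<close>] that(2) by (force simp: s_def)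
    qed
    define \<rho> where "\<rho> = dist (\<phi> y) (\<phi> (\<gamma> 0)) + K * L * T"
    have "\<gamma> 0 \<in> B R" using \<gamma>0 R L T by (simp add: B_iff) (smt (verit) mult_nonneg_nonneg)
    then have "0 < s" using s by (cases "s = 0") auto
    have "\<gamma> q \<in> chart_inv c ` cball (\<phi> y) \<rho>" if q: "0 \<le> q" "q < s" for q
    proof -
      have "dist (\<phi> (\<gamma> 0)) (\<phi> (\<gamma> q)) \<le> K * L * q"
        using q before by (intro displacement_le[OF \<gamma>]) auto
      also have "\<dots> \<le> K * L * T" using L q s by (intro mult_left_mono) auto
      finally have "dist (\<phi> y) (\<phi> (\<gamma> q)) \<le> \<rho>"
        unfolding \<rho>_def using dist_triangle[of "\<phi> y" "\<phi> (\<gamma> q)" "\<phi> (\<gamma> 0)"] by linarith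
      moreover have "\<gamma> q = chart_inv c (\<phi> (\<gamma> q))"
        using before[OF q] chart_inv_map[OF chart_in_atlas] by (simp add: B_iff)
      ultimately show ?thesis by (metis image_eqI mem_cball)
    qed
    then have "{0..<s} \<subseteq> \<gamma> -` (chart_inv c ` cball (\<phi> y) \<rho>)" by auto
    \<comment> \<open>Coordinates of \<open>\<gamma> s\<close> are meaningless until it is known to
      lie in the chart domain. The limit is therefore taken in the manifold, where compact sets are
      closed by the Hausdorff property.\<close>
    moreover have "closed (\<gamma> -` (chart_inv c ` cball (\<phi> y) \<rho>))"
      using R compact_chart_cball[of \<rho>] compact_imp_closed cont
      by (intro closed_vimage) (auto simp: \<rho>_def)
    ultimately have "closure {0..<s} \<subseteq> \<gamma> -` (chart_inv c ` cball (\<phi> y) \<rho>)"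
      by (rule closure_minimal)
    moreover have "s \<in> closure {0..<s}" using \<open>0 < s\<close> by simp
    ultimately have "s \<in> \<gamma> -` (chart_inv c ` cball (\<phi> y) \<rho>)" by (rule subsetD)
    then have "\<gamma> s \<in> chart_inv c ` cball (\<phi> y) \<rho>" by (rule vimageD)
    then obtain z where z: "z \<in> cball (\<phi> y) \<rho>" "\<gamma> s = chart_inv c z" by blast
    then have "\<gamma> s \<in> B R"
      using chart_inv_cball[of \<rho> z] R by (auto simp: B_iff \<rho>_def)
    then show False using s by blast
  qed
  show "\<gamma> t \<in> B R" using all t .
  show "dist (\<phi> (\<gamma> 0)) (\<phi> (\<gamma> t)) \<le> K * L * t"
    using all t by (intro displacement_le[OF \<gamma>]) auto
qed

text \<open>Induction over the pieces: the length used so far bounds the displacement, and the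
  remaining slack keeps the next piece in the ball.\<close>

lemma broken_geodesic_displacement:
  assumes "broken_geodesic p q L" "p \<in> chart_dom c" "dist (\<phi> y) (\<phi> p) + K * L < R"
  shows "q \<in> chart_dom c" "dist (\<phi> p) (\<phi> q) \<le> K * L"
proof -
  have "q \<in> chart_dom c \<and> dist (\<phi> p) (\<phi> q) \<le> K * L"
    using assms
  proof (induction rule: broken_geodesic.induct)
    case (step \<gamma> M L t)
    have L: "0 \<le> K * (L * t)" using step K_pos by (simp add: constant_speed_geodesic_def)
    have IH: "\<gamma> 0 \<in> chart_dom c" "dist (\<phi> p) (\<phi> (\<gamma> 0)) \<le> K * M"
      using step L by (auto simp: algebra_simps)
    have *: "dist (\<phi> y) (\<phi> (\<gamma> 0)) + K * L * t < R"
      using IH step.prems dist_triangle[of "\<phi> y" "\<phi> (\<gamma> 0)" "\<phi> p"] by (simp add: algebra_simps)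
    have "\<gamma> t \<in> B R" "dist (\<phi> (\<gamma> 0)) (\<phi> (\<gamma> t)) \<le> K * L * t"
      using geodesic_stays[OF step.hyps(2) IH(1) step.hyps(3) *] step.hyps(3) by auto
    then show ?case
      using IH dist_triangle[of "\<phi> p" "\<phi> (\<gamma> t)" "\<phi> (\<gamma> 0)"] by (simp add: B_iff algebra_simps)
  qed simp
  then show "q \<in> chart_dom c" "dist (\<phi> p) (\<phi> q) \<le> K * L" by auto
qed

section \<open>Short geodesics: existence by shooting and minimality\<close>

definition short_geodesic :: "(real \<Rightarrow> 'a) \<Rightarrow> real \<Rightarrow> bool" where
  "short_geodesic \<gamma> L \<longleftrightarrow> constant_speed_geodesic \<gamma> L \<and> \<gamma> 0 \<in> B (R / 2) \<and> norm (coord_velocity c \<gamma> 0) \<le> r"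

text \<open>Conservation of speed: the velocity at time 0 controls \<open>L\<close>, which confines
  the curve to the ball and in turn controls its coordinate velocity at all times of the unit
  interval.\<close>

lemma short_geodesic_bounds:
  assumes \<gamma>: "short_geodesic \<gamma> L" and t: "t \<in> {0..1}"
  shows "L \<le> K * norm (coord_velocity c \<gamma> 0)" "\<gamma> t \<in> B R"
    "ball.coord_geodesic (\<phi> \<circ> \<gamma>) (coord_velocity c \<gamma>) t"
    "norm (coord_velocity c \<gamma> t) \<le> K * norm (coord_velocity c \<gamma> 0)"
    "norm (coord_velocity c \<gamma> t) \<le> K * r"
proof -
  let ?u = "coord_velocity c \<gamma> 0"
  have geo: "constant_speed_geodesic \<gamma> L" and \<gamma>0: "\<gamma> 0 \<in> B (R / 2)" and u: "norm ?u \<le> r"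
    using \<gamma> by (auto simp: short_geodesic_def)
  have L: "0 \<le> L" using geo by (simp add: constant_speed_geodesic_def)
  have \<gamma>0': "\<gamma> 0 \<in> B R" "\<gamma> 0 \<in> chart_dom c" using \<gamma>0 ball.R_pos by (auto simp: B_iff)
  have L2: "L\<^sup>2 \<le> K * (norm ?u)\<^sup>2"
    using ball.g_bound[OF B_in_cball[OF \<gamma>0'(1)], of ?u ?u]
      constant_speed_geodesicD(4)[OF geo chart_in_atlas \<gamma>0'(2)]
    by (simp add: power2_eq_square)
  also have "\<dots> \<le> K\<^sup>2 * (norm ?u)\<^sup>2"
    using ball.K_ge_1 by (intro mult_right_mono) (auto simp: power2_eq_square)
  finally have "L\<^sup>2 \<le> (K * norm ?u)\<^sup>2" by (simp add: power_mult_distrib)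
  then show LK: "L \<le> K * norm ?u"
    by (rule power2_le_imp_le) (use K_pos in simp)
  have Kr: "K * norm ?u \<le> K * r" using u K_pos by (intro mult_left_mono) auto
  then have "L \<le> K * r" using LK by linarith
  then have "K * L * 1 \<le> K * (K * r)"
    using K_pos by simp
  then have "dist (\<phi> y) (\<phi> (\<gamma> 0)) + K * L * 1 < R"
    using \<gamma>0 r_bounds ball.R_pos by (simp add: B_iff)
  from geodesic_stays(1)[OF geo \<gamma>0'(2) _ this] show tB: "\<gamma> t \<in> B R" using t by auto
  then show "ball.coord_geodesic (\<phi> \<circ> \<gamma>) (coord_velocity c \<gamma>) t"
    using geodesic_in_chart[OF _ chart_in_atlas] geo by (simp add: constant_speed_geodesic_def B_iff)
  have "(norm (coord_velocity c \<gamma> t))\<^sup>2 \<le> K * L\<^sup>2"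
    using ball.coercive[OF B_in_cball[OF tB], of "coord_velocity c \<gamma> t"]
      constant_speed_geodesicD(4)[OF geo chart_in_atlas, of t] tB
    by (simp add: B_iff)
  also have "\<dots> \<le> K * (K * (norm ?u)\<^sup>2)"
    using L2 K_pos by (intro mult_left_mono) auto
  finally have "(norm (coord_velocity c \<gamma> t))\<^sup>2 \<le> (K * norm ?u)\<^sup>2"
    by (simp add: power_mult_distrib power2_eq_square mult_ac)
  then show *: "norm (coord_velocity c \<gamma> t) \<le> K * norm ?u"
    by (rule power2_le_imp_le) (use K_pos in simp)
  from * Kr show "norm (coord_velocity c \<gamma> t) \<le> K * r" by linarith
qed

text \<open>Shooting, with a geodesic from \<open>a\<close> chosen for every initial
  velocity.\<close>

lemma short_geodesic_exists:
  assumes a: "a \<in> B (R / 2)" and b: "b \<in> chart_dom c" and ab: "dist (\<phi> a) (\<phi> b) \<le> r / 2"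
  obtains \<gamma> L where "short_geodesic \<gamma> L" "\<gamma> 0 = a" "\<gamma> 1 = b" "L \<le> 2 * K * dist (\<phi> a) (\<phi> b)"
proof -
  have a': "a \<in> chart_dom c" using a by (simp add: B_iff)
  have "\<exists>\<gamma> L. constant_speed_geodesic \<gamma> L \<and> \<gamma> 0 = a \<and> coord_velocity c \<gamma> 0 = u" for u
    using geodesic_exists[OF chart_in_atlas a'] by metis
  then obtain \<gamma> L where \<gamma>: "\<And>u. constant_speed_geodesic (\<gamma> u) (L u)" "\<And>u. \<gamma> u 0 = a"
      "\<And>u. coord_velocity c (\<gamma> u) 0 = u"
    by metis
  have short: "short_geodesic (\<gamma> u) (L u)" if "norm u \<le> r" for u
    using \<gamma> that a by (simp add: short_geodesic_def)
  obtain u where u: "norm u \<le> r" "(\<phi> \<circ> \<gamma> u) 1 = \<phi> b" "norm u \<le> 2 * norm (\<phi> b - \<phi> a)"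
  proof (rule ball.geodesic_shooting[where x = "\<lambda>u. \<phi> \<circ> \<gamma> u" and v = "\<lambda>u. coord_velocity c (\<gamma> u)" and r = r and a = "\<phi> a" and b = "\<phi> b"])
    fix u :: 'e and t :: real assume u: "norm u \<le> r" and t: "t \<in> {0..1}"
    show "ball.coord_geodesic (\<phi> \<circ> \<gamma> u) (coord_velocity c (\<gamma> u)) t \<and>
       (\<phi> \<circ> \<gamma> u) t \<in> cball (\<phi> y) R \<and> norm (coord_velocity c (\<gamma> u) t) \<le> K * norm u"
      using short_geodesic_bounds[OF short[OF u] t] \<gamma>(3)[of u] B_in_cball by auto
  next
    show "norm (\<phi> b - \<phi> a) \<le> r / 2" using ab by (simp add: dist_norm norm_minus_commute)
  qed (use \<gamma> r_pos r_bounds in auto)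
  show ?thesis
  proof (rule that[OF short[OF u(1)] \<gamma>(2)])
    have "\<gamma> u 1 \<in> chart_dom c"
      using short_geodesic_bounds(2)[OF short[OF u(1)], of 1] by (simp add: B_iff)
    then show "\<gamma> u 1 = b" using u(2) b chart_map_inj[OF chart_in_atlas] by simp
    have "L u \<le> K * norm u"
      using short_geodesic_bounds(1)[OF short[OF u(1)], of 0] \<gamma>(3)[of u] by simp
    also have "\<dots> \<le> K * (2 * norm (\<phi> b - \<phi> a))" using u(3) K_pos by (intro mult_left_mono) auto
    finally show "L u \<le> 2 * K * dist (\<phi> a) (\<phi> b)" by (simp add: dist_norm norm_minus_commute)
  qed
qed

text \<open>The energy comparison with the curve that follows \<open>\<sigma>\<close> until
  \<open>\<theta>\<close> and \<open>\<tau>\<close> afterwards, at possibly different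
  speeds.\<close>

lemma short_geodesic_corner:
  assumes \<gamma>: "short_geodesic \<gamma> e" and \<theta>: "0 < \<theta>" "\<theta> < 1"
    and \<sigma>: "constant_speed_geodesic \<sigma> a" "\<And>t. 0 \<le> t \<Longrightarrow> t \<le> \<theta> \<Longrightarrow> \<sigma> t \<in> B R"
    and \<tau>: "constant_speed_geodesic \<tau> b" "\<And>t. \<theta> \<le> t \<Longrightarrow> t \<le> 1 \<Longrightarrow> \<tau> t \<in> B R"
    and ends: "\<sigma> 0 = \<gamma> 0" "\<sigma> \<theta> = \<tau> \<theta>" "\<tau> 1 = \<gamma> 1"
  shows "e\<^sup>2 \<le> \<theta> * a\<^sup>2 + (1 - \<theta>) * b\<^sup>2"
    and "\<theta> * a\<^sup>2 + (1 - \<theta>) * b\<^sup>2 \<le> e\<^sup>2 \<Longrightarrow> 0 \<le> t \<Longrightarrow> t < \<theta> \<Longrightarrow> \<sigma> t = \<gamma> t"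
proof -
  define C where "C t = (if t \<le> \<theta> then \<phi> (\<sigma> t) else \<phi> (\<tau> t))" for t
  define C' where "C' t = (if t \<le> \<theta> then coord_velocity c \<sigma> t else coord_velocity c \<tau> t)" for t
  have geo: "geodesic A G UNIV \<gamma>" "geodesic A G UNIV \<sigma>" "geodesic A G UNIV \<tau>"
    using \<gamma> \<sigma> \<tau> by (auto simp: short_geodesic_def constant_speed_geodesic_def)
  have x: "ball.coord_geodesic (\<phi> \<circ> \<gamma>) (coord_velocity c \<gamma>) t \<and> (\<phi> \<circ> \<gamma>) t \<in> cball (\<phi> y) R \<and>
      norm (coord_velocity c \<gamma> t) \<le> K * r" if "t \<in> {0..1}" for t
    using short_geodesic_bounds[OF \<gamma> that] B_in_cball by auto
  have e: "G c ((\<phi> \<circ> \<gamma>) t) (coord_velocity c \<gamma> t) (coord_velocity c \<gamma> t) = e\<^sup>2" if "t \<in> {0..1}" for t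
    using short_geodesic_bounds(2)[OF \<gamma> that] constant_speed_geodesicD(4)[OF _ chart_in_atlas] \<gamma>
    by (simp add: short_geodesic_def B_iff)
  have cont\<phi>: "continuous_on S (\<lambda>t. \<phi> (\<eta> t))" if "geodesic A G UNIV \<eta>" "\<And>t. t \<in> S \<Longrightarrow> \<eta> t \<in> B R" for \<eta> S
  proof (rule continuous_on_compose2[OF continuous_on_chart_map[OF chart_in_atlas]])
    show "continuous_on S \<eta>" using that(1) by (auto simp: geodesic_def intro: continuous_on_subset)
  qed (use that(2) in \<open>auto simp: B_iff\<close>)
  have C_cont: "continuous_on {0..1} C"
    unfolding C_def
  proof (rule continuous_on_cases_le)
    show "continuous_on {t \<in> {0..1}. t \<le> \<theta>} (\<lambda>t. \<phi> (\<sigma> t))" "continuous_on {t \<in> {0..1}. \<theta> \<le> t} (\<lambda>t. \<phi> (\<tau> t))"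
      by (rule cont\<phi>; use \<sigma>(2) \<tau>(2) geo in auto)+
  qed (use ends in \<open>auto intro: continuous_on_id\<close>)
  have C_ball: "C t \<in> cball (\<phi> y) R" if "t \<in> {0..1}" for t
    using that B_in_cball[OF \<sigma>(2)[of t]] B_in_cball[OF \<tau>(2)[of t]] by (auto simp: C_def)
  have C_ends: "C 0 = (\<phi> \<circ> \<gamma>) 0" "C 1 = (\<phi> \<circ> \<gamma>) 1"
    using \<theta> ends by (auto simp: C_def)
  have C1: "(C has_vector_derivative C' t) (at t) \<and> G c (C t) (C' t) (C' t) = a\<^sup>2" if t: "0 < t" "t < \<theta>" for t
  proof
    have tB: "\<sigma> t \<in> chart_dom c" using \<sigma>(2)[of t] t by (simp add: B_iff)
    have "((\<phi> \<circ> \<sigma>) has_vector_derivative C' t) (at t)"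
      using geodesic_coord_velocity[OF geo(2) chart_in_atlas tB] t by (simp add: C'_def)
    then show "(C has_vector_derivative C' t) (at t)"
      by (rule has_vector_derivative_transform_within_open[where S = "{..<\<theta>}"]) (use t in \<open>auto simp: C_def\<close>)
    show "G c (C t) (C' t) (C' t) = a\<^sup>2"
      using constant_speed_geodesicD(4)[OF \<sigma>(1) chart_in_atlas tB] t by (simp add: C_def C'_def)
  qed
  have C2: "(C has_vector_derivative C' t) (at t) \<and> G c (C t) (C' t) (C' t) = b\<^sup>2" if t: "\<theta> < t" "t < 1" for t
  proof
    have tB: "\<tau> t \<in> chart_dom c" using \<tau>(2)[of t] t by (simp add: B_iff)
    have "((\<phi> \<circ> \<tau>) has_vector_derivative C' t) (at t)"
      using geodesic_coord_velocity[OF geo(3) chart_in_atlas tB] t by (simp add: C'_def)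
    then show "(C has_vector_derivative C' t) (at t)"
      by (rule has_vector_derivative_transform_within_open[where S = "{\<theta><..}"]) (use t in \<open>auto simp: C_def\<close>)
    show "G c (C t) (C' t) (C' t) = b\<^sup>2"
      using constant_speed_geodesicD(4)[OF \<tau>(1) chart_in_atlas tB] t by (simp add: C_def C'_def)
  qed
  show "e\<^sup>2 \<le> \<theta> * a\<^sup>2 + (1 - \<theta>) * b\<^sup>2"
    by (rule ball.slow_geodesic_minimizes_energy(1)[OF x e r_bounds(2) \<theta> C_cont C_ball C_ends C1 C2])
  assume eq: "\<theta> * a\<^sup>2 + (1 - \<theta>) * b\<^sup>2 \<le> e\<^sup>2"
  have C_eq: "C t = (\<phi> \<circ> \<gamma>) t" if "t \<in> {0..1}" "t \<noteq> \<theta>" for t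
    by (rule ball.slow_geodesic_minimizes_energy(2)[OF x e r_bounds(2) \<theta> C_cont C_ball C_ends C1 C2 eq that])
  show "\<sigma> t = \<gamma> t" if "0 \<le> t" "t < \<theta>"
  proof (rule chart_map_inj[OF chart_in_atlas])
    show "\<sigma> t \<in> chart_dom c" "\<gamma> t \<in> chart_dom c"
      using \<sigma>(2)[of t] short_geodesic_bounds(2)[OF \<gamma>, of t] that \<theta> by (auto simp: B_iff)
    show "\<phi> (\<sigma> t) = \<phi> (\<gamma> t)" using C_eq[of t] that \<theta> by (simp add: C_def)
  qed
qed

text \<open>The optimal corner time divides the unit interval in proportion to the two lengths; the
  energy is then the square of the total length. Adding \<open>\<epsilon> / 2\<close> to each length
  keeps \<open>\<theta>\<close> strictly between 0 and 1 even if \<open>a\<close> or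
  \<open>b\<close> is 0.\<close>

lemma short_geodesic_triangle:
  assumes \<gamma>: "short_geodesic \<gamma> e"
    and \<sigma>: "constant_speed_geodesic \<sigma> a" "\<And>t. 0 \<le> t \<Longrightarrow> t \<le> 1 \<Longrightarrow> \<sigma> t \<in> B R"
    and \<tau>: "constant_speed_geodesic \<tau> b" "\<And>t. 0 \<le> t \<Longrightarrow> t \<le> 1 \<Longrightarrow> \<tau> t \<in> B R"
    and ends: "\<sigma> 0 = \<gamma> 0" "\<sigma> 1 = \<tau> 0" "\<tau> 1 = \<gamma> 1"
  shows "e \<le> a + b"
proof (rule field_le_epsilon)
  fix \<epsilon> :: real assume \<epsilon>: "0 < \<epsilon>"
  have ab: "0 \<le> a" "0 \<le> b" using \<sigma>(1) \<tau>(1) constant_speed_geodesicD(2) by blast+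
  define p q where "p = a + \<epsilon> / 2" and "q = b + \<epsilon> / 2"
  define \<theta> where "\<theta> = p / (p + q)"
  have pq: "0 < p" "0 < q" "a \<le> p" "b \<le> q" using ab \<epsilon> by (auto simp: p_def q_def)
  have \<theta>: "0 < \<theta>" "\<theta> < 1" and \<theta>': "1 - \<theta> = q / (p + q)" using pq by (auto simp: \<theta>_def field_simps)
  have "e\<^sup>2 \<le> \<theta> * (\<bar>1 / \<theta>\<bar> * a)\<^sup>2 + (1 - \<theta>) * (\<bar>1 / (1 - \<theta>)\<bar> * b)\<^sup>2"
  proof (rule short_geodesic_corner(1)[OF \<gamma> \<theta> constant_speed_geodesic_affine(1)[OF \<sigma>(1), where b = 0] _
        constant_speed_geodesic_affine(1)[OF \<tau>(1), where b = "- \<theta> / (1 - \<theta>)"]])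
    show "\<sigma> (1 / \<theta> * t + 0) \<in> B R" if "0 \<le> t" "t \<le> \<theta>" for t
      using that \<theta> by (intro \<sigma>(2)) auto
    show "\<tau> (1 / (1 - \<theta>) * t + - \<theta> / (1 - \<theta>)) \<in> B R" if "\<theta> \<le> t" "t \<le> 1" for t
    proof -
      have "1 / (1 - \<theta>) * t + - \<theta> / (1 - \<theta>) = (t - \<theta>) / (1 - \<theta>)" by (simp add: diff_divide_distrib)
      then show ?thesis using that \<theta> by (intro \<tau>(2)) auto
    qed
    show "\<tau> (1 / (1 - \<theta>) * 1 + - \<theta> / (1 - \<theta>)) = \<gamma> 1"
    proof -
      have "1 / (1 - \<theta>) * 1 + - \<theta> / (1 - \<theta>) = 1" using \<theta> by (simp add: field_simps)
      then show ?thesis using ends by simp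
    qed
  qed (use \<theta> ends in auto)
  also have "\<dots> = a\<^sup>2 / \<theta> + b\<^sup>2 / (1 - \<theta>)"
    using \<theta> by (simp add: power2_eq_square)
  also have "\<dots> \<le> p\<^sup>2 / \<theta> + q\<^sup>2 / (1 - \<theta>)"
    using \<theta> ab pq by (intro add_mono divide_right_mono power_mono) auto
  also have "p\<^sup>2 / \<theta> = p * (p + q)" using pq by (simp add: \<theta>_def power2_eq_square)
  also have "q\<^sup>2 / (1 - \<theta>) = q * (p + q)" using pq by (simp add: \<theta>' power2_eq_square)
  also have "p * (p + q) + q * (p + q) = (p + q)\<^sup>2" by (simp add: power2_eq_square algebra_simps)
  finally have "e \<le> p + q" by (rule power2_le_imp_le) (use pq in simp)
  then show "e \<le> a + b + \<epsilon>" by (simp add: p_def q_def)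
qed

text \<open>Induction over the pieces: the path so far is replaced by one short geodesic, and the
  triangle inequality absorbs the next piece. The bound on the length keeps all end points within
  the shooting range \<open>r / 2\<close> of \<open>a\<close>.\<close>

lemma short_geodesic_below_broken_geodesic:
  assumes "broken_geodesic a q L" "a \<in> B (R / 2)" "K * L \<le> r / 2"
  shows "\<exists>\<gamma> e. short_geodesic \<gamma> e \<and> \<gamma> 0 = a \<and> \<gamma> 1 = q \<and> e \<le> L"
  using assms
proof (induction rule: broken_geodesic.induct)
  case base
  have "a \<in> chart_dom c" using base by (simp add: B_iff)
  then obtain \<gamma> L where "short_geodesic \<gamma> L" "\<gamma> 0 = a" "\<gamma> 1 = a" "L \<le> 2 * K * dist (\<phi> a) (\<phi> a)"
    using short_geodesic_exists[of a a] base r_pos by auto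
  then show ?case by auto
next
  case (step \<sigma> M L t)
  have nonneg: "0 \<le> K * L * t" "0 \<le> K * M"
    using step.hyps constant_speed_geodesicD(2) broken_geodesic_nonneg K_pos by (auto intro!: mult_nonneg_nonneg)
  have le: "K * M + K * L * t \<le> r / 2" using step.prems by (simp add: algebra_simps)
  have a: "a \<in> chart_dom c" "dist (\<phi> y) (\<phi> a) < R / 2" using step.prems by (auto simp: B_iff)
  obtain \<gamma>' e' where \<gamma>': "short_geodesic \<gamma>' e'" "\<gamma>' 0 = a" "\<gamma>' 1 = \<sigma> 0" "e' \<le> M"
    using step.IH step.prems le nonneg by auto
  have R: "dist (\<phi> y) (\<phi> a) + (K * M + K * L * t) < R"
    using a le r_bounds(4) r_pos ball.R_pos by linarith
  have "broken_geodesic a (\<sigma> t) (M + L * t)" by (rule broken_geodesic.step[OF step.hyps])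
  from broken_geodesic_displacement[OF this a(1)] have fin: "\<sigma> t \<in> chart_dom c" "dist (\<phi> a) (\<phi> (\<sigma> t)) \<le> r / 2"
    using R le by (auto simp: algebra_simps)
  obtain \<gamma> e where \<gamma>: "short_geodesic \<gamma> e" "\<gamma> 0 = a" "\<gamma> 1 = \<sigma> t"
    using short_geodesic_exists[OF step.prems(1) fin] by blast
  have \<sigma>0: "\<sigma> 0 \<in> chart_dom c" "dist (\<phi> a) (\<phi> (\<sigma> 0)) \<le> K * M"
    using broken_geodesic_displacement[OF step.hyps(1) a(1)] R nonneg by auto
  then have \<sigma>R: "dist (\<phi> y) (\<phi> (\<sigma> 0)) + K * L * t < R"
    using R dist_triangle[of "\<phi> y" "\<phi> (\<sigma> 0)" "\<phi> a"] by linarith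
  have "e \<le> e' + \<bar>t\<bar> * L"
  proof (rule short_geodesic_triangle[OF \<gamma>(1) _ _ constant_speed_geodesic_affine(1)[OF step.hyps(2), where b = 0]])
    show "constant_speed_geodesic \<gamma>' e'" using \<gamma>'(1) by (simp add: short_geodesic_def)
    show "\<gamma>' s \<in> B R" if "0 \<le> s" "s \<le> 1" for s
      using short_geodesic_bounds(2)[OF \<gamma>'(1)] that by simp
    show "\<sigma> (t * s + 0) \<in> B R" if "0 \<le> s" "s \<le> 1" for s
      using that step.hyps(3) by (intro geodesic_stays(1)[OF step.hyps(2) \<sigma>0(1) step.hyps(3) \<sigma>R]) (auto intro: mult_left_le)
  qed (use \<gamma> \<gamma>' in auto)
  then have "e \<le> M + L * t" using \<gamma>'(4) step.hyps(3) by (simp add: mult.commute)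
  then show ?case using \<gamma> by blast
qed

text \<open>Chosen so that the geodesic found by shooting between two points of \<open>B r'\<close>
  has length at most \<open>2 * K * (2 * r') \<le> r / (2 * K)\<close>. Broken geodesics outside the
  reach of the comparison are longer than \<open>r / (2 * K)\<close>.\<close>

definition r' :: real where "r' = r / (8 * K\<^sup>2)"

lemma r'_bounds: "0 < r'" "r' \<le> r / 8" "r' \<le> R / 2" "4 * K * r' \<le> r / (2 * K)"
proof -
  note K = ball.K_ge_1
  show "0 < r'" using r_pos K by (simp add: r'_def)
  have "r / (8 * K\<^sup>2) \<le> r / (8 * 1)"
    using K r_pos one_le_power[of K 2] by (intro divide_left_mono mult_left_mono) auto
  then show "r' \<le> r / 8" by (simp add: r'_def)
  then show "r' \<le> R / 2" using r_bounds r_pos by linarith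
  show "4 * K * r' \<le> r / (2 * K)" using K by (simp add: r'_def power2_eq_square)
qed

lemma geodesic_dist_realized:
  assumes a: "a \<in> B r'" and b: "b \<in> B r'"
  obtains \<gamma> where "short_geodesic \<gamma> (geodesic_dist a b)" "\<gamma> 0 = a" "\<gamma> 1 = b"
    "geodesic_dist a b \<le> 2 * K * dist (\<phi> a) (\<phi> b)"
proof -
  have ab: "dist (\<phi> a) (\<phi> b) \<le> 2 * r'"
    using a b dist_triangle3[of "\<phi> a" "\<phi> b" "\<phi> y"] by (simp add: B_iff)
  have a': "a \<in> B (R / 2)" using a r'_bounds by (simp add: B_iff)
  have "dist (\<phi> a) (\<phi> b) \<le> r / 2" using ab r'_bounds r_pos by linarith
  moreover have "b \<in> chart_dom c" using b by (simp add: B_iff)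
  ultimately obtain \<gamma> e where \<gamma>: "short_geodesic \<gamma> e" "\<gamma> 0 = a" "\<gamma> 1 = b" and e: "e \<le> 2 * K * dist (\<phi> a) (\<phi> b)"
    using short_geodesic_exists[OF a'] by metis
  have csg: "constant_speed_geodesic \<gamma> e" using \<gamma> by (simp add: short_geodesic_def)
  have "e \<le> L" if L: "broken_geodesic a b L" for L
  proof (cases "K * L \<le> r / 2")
    case True
    obtain \<gamma>' e' where \<gamma>': "short_geodesic \<gamma>' e'" "\<gamma>' 0 = a" "\<gamma>' 1 = b" "e' \<le> L"
      using short_geodesic_below_broken_geodesic[OF L a' True] by blast
    then have csg': "constant_speed_geodesic \<gamma>' e'" by (simp add: short_geodesic_def)
    \<comment> \<open>With \<open>\<gamma>'\<close> serving as both pieces, the comparison shows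
      that no short geodesic with these ends is shorter than \<open>\<gamma>\<close>.\<close>
    have "e\<^sup>2 \<le> (1/2) * e'\<^sup>2 + (1 - 1/2) * e'\<^sup>2"
      using short_geodesic_bounds(2)[OF \<gamma>'(1)] \<gamma> \<gamma>'
      by (intro short_geodesic_corner(1)[OF \<gamma>(1) _ _ csg' _ csg']) auto
    then have "e \<le> e'"
      using constant_speed_geodesicD(2)[OF csg'] by (intro power2_le_imp_le[of e e']) simp_all
    then show ?thesis using \<gamma>'(4) by simp
  next
    \<comment> \<open>Too long for the comparison, hence at least as long as \<open>\<gamma>\<close>
      by the choice of \<open>r'\<close>.\<close>
    case False
    have "2 * K * dist (\<phi> a) (\<phi> b) \<le> 2 * K * (2 * r')" using ab K_pos by (intro mult_left_mono) auto
    also have "\<dots> \<le> r / (2 * K)" using r'_bounds(4) by simp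
    also have "\<dots> \<le> L" using False K_pos by (simp add: field_simps)
    finally show ?thesis using e by simp
  qed
  moreover have "broken_geodesic a b e"
    using broken_geodesic_segment[OF csg, of 0 1] \<gamma> by simp
  ultimately have "geodesic_dist a b = e"
    unfolding geodesic_dist_def by (intro cInf_eq_minimum) auto
  then show ?thesis using that \<gamma> e by metis
qed

text \<open>Local uniqueness for the geodesic equation is the deviation estimate with equal initial
  velocities.\<close>

lemma short_geodesic_unique:
  assumes "short_geodesic \<gamma> a" "short_geodesic \<sigma> b" "\<gamma> 0 = \<sigma> 0"
    "coord_velocity c \<gamma> 0 = coord_velocity c \<sigma> 0" "t \<in> {0..1}"
  shows "\<gamma> t = \<sigma> t"
proof (rule chart_map_inj[OF chart_in_atlas])
  show "\<gamma> t \<in> chart_dom c" "\<sigma> t \<in> chart_dom c"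
    using short_geodesic_bounds(2) assms by (auto simp: B_iff)
  have "norm ((\<phi> \<circ> \<gamma>) t - (\<phi> \<circ> \<sigma>) t - t *\<^sub>R (coord_velocity c \<gamma> 0 - coord_velocity c \<sigma> 0)) \<le>
    norm (coord_velocity c \<gamma> 0 - coord_velocity c \<sigma> 0) / 3"
  proof (rule ball.slow_geodesics_deviation[where \<rho> = "K * r"])
    fix t :: real assume t: "t \<in> {0..1}"
    show "ball.coord_geodesic (\<phi> \<circ> \<gamma>) (coord_velocity c \<gamma>) t \<and> (\<phi> \<circ> \<gamma>) t \<in> cball (\<phi> y) R \<and>
        norm (coord_velocity c \<gamma> t) \<le> K * r"
      using short_geodesic_bounds(2,3,5)[OF assms(1) t] B_in_cball[of "\<gamma> t"] by simp
    show "ball.coord_geodesic (\<phi> \<circ> \<sigma>) (coord_velocity c \<sigma>) t \<and> (\<phi> \<circ> \<sigma>) t \<in> cball (\<phi> y) R \<and>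
        norm (coord_velocity c \<sigma> t) \<le> K * r"
      using short_geodesic_bounds(2,3,5)[OF assms(2) t] B_in_cball[of "\<sigma> t"] by simp
  qed (use assms(3,5) r_bounds(1) in auto)
  then show "\<phi> (\<gamma> t) = \<phi> (\<sigma> t)" using assms(4) by simp
qed

text \<open>Near \<open>y\<close> the concatenation of \<open>\<gamma>\<close> and
  \<open>\<sigma>\<close> has no more energy than the minimizing short geodesic
  \<open>\<tau>\<close> between its ends, so the equality case identifies its first half with
  \<open>\<tau>\<close>. Sharing the initial velocity of \<open>\<tau>\<close>, the curve
  \<open>\<gamma>\<close> follows it to the end, which is a point of
  \<open>\<sigma>\<close>.\<close>

lemma minimizing_curve_has_no_corner:
  assumes \<gamma>: "constant_speed_geodesic \<gamma> 1" "\<gamma> T = y" and \<sigma>: "constant_speed_geodesic \<sigma> 1" "\<sigma> 0 = y"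
    and \<delta>: "0 < \<delta>" "\<And>s. 0 < s \<Longrightarrow> s < \<delta> \<Longrightarrow> 2 * s \<le> geodesic_dist (\<gamma> (T - s)) (\<sigma> s)"
  obtains s where "0 < s" "s < \<delta>" "\<sigma> s = \<gamma> (T + s)"
proof -
  \<comment> \<open>Small enough that both arcs lie in \<open>B r'\<close> and that
    \<open>\<gamma>'\<close> below, of coordinate velocity at most \<open>2 * K * s\<close>, is
    short.\<close>
  define s where "s = min (\<delta> / 2) (r' / (2 * K))"
  have s: "0 < s" "s < \<delta>" using \<delta>(1) r'_bounds(1) K_pos by (auto simp: s_def)
  have "s \<le> r' / (2 * K)" by (simp add: s_def)
  then have Ks: "2 * (K * s) \<le> r'" using K_pos by (simp add: field_simps)
  have r'R: "r' < R" using r'_bounds ball.R_pos by linarith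
  have near: "\<eta> t \<in> B r' \<and> \<eta> t \<in> B R" if \<eta>: "constant_speed_geodesic \<eta> 1" "\<eta> 0 = y" and t: "0 \<le> t" "t \<le> s" for \<eta> t
  proof -
    have Ks': "K * 1 * t \<le> K * s" using t K_pos by simp
    have "0 < K * s" using K_pos s by simp
    have *: "dist (\<phi> y) (\<phi> (\<eta> 0)) + K * 1 * t < R"
      using \<eta> Ks Ks' r'R \<open>0 < K * s\<close> by simp
    have "\<eta> t \<in> B R" "dist (\<phi> y) (\<phi> (\<eta> t)) \<le> K * 1 * t"
      using geodesic_stays[OF \<eta>(1) _ t(1) * t(1) order_refl] \<eta>(2) center_in_dom by auto
    then show ?thesis using Ks Ks' \<open>0 < K * s\<close> by (auto simp: B_iff)
  qed
  have near_\<gamma>: "\<gamma> (T - t) \<in> B r' \<and> \<gamma> (T - t) \<in> B R" if "0 \<le> t" "t \<le> s" for t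
    using near[of "\<lambda>t. \<gamma> (- 1 * t + T)"] constant_speed_geodesic_affine(1)[OF \<gamma>(1), of "- 1" T] \<gamma>(2) that by simp
  \<comment> \<open>Both curves reparametrized over a unit interval, with the corner at time
    \<open>1/2\<close>.\<close>
  define \<gamma>' \<sigma>' where "\<gamma>' = (\<lambda>t. \<gamma> (2 * s * t + (T - s)))" and "\<sigma>' = (\<lambda>t. \<sigma> (2 * s * t + (- s)))"
  have csg: "constant_speed_geodesic \<gamma>' (2 * s)" "constant_speed_geodesic \<sigma>' (2 * s)"
    using constant_speed_geodesic_affine(1)[OF \<gamma>(1), of "2 * s" "T - s"]
      constant_speed_geodesic_affine(1)[OF \<sigma>(1), of "2 * s" "- s"] s by (auto simp: \<gamma>'_def \<sigma>'_def)
  obtain \<tau> where \<tau>: "short_geodesic \<tau> (geodesic_dist (\<gamma> (T - s)) (\<sigma> s))" "\<tau> 0 = \<gamma> (T - s)" "\<tau> 1 = \<sigma> s"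
    using geodesic_dist_realized near_\<gamma>[of s] near[OF \<sigma>, of s] s(1) by (metis order_refl less_imp_le)
  have agree: "\<gamma>' t = \<tau> t" if "0 \<le> t" "t < 1/2" for t
  proof (rule short_geodesic_corner(2)[OF \<tau>(1) _ _ csg(1) _ csg(2) _ _ _ _ _ that])
    show "\<gamma>' t \<in> B R" if "0 \<le> t" "t \<le> 1/2" for t
    proof -
      have "2 * s * t \<le> 2 * s * (1/2)" using that s by (intro mult_left_mono) auto
      then show ?thesis using near_\<gamma>[of "s - 2 * s * t"] that s by (simp add: \<gamma>'_def algebra_simps)
    qed
    show "\<sigma>' t \<in> B R" if "1/2 \<le> t" "t \<le> 1" for t
    proof -
      have "2 * s * t \<le> 2 * s * 1" "2 * s * (1/2) \<le> 2 * s * t" using that s by (auto intro!: mult_left_mono)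
      then show ?thesis using near[OF \<sigma>, of "2 * s * t - s"] by (simp add: \<sigma>'_def)
    qed
    have "(2 * s)\<^sup>2 \<le> (geodesic_dist (\<gamma> (T - s)) (\<sigma> s))\<^sup>2"
      using \<delta>(2)[OF s] s(1) by (intro power_mono) auto
    then show "1/2 * (2 * s)\<^sup>2 + (1 - 1/2) * (2 * s)\<^sup>2 \<le> (geodesic_dist (\<gamma> (T - s)) (\<sigma> s))\<^sup>2" by simp
  qed (use \<tau> \<gamma> \<sigma> in \<open>auto simp: \<gamma>'_def \<sigma>'_def\<close>)
  have dom: "\<gamma>' 0 \<in> chart_dom c" "\<tau> 0 \<in> chart_dom c" "\<gamma>' 0 \<in> B r'" "\<gamma>' 0 \<in> B R"
    using near_\<gamma>[of s] s \<tau>(2) by (auto simp: \<gamma>'_def B_iff)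
  have "norm (coord_velocity c \<gamma>' 0) \<le> K * (2 * s)" by (rule coord_velocity_le[OF csg(1) dom(4)])
  then have "norm (coord_velocity c \<gamma>' 0) \<le> r" using Ks r'_bounds(2) r_pos by linarith
  then have short: "short_geodesic \<gamma>' (2 * s)"
    using csg(1) dom(3) r'_bounds(3) by (simp add: short_geodesic_def B_iff)
  have geo: "geodesic A G UNIV \<gamma>'" "geodesic A G UNIV \<tau>"
    using csg(1) \<tau>(1) constant_speed_geodesicD(1) by (auto simp: short_geodesic_def)
  \<comment> \<open>Agreement is known only for times in \<open>{0..<1/2}\<close>, so the velocities
    are compared through one-sided derivatives.\<close>
  have vel: "coord_velocity c \<gamma>' 0 = coord_velocity c \<tau> 0"
  proof (rule vector_derivative_unique_within)
    show "at 0 within {0..<1/2} \<noteq> (bot :: real filter)"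
    proof -
      have "{0..<1/2} - {0} = {0<..<1/2 :: real}" by auto
      then show ?thesis by (simp add: at_within_eq_bot_iff)
    qed
    show "((\<phi> \<circ> \<gamma>') has_vector_derivative coord_velocity c \<gamma>' 0) (at 0 within {0..<1/2})"
      by (rule has_vector_derivative_at_within[OF geodesic_coord_velocity[OF geo(1) chart_in_atlas dom(1)]])
    show "((\<phi> \<circ> \<gamma>') has_vector_derivative coord_velocity c \<tau> 0) (at 0 within {0..<1/2})"
    proof (rule has_vector_derivative_transform)
      show "((\<phi> \<circ> \<tau>) has_vector_derivative coord_velocity c \<tau> 0) (at 0 within {0..<1/2})"
        by (rule has_vector_derivative_at_within[OF geodesic_coord_velocity[OF geo(2) chart_in_atlas dom(2)]])
    qed (use agree in auto)
  qed
  have "\<gamma>' 1 = \<tau> 1"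
    by (rule short_geodesic_unique[OF short \<tau>(1) agree vel]) auto
  then have "\<sigma> s = \<gamma> (T + s)" using \<tau>(3) by (simp add: \<gamma>'_def algebra_simps)
  then show ?thesis using that s by blast
qed

end

section \<open>The Hopf--Rinow theorem\<close>

context complete_riemannian_manifold begin

text \<open>Some piece starts in \<open>V\<close> and ends outside; being connected, it meets the
  frontier, and the length splits there.\<close>

lemma broken_geodesic_crosses_frontier:
  assumes "broken_geodesic p q L" "p \<in> V" "q \<notin> V"
  shows "\<exists>x\<in>frontier V. \<exists>L1 L2. broken_geodesic p x L1 \<and> broken_geodesic x q L2 \<and> L1 + L2 = L"
  using assms
proof (induction rule: broken_geodesic.induct)
  case (step \<gamma> K L t)
  show ?case
  proof (cases "\<gamma> 0 \<in> V")
    case False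
    then obtain x L1 L2 where "x \<in> frontier V" "broken_geodesic p x L1" "broken_geodesic x (\<gamma> 0) L2" "L1 + L2 = K"
      using step by blast
    then show ?thesis
      using broken_geodesic.step[OF _ step.hyps(2,3), of x L2] by (metis add.assoc)
  next
    case True
    have "continuous_on {0..t} \<gamma>"
      using constant_speed_geodesicD(3)[OF step.hyps(2)] continuous_on_subset by blast
    then have "connected (\<gamma> ` {0..t})" using connected_continuous_image connected_Icc by blast
    moreover have "\<gamma> 0 \<in> \<gamma> ` {0..t}" "\<gamma> t \<in> \<gamma> ` {0..t}" using step.hyps(3) by auto
    ultimately have "\<gamma> ` {0..t} \<inter> frontier V \<noteq> {}"
      using True step.prems by (intro connected_Int_frontier) auto
    then obtain s where s: "0 \<le> s" "s \<le> t" "\<gamma> s \<in> frontier V" by auto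
    have "broken_geodesic p (\<gamma> s) (K + L * s)"
      using broken_geodesic.step[OF step.hyps(1,2) s(1)] .
    moreover have "broken_geodesic (\<gamma> s) (\<gamma> t) (L * (t - s))"
      by (rule broken_geodesic_segment[OF step.hyps(2) s(2)])
    moreover have "(K + L * s) + L * (t - s) = K + L * t" by (simp add: algebra_simps)
    ultimately show ?thesis using s(3) by blast
  qed
qed simp

text \<open>The set reachable from \<open>p\<close> is open and closed because nearby points are
  joined by short geodesics, and the manifold is connected.\<close>

lemma broken_geodesic_exists: "\<exists>L. broken_geodesic p q L"
proof -
  define S where "S = {q. \<exists>L. broken_geodesic p q L}"
  have nbhd: "\<exists>V. open V \<and> z \<in> V \<and> (\<forall>a\<in>V. \<forall>b\<in>V. \<exists>L. broken_geodesic a b L)" for z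
  proof -
    obtain c R K where "normal_chart A G c z R K" by (rule normal_chart_exists)
    then interpret N: normal_chart A G c z R K .
    have "\<exists>L. broken_geodesic a b L" if ab: "a \<in> N.B N.r'" "b \<in> N.B N.r'" for a b
    proof -
      obtain \<gamma> where \<gamma>: "N.short_geodesic \<gamma> (geodesic_dist a b)" "\<gamma> 0 = a" "\<gamma> 1 = b"
        by (rule N.geodesic_dist_realized[OF ab])
      then have "constant_speed_geodesic \<gamma> (geodesic_dist a b)" by (simp add: N.short_geodesic_def)
      from broken_geodesic_segment[OF this, of 0 1] \<gamma> show ?thesis by auto
    qed
    moreover have "z \<in> N.B N.r'" using N.center_in_dom N.r'_bounds(1) by (simp add: N.B_iff)
    ultimately show ?thesis using N.open_B by blast
  qed
  have S_trans: "b \<in> S" if "a \<in> S" "\<exists>L. broken_geodesic a b L" for a b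
    using that broken_geodesic_trans[of a b _ p] by (auto simp: S_def)
  have "open S"
  proof (subst open_subopen, rule ballI)
    fix z assume "z \<in> S"
    obtain V where V: "open V" "z \<in> V" "\<forall>a\<in>V. \<forall>b\<in>V. \<exists>L. broken_geodesic a b L" using nbhd[of z] by (elim exE conjE)
    have "V \<subseteq> S" using S_trans[OF \<open>z \<in> S\<close>] V by (intro subsetI) simp
    then show "\<exists>T. open T \<and> z \<in> T \<and> T \<subseteq> S" using V by (intro exI[of _ V]) simp
  qed
  moreover have "open (- S)"
  proof (subst open_subopen, rule ballI)
    fix z assume z: "z \<in> - S"
    obtain V where V: "open V" "z \<in> V" "\<forall>a\<in>V. \<forall>b\<in>V. \<exists>L. broken_geodesic a b L" using nbhd[of z] by (elim exE conjE)
    have "w \<notin> S" if "w \<in> V" for w using S_trans[of w z] V that z by auto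
    then show "\<exists>T. open T \<and> z \<in> T \<and> T \<subseteq> - S" using V by (intro exI[of _ V]) auto
  qed
  then have "closed S" by (simp add: closed_def)
  moreover have "p \<in> S" unfolding S_def using base by blast
  ultimately have "S = UNIV"
    using connected_manifold by (auto simp: connected_clopen)
  then show ?thesis by (auto simp: S_def)
qed

lemma geodesic_dist_approx:
  assumes "0 < \<epsilon>"
  obtains L where "broken_geodesic p q L" "L < geodesic_dist p q + \<epsilon>"
proof -
  have "{L. broken_geodesic p q L} \<noteq> {}" using broken_geodesic_exists by blast
  moreover have "bdd_below {L. broken_geodesic p q L}"
    using broken_geodesic_nonneg by (auto intro!: bdd_belowI[of _ 0])
  ultimately show ?thesis
    using cInf_less_iff[of "{L. broken_geodesic p q L}" "geodesic_dist p q + \<epsilon>"] assms that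
    by (auto simp: geodesic_dist_def)
qed

lemma geodesic_dist_ge: "(\<And>L. broken_geodesic p q L \<Longrightarrow> d \<le> L) \<Longrightarrow> d \<le> geodesic_dist p q"
  unfolding geodesic_dist_def using broken_geodesic_exists by (intro cInf_greatest) auto

lemma geodesic_dist_nonneg: "0 \<le> geodesic_dist p q"
  using broken_geodesic_nonneg by (rule geodesic_dist_ge)

lemma geodesic_dist_self: "geodesic_dist p p = 0"
  using geodesic_dist_le[OF base, of p] geodesic_dist_nonneg[of p p] by simp

lemma geodesic_dist_triangle: "geodesic_dist p z \<le> geodesic_dist p q + geodesic_dist q z"
proof (rule field_le_epsilon)
  fix \<epsilon> :: real assume "0 < \<epsilon>"
  then have \<epsilon>: "0 < \<epsilon> / 2" by simp
  obtain K where K: "broken_geodesic p q K" "K < geodesic_dist p q + \<epsilon> / 2" by (rule geodesic_dist_approx[OF \<epsilon>])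
  obtain L where L: "broken_geodesic q z L" "L < geodesic_dist q z + \<epsilon> / 2" by (rule geodesic_dist_approx[OF \<epsilon>])
  show "geodesic_dist p z \<le> geodesic_dist p q + geodesic_dist q z + \<epsilon>"
    using geodesic_dist_le[OF broken_geodesic_trans[OF L(1) K(1)]] K(2) L(2) by simp
qed

lemma geodesic_dist_along:
  assumes "constant_speed_geodesic \<gamma> 1"
  shows "geodesic_dist (\<gamma> s) (\<gamma> t) \<le> \<bar>t - s\<bar>"
proof (cases "s \<le> t")
  case True
  then show ?thesis using geodesic_dist_le[OF broken_geodesic_segment[OF assms True]] by simp
next
  case False
  have "constant_speed_geodesic (\<lambda>t. \<gamma> (- 1 * t + 0)) 1"
    using constant_speed_geodesic_affine(1)[OF assms, of "- 1" 0] by simp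
  from geodesic_dist_le[OF broken_geodesic_segment[OF this, of "- s" "- t"]] False
  show ?thesis by simp
qed

text \<open>Distance 0 yields arbitrarily short broken geodesics from \<open>p\<close> to
  \<open>q\<close>. Their coordinate displacement is too small to leave the chart or to reach a
  different point in it.\<close>

lemma geodesic_dist_zero:
  assumes "geodesic_dist p q = 0"
  shows "p = q"
proof (rule ccontr)
  assume "p \<noteq> q"
  obtain c R K where "normal_chart A G c p R K" by (rule normal_chart_exists)
  then interpret N: normal_chart A G c p R K .
  define d where "d = (if q \<in> chart_dom c then min R (dist (N.\<phi> p) (N.\<phi> q)) else R)"
  have "0 < d"
    using \<open>p \<noteq> q\<close> N.ball.R_pos chart_map_inj[OF N.chart_in_atlas N.center_in_dom] by (auto simp: d_def)
  then have "0 < d / K" using N.K_pos by simp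
  then obtain L where L: "broken_geodesic p q L" "L < geodesic_dist p q + d / K"
    by (rule geodesic_dist_approx)
  then have "K * L < d" using N.K_pos assms by (simp add: field_simps)
  moreover have "d \<le> R" by (simp add: d_def)
  ultimately have "q \<in> chart_dom c" "dist (N.\<phi> p) (N.\<phi> q) \<le> K * L"
    using N.broken_geodesic_displacement[OF L(1) N.center_in_dom] by auto
  then show False using \<open>K * L < d\<close> by (simp add: d_def)
qed

text \<open>A coordinate sphere around \<open>p\<close> contains a point \<open>x\<close> that minimizes
  \<open>d(p, x) + d(x, q)\<close>.\<close>

lemma minimizing_first_step:
  assumes "p \<noteq> q"
  obtains \<gamma> l where "constant_speed_geodesic \<gamma> 1" "\<gamma> 0 = p" "0 < l"
    "\<forall>s\<in>{0..l}. geodesic_dist (\<gamma> s) q = geodesic_dist p q - s"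
proof -
  obtain c R K where "normal_chart A G c p R K" by (rule normal_chart_exists)
  then interpret N: normal_chart A G c p R K .
  have p: "p \<in> N.B N.r'" using N.center_in_dom N.r'_bounds(1) by (simp add: N.B_iff)
  define F where "F x = geodesic_dist p x + geodesic_dist x q" for x
  obtain x where x: "x \<in> N.B N.r'" "x \<noteq> p" "F x \<le> geodesic_dist p q"
  proof (cases "q \<in> N.B N.r'")
    \<comment> \<open>Here \<open>q\<close> itself serves as \<open>x\<close>, since
      \<open>F q\<close> is the distance from \<open>p\<close> to \<open>q\<close>.\<close>
    case True
    then show ?thesis using that[of q] assms by (simp add: F_def geodesic_dist_self)
  next
    case False
    define s where "s = N.r' / 2"
    have s: "0 < s" "s < N.r'" "s \<le> R" using N.r'_bounds N.ball.R_pos by (auto simp: s_def)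
    let ?S = "sphere (N.\<phi> p) s"
    have S: "chart_inv c z \<in> N.B N.r' \<and> N.\<phi> (chart_inv c z) = z" if "z \<in> ?S" for z
      using N.chart_inv_cball[OF s(3), of z] that s by (auto simp: N.B_iff)
    have near: "geodesic_dist (chart_inv c w) (chart_inv c z) \<le> 2 * K * dist w z" if zw: "z \<in> ?S" "w \<in> ?S" for z w
      using N.geodesic_dist_realized[of "chart_inv c w" "chart_inv c z"] S[OF zw(1)] S[OF zw(2)] by metis
    \<comment> \<open>Each of the two summands of \<open>F\<close> changes by at most
      \<open>2 * K * dist z w\<close>.\<close>
    have lip: "F (chart_inv c z) \<le> F (chart_inv c w) + 4 * K * dist z w" if zw: "z \<in> ?S" "w \<in> ?S" for z w
    proof -
      have "geodesic_dist (chart_inv c w) (chart_inv c z) \<le> 2 * K * dist z w"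
        "geodesic_dist (chart_inv c z) (chart_inv c w) \<le> 2 * K * dist z w"
        using near[OF zw] near[OF zw(2,1)] by (simp_all add: dist_commute)
      then show ?thesis
        unfolding F_def using geodesic_dist_triangle[of p "chart_inv c z" "chart_inv c w"]
          geodesic_dist_triangle[of "chart_inv c z" q "chart_inv c w"] by linarith
    qed
    have "(4 * K)-lipschitz_on ?S (\<lambda>z. F (chart_inv c z))"
    proof (rule lipschitz_onI)
      show "dist (F (chart_inv c z)) (F (chart_inv c w)) \<le> 4 * K * dist z w" if "z \<in> ?S" "w \<in> ?S" for z w
        using lip[OF that] lip[OF that(2,1)] by (simp add: dist_real_def dist_commute)
    qed (use N.K_pos in simp)
    then have cont: "continuous_on ?S (\<lambda>z. F (chart_inv c z))" by (rule lipschitz_on_continuous_on)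
    \<comment> \<open>Every path to \<open>q\<close> crosses the sphere, so the minimum of
      \<open>F\<close> over it is a lower bound for all lengths, hence for the distance.\<close>
    have cross: "\<exists>z\<in>?S. F (chart_inv c z) \<le> L" if L: "broken_geodesic p q L" for L
    proof -
      have "p \<in> N.B s" "q \<notin> N.B s" using N.center_in_dom s False by (auto simp: N.B_iff)
      then obtain x L1 L2 where x: "x \<in> frontier (N.B s)" "broken_geodesic p x L1" "broken_geodesic x q L2" "L1 + L2 = L"
        using broken_geodesic_crosses_frontier[OF L] by blast
      have "N.B s \<subseteq> chart_inv c ` cball (N.\<phi> p) s"
      proof
        fix w assume "w \<in> N.B s"
        then have "w = chart_inv c (N.\<phi> w)" "N.\<phi> w \<in> cball (N.\<phi> p) s"
          using chart_inv_map[OF N.chart_in_atlas] by (auto simp: N.B_iff)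
        then show "w \<in> chart_inv c ` cball (N.\<phi> p) s" by (rule image_eqI)
      qed
      then have "closure (N.B s) \<subseteq> chart_inv c ` cball (N.\<phi> p) s"
        using compact_imp_closed[OF N.compact_chart_cball[OF s(3)]] by (rule closure_minimal)
      then obtain z where z: "z \<in> cball (N.\<phi> p) s" "x = chart_inv c z"
        using x(1) unfolding frontier_def by blast
      have "x \<notin> N.B s" using x(1) N.open_B by (simp add: frontier_def interior_open)
      then have "z \<in> ?S" using N.chart_inv_cball[OF s(3) z(1)] z by (auto simp: N.B_iff)
      moreover have "F x \<le> L"
        unfolding F_def using geodesic_dist_le[OF x(2)] geodesic_dist_le[OF x(3)] x(4) by linarith
      ultimately show ?thesis using z(2) by blast
    qed
    then have "?S \<noteq> {}" using broken_geodesic_exists by blast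
    then obtain z where z: "z \<in> ?S" "\<forall>w\<in>?S. F (chart_inv c z) \<le> F (chart_inv c w)"
      using continuous_attains_inf[OF compact_sphere _ cont] by blast
    have "F (chart_inv c z) \<le> geodesic_dist p q"
      using cross z(2) by (intro geodesic_dist_ge) (meson order_trans)
    moreover have "chart_inv c z \<noteq> p" using S[OF z(1)] z(1) s by auto
    ultimately show ?thesis using that S[OF z(1)] by blast
  qed
  define l where "l = geodesic_dist p x"
  have "l \<noteq> 0" using geodesic_dist_zero[of p x] x(2) by (auto simp: l_def)
  then have l: "0 < l" using geodesic_dist_nonneg[of p x] by (simp add: l_def)
  obtain \<gamma> where \<gamma>: "N.short_geodesic \<gamma> l" "\<gamma> 0 = p" "\<gamma> 1 = x"
    unfolding l_def by (rule N.geodesic_dist_realized[OF p x(1)])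
  \<comment> \<open>Parametrization by arc length.\<close>
  let ?\<sigma> = "\<lambda>t. \<gamma> (1 / l * t + 0)"
  have \<sigma>: "constant_speed_geodesic ?\<sigma> 1"
    using constant_speed_geodesic_affine(1)[of \<gamma> l "1 / l" 0] \<gamma>(1) l by (simp add: N.short_geodesic_def)
  show ?thesis
  proof (rule that[OF \<sigma> _ l])
    show "\<forall>s\<in>{0..l}. geodesic_dist (?\<sigma> s) q = geodesic_dist p q - s"
    proof
      fix s assume s: "s \<in> {0..l}"
      \<comment> \<open>The triangle inequality from \<open>p\<close> to \<open>q\<close> through
        \<open>?\<sigma> s\<close> gives one direction. The one from \<open>?\<sigma> s\<close> to
        \<open>q\<close> through \<open>x\<close> gives the other, because \<open>F x\<close> does
        not exceed the distance from \<open>p\<close> to \<open>q\<close>.\<close>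
      have "geodesic_dist (?\<sigma> 0) (?\<sigma> s) \<le> s" "geodesic_dist (?\<sigma> s) (?\<sigma> l) \<le> l - s"
        using geodesic_dist_along[OF \<sigma>, of 0 s] geodesic_dist_along[OF \<sigma>, of s l] s by auto
      moreover have "?\<sigma> 0 = p" "?\<sigma> l = x" using \<gamma> l by auto
      ultimately show "geodesic_dist (?\<sigma> s) q = geodesic_dist p q - s"
        using geodesic_dist_triangle[of p q "?\<sigma> s"] geodesic_dist_triangle[of "?\<sigma> s" q x] x(3)
        by (simp add: F_def l_def)
    qed
  qed (use \<gamma> in simp)
qed

text \<open>\<open>S\<close> collects the times at which \<open>\<gamma>\<close> has come closer to
  \<open>q\<close> by exactly the distance travelled. It is closed, and its supremum
  \<open>T\<close> cannot lie below \<open>d\<close>: a minimizing first step from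
  \<open>\<gamma> T\<close> continues \<open>\<gamma>\<close> without a corner and thus extends
  \<open>S\<close>.\<close>

lemma hopf_rinow:
  obtains \<gamma> where "geodesic A G UNIV \<gamma>" "\<gamma> 0 = p" "\<gamma> 1 = q"
proof (cases "p = q")
  case True
  obtain c where c: "c \<in> A" "p \<in> chart_dom c" using atlas_cover by blast
  obtain \<gamma> L where \<gamma>: "constant_speed_geodesic \<gamma> L" "\<gamma> 0 = p" using geodesic_exists[OF c] by metis
  \<comment> \<open>Slope 0 turns any geodesic through \<open>p\<close> into a constant one.\<close>
  have "geodesic A G UNIV (\<lambda>s. \<gamma> (0 * s + 0))"
    by (rule constant_speed_geodesicD(1)[OF constant_speed_geodesic_affine(1)[OF \<gamma>(1)]])
  then show ?thesis by (rule that) (use \<gamma>(2) True in auto)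
next
  case False
  define d where "d = geodesic_dist p q"
  obtain \<gamma> l where \<gamma>: "constant_speed_geodesic \<gamma> 1" "\<gamma> 0 = p" "0 < l"
    and step: "\<forall>s\<in>{0..l}. geodesic_dist (\<gamma> s) q = d - s"
    by (rule minimizing_first_step[OF False, folded d_def])
  define S where "S = {t \<in> {0..d}. geodesic_dist (\<gamma> t) q = d - t}"
  have lip: "geodesic_dist (\<gamma> s) q \<le> geodesic_dist (\<gamma> t) q + dist s t" for s t
    using geodesic_dist_triangle[of "\<gamma> s" q "\<gamma> t"] geodesic_dist_along[OF \<gamma>(1), of s t]
    by (simp add: dist_real_def abs_minus_commute)
  have "1-lipschitz_on UNIV (\<lambda>t. geodesic_dist (\<gamma> t) q)"
  proof (rule lipschitz_onI)
    show "dist (geodesic_dist (\<gamma> s) q) (geodesic_dist (\<gamma> t) q) \<le> 1 * dist s t" for s t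
      unfolding dist_real_def[of "geodesic_dist _ _"] using lip[of s t] lip[of t s]
      by (simp add: abs_le_iff dist_commute)
  qed simp
  then have cont: "continuous_on UNIV (\<lambda>t. geodesic_dist (\<gamma> t) q)" by (rule lipschitz_on_continuous_on)
  have "closed S"
  proof -
    have "closed {t. geodesic_dist (\<gamma> t) q = d - t}"
      by (rule closed_Collect_eq[OF cont]) (intro continuous_intros)
    moreover have "S = {0..d} \<inter> {t. geodesic_dist (\<gamma> t) q = d - t}" by (auto simp: S_def)
    ultimately show ?thesis by (simp add: closed_Int)
  qed
  have bdd: "bdd_above S" by (auto simp: S_def)
  have "l \<le> d" using step \<gamma>(3) geodesic_dist_nonneg[of "\<gamma> l" q] by simp
  then have "l \<in> S" using step \<gamma>(3) by (simp add: S_def)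
  define T where "T = Sup S"
  have "T \<in> S" unfolding T_def using \<open>l \<in> S\<close> bdd \<open>closed S\<close> by (intro closed_contains_Sup) auto
  moreover have "l \<le> T" unfolding T_def by (rule cSup_upper[OF \<open>l \<in> S\<close> bdd])
  ultimately have T: "0 < T" "T \<le> d" "geodesic_dist (\<gamma> T) q = d - T"
    using \<gamma>(3) by (auto simp: S_def)
  have "T = d"
  proof (rule ccontr)
    assume "T \<noteq> d"
    then have "\<gamma> T \<noteq> q" using T geodesic_dist_self[of q] by auto
    then obtain \<sigma> k where \<sigma>: "constant_speed_geodesic \<sigma> 1" "\<sigma> 0 = \<gamma> T" "0 < k"
      and \<sigma>_step: "\<forall>s\<in>{0..k}. geodesic_dist (\<sigma> s) q = geodesic_dist (\<gamma> T) q - s"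
      by (rule minimizing_first_step)
    obtain c R K where "normal_chart A G c (\<gamma> T) R K" by (rule normal_chart_exists)
    then interpret N: normal_chart A G c "\<gamma> T" R K .
    \<comment> \<open>\<open>d\<close> is at most \<open>T - s\<close>, plus the distance in
      question, plus the remaining \<open>d - T - s\<close>.\<close>
    have corner: "2 * s \<le> geodesic_dist (\<gamma> (T - s)) (\<sigma> s)" if s: "0 < s" "s < min T k" for s
    proof -
      have "d \<le> geodesic_dist p (\<gamma> (T - s)) + geodesic_dist (\<gamma> (T - s)) q"
        unfolding d_def by (rule geodesic_dist_triangle)
      moreover have "geodesic_dist p (\<gamma> (T - s)) \<le> T - s"
        using geodesic_dist_along[OF \<gamma>(1), of 0 "T - s"] \<gamma>(2) s by simp
      moreover have "geodesic_dist (\<gamma> (T - s)) q \<le> geodesic_dist (\<gamma> (T - s)) (\<sigma> s) + geodesic_dist (\<sigma> s) q"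
        by (rule geodesic_dist_triangle)
      moreover have "geodesic_dist (\<sigma> s) q = d - T - s" using \<sigma>_step s T(3) by simp
      ultimately show ?thesis by linarith
    qed
    have "0 < min T k" using T(1) \<sigma>(3) by simp
    from N.minimizing_curve_has_no_corner[OF \<gamma>(1) refl \<sigma>(1,2) this corner]
    obtain s where s: "0 < s" "s < min T k" "\<sigma> s = \<gamma> (T + s)" by blast
    have "geodesic_dist (\<sigma> s) q = d - (T + s)" using \<sigma>_step s(1,2) T(3) by simp
    then have "geodesic_dist (\<gamma> (T + s)) q = d - (T + s)" using s(3) by simp
    \<comment> \<open>Nonnegativity of the remaining distance gives
      \<open>T + s \<le> d\<close>.\<close>
    then have "T + s \<in> S"
      using geodesic_dist_nonneg[of "\<gamma> (T + s)" q] s(1) T(1) by (simp add: S_def)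
    then have "T + s \<le> T" unfolding T_def using bdd by (rule cSup_upper)
    then show False using s(1) by simp
  qed
  then have "\<gamma> d = q" using T(3) geodesic_dist_zero[of "\<gamma> d" q] by simp
  have "geodesic A G UNIV (\<lambda>s. \<gamma> (d * s + 0))"
    by (rule constant_speed_geodesicD(1)[OF constant_speed_geodesic_affine(1)[OF \<gamma>(1)]])
  then show ?thesis by (rule that) (use \<gamma>(2) \<open>\<gamma> d = q\<close> in auto)
qed

end

section \<open>Optimality conditions\<close>

text \<open>The definite description denotes the limit: a geodesic in direction \<open>X\<close> is
  at hand, and limits along the nontrivial filter \<open>at_right 0\<close> are unique.\<close>

lemma has_dir_deriv_dir_deriv:
  assumes "dir_differentiable_at A G E h p0" "geodesic_from A G E p0 X I \<gamma>" "X \<in> tangent_space A p0"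
  shows "((\<lambda>s. (h (\<gamma> s) - h p0) / s) \<longlongrightarrow> dir_deriv A G E h p0 X) (at_right 0)"
proof -
  have "X \<in> tangent_directions A G E p0"
    using assms unfolding tangent_directions_def by blast
  then obtain d where d: "has_dir_deriv A G E h p0 X d"
    using assms(1) unfolding dir_differentiable_at_def by blast
  have lim: "((\<lambda>s. (h (\<gamma> s) - h p0) / s) \<longlongrightarrow> e) (at_right 0)" if "has_dir_deriv A G E h p0 X e" for e
    using that assms(2) unfolding has_dir_deriv_def by blast
  have "dir_deriv A G E h p0 X = d"
    unfolding dir_deriv_def
  proof (rule the_equality[where P = "has_dir_deriv A G E h p0 X", OF d])
    fix e assume "has_dir_deriv A G E h p0 X e"
    then show "e = d"
      using tendsto_unique[OF trivial_limit_at_right_real lim lim] d by blast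
  qed
  then show ?thesis using lim[OF d] by simp
qed

text \<open>Convexity rearranged: every difference quotient is at most the increment at the end
  point, and so is the limit.\<close>

lemma dir_deriv_le_of_convex_at:
  assumes "convex_at A G E h p0" "dir_differentiable_at A G E h p0"
    and \<gamma>: "geodesic_from A G E p0 X {0..1} \<gamma>" and X: "X \<in> tangent_space A p0"
  shows "dir_deriv A G E h p0 X \<le> h (\<gamma> 1) - h p0"
proof (rule tendsto_upperbound[OF has_dir_deriv_dir_deriv[OF assms(2) \<gamma> X]])
  have *: "h (\<gamma> s) \<le> (1 - s) * h p0 + s * h (\<gamma> 1)" if "s \<in> {0<..<1}" for s
  proof -
    have "\<gamma> 1 \<in> E" "geodesic A G {0..1} \<gamma>" "\<gamma> 0 = p0"
      using \<gamma> unfolding geodesic_from_def by auto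
    then show ?thesis using assms(1) that unfolding convex_at_def by blast
  qed
  have "(h (\<gamma> s) - h p0) / s \<le> h (\<gamma> 1) - h p0" if "s \<in> {0<..<1}" for s
    using *[OF that] that by (simp add: field_simps)
  moreover have "\<forall>\<^sub>F s in at_right 0. s \<in> {0<..<1::real}"
    by (rule eventually_at_right_real) simp
  ultimately show "\<forall>\<^sub>F s in at_right 0. (h (\<gamma> s) - h p0) / s \<le> h (\<gamma> 1) - h p0"
    by (rule eventually_mono[rotated])
qed simp

context complete_riemannian_manifold begin

text \<open>Hopf-Rinow supplies the geodesic, and star-shapedness keeps it in
  \<open>E\<close>.\<close>

lemma geodesic_from_exists:
  assumes "star_shaped A G E p0" "p \<in> E"
  obtains \<gamma> X where "geodesic_from A G E p0 X {0..1} \<gamma>" "\<gamma> 1 = p" "X \<in> tangent_space A p0"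
proof -
  obtain \<gamma> where \<gamma>: "geodesic A G UNIV \<gamma>" "\<gamma> 0 = p0" "\<gamma> 1 = p" by (rule hopf_rinow)
  have geo: "geodesic A G {0..1} \<gamma>"
    unfolding geodesic_def
  proof (intro conjI ballI)
    show "continuous_on {0..1} \<gamma>" using \<gamma>(1) unfolding geodesic_def by (metis continuous_on_subset subset_UNIV)
    fix c assume "c \<in> A"
    then obtain v where v: "\<forall>t\<in>UNIV. \<gamma> t \<in> chart_dom c \<longrightarrow>
        ((chart_map c \<circ> \<gamma>) has_vector_derivative v t) (at t) \<and>
        (v has_vector_derivative - christoffel G c (chart_map c (\<gamma> t)) (v t) (v t)) (at t)"
      using \<gamma>(1) unfolding geodesic_def by blast
    then show "\<exists>v. \<forall>t\<in>{0..1}. \<gamma> t \<in> chart_dom c \<longrightarrow>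
        ((chart_map c \<circ> \<gamma>) has_vector_derivative v t) (at t within {0..1}) \<and>
        (v has_vector_derivative - christoffel G c (chart_map c (\<gamma> t)) (v t) (v t)) (at t within {0..1})"
      by (intro exI[of _ v]) (blast intro: has_vector_derivative_at_within)
  qed
  \<comment> \<open>The value 0 outside of the charts around \<open>p0\<close> is demanded by
    \<open>tangent_space\<close>.\<close>
  define X where "X c = (if c \<in> A \<and> p0 \<in> chart_dom c then coord_velocity c \<gamma> 0 else 0)" for c
  have X: "X \<in> tangent_space A p0"
    unfolding tangent_space_def
  proof (intro CollectI conjI allI ballI impI)
    fix c c' assume "c \<in> A" "c' \<in> A" "p0 \<in> chart_dom c \<inter> chart_dom c'"
    then show "X c' = frechet_derivative (transition c c') (at (chart_map c p0)) (X c)"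
      using geodesic_velocity_change[OF \<gamma>(1), of c c' 0] \<gamma>(2) by (simp add: X_def)
  qed (auto simp: X_def)
  have "has_velocity A {0..1} \<gamma> 0 X"
    unfolding has_velocity_def
  proof (intro conjI ballI impI)
    show "X \<in> tangent_space A (\<gamma> 0)" using X \<gamma>(2) by simp
    fix c assume "c \<in> A" "\<gamma> 0 \<in> chart_dom c"
    then show "((chart_map c \<circ> \<gamma>) has_vector_derivative X c) (at 0 within {0..1})"
      using has_vector_derivative_at_within[OF geodesic_coord_velocity[OF \<gamma>(1), of c 0]] \<gamma>(2)
      by (simp add: X_def)
  qed
  moreover have "\<gamma> s \<in> E" if s: "s \<in> {0..1}" for s
  proof (cases "s = 0 \<or> s = 1")
    case True
    then show ?thesis using assms \<gamma>(2,3) unfolding star_shaped_def by auto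
  next
    case False
    then have "s \<in> {0<..<1}" using s by auto
    then show ?thesis using assms \<gamma>(2,3) geo unfolding star_shaped_def by blast
  qed
  moreover have "{0..<1} \<subseteq> {0..1::real}" by auto
  ultimately have "geodesic_from A G E p0 X {0..1} \<gamma>"
    unfolding geodesic_from_def using geo \<gamma>(2) by (auto simp: is_interval_cc intro!: exI[of _ 1])
  then show ?thesis using that \<gamma>(3) X by blast
qed

text \<open>In the direction of the geodesic to \<open>p\<close> every constraint term is
  nonpositive: for an active constraint by convexity and feasibility of \<open>p\<close>, for an
  inactive one because its multiplier vanishes. The derivative of \<open>h\<close> is thus
  nonnegative there.\<close>

lemma kkt_imp_le:
  assumes star: "star_shaped A G E p0" and p: "p \<in> feasible_set E m g"
    and p0: "p0 \<in> feasible_set E m g"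
    and g_convex: "\<And>i. i \<in> {1..m} \<Longrightarrow> g i p0 = 0 \<Longrightarrow> convex_at A G E (g i) p0"
    and g_diff: "\<And>i. i \<in> {1..m} \<Longrightarrow> dir_differentiable_at A G E (g i) p0"
    and h: "dir_differentiable_at A G E h p0" "convex_at A G E h p0"
    and kkt: "kkt_multipliers A G E m g h p0 \<mu>"
  shows "h p0 \<le> h p"
proof -
  have "p \<in> E" using p by (simp add: feasible_set_def)
  then obtain \<gamma> X where \<gamma>: "geodesic_from A G E p0 X {0..1} \<gamma>" "\<gamma> 1 = p" and X: "X \<in> tangent_space A p0"
    using geodesic_from_exists[OF star] by blast
  have XT: "X \<in> tangent_directions A G E p0"
    using \<gamma>(1) X unfolding tangent_directions_def by blast
  have "\<mu> i * dir_deriv A G E (g i) p0 X \<le> 0" if i: "i \<in> {1..m}" for i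
  proof (cases "g i p0 = 0")
    case True
    have "dir_deriv A G E (g i) p0 X \<le> g i p - g i p0"
      using dir_deriv_le_of_convex_at[OF g_convex[OF i True] g_diff[OF i] \<gamma>(1) X] \<gamma>(2) by simp
    also have "\<dots> \<le> 0" using p i True by (simp add: feasible_set_def)
    finally show ?thesis using kkt i by (simp add: kkt_multipliers_def mult_nonneg_nonpos)
  next
    case False
    then show ?thesis using kkt i unfolding kkt_multipliers_def by (metis mult_eq_0_iff order_refl)
  qed
  then have "(\<Sum>i=1..m. \<mu> i * dir_deriv A G E (g i) p0 X) \<le> 0" by (intro sum_nonpos)
  moreover have "0 \<le> dir_deriv A G E h p0 X + (\<Sum>i=1..m. \<mu> i * dir_deriv A G E (g i) p0 X)"
    using kkt XT unfolding kkt_multipliers_def by blast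
  moreover have "dir_deriv A G E h p0 X \<le> h p - h p0"
    using dir_deriv_le_of_convex_at[OF h(2,1) \<gamma>(1) X] \<gamma>(2) by simp
  ultimately show ?thesis by linarith
qed

end

text \<open>Strictness of \<open><min\<close> is inequality of intervals, whereas the estimates
  concern centers and half-widths.\<close>

lemma interval_eq_iff_center_half_width:
  "S = T \<longleftrightarrow> center S = center T \<and> half_width S = half_width T"
  by (auto simp: center_def half_width_def interval_eq_iff field_simps)

theorem theorem6p3:
  fixes A :: "('a::{t2_space, second_countable_topology}, 'e::euclidean_space) chart set"
    and G :: "('a, 'e) metric_tensor"
    and E X :: "'a set" and p0 :: 'a
    and f :: "'a \<Rightarrow> real interval" and fc fw :: "'a \<Rightarrow> real"
    and m :: nat and g :: "nat \<Rightarrow> 'a \<Rightarrow> real" and J :: "nat set"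
  defines "fc \<equiv> \<lambda>p. center (f p)"
    and "fw \<equiv> \<lambda>p. half_width (f p)"
    and "X \<equiv> feasible_set E m g"
    and "J \<equiv> {i \<in> {1..m}. g i p0 = 0}"
  assumes "complete_riemannian_manifold A G"
    and "star_shaped A G E p0"
    and "p0 \<in> X"
    and "\<And>i. i \<in> J \<Longrightarrow> convex_at A G E (g i) p0"
    and "\<And>i. i \<in> {1..m} \<Longrightarrow> dir_differentiable_at A G E (g i) p0"
  shows "(dir_differentiable_at A G E fc p0 \<and> convex_at A G E fc p0 \<and> nonconstant_on fc X \<and>
          (\<exists>\<mu>. kkt_multipliers A G E m g fc p0 \<mu>)
            \<longrightarrow> strict_optimal_solution f X p0) \<and>
         (fc constant_on X \<and> dir_differentiable_at A G E fw p0 \<and> convex_at A G E fw p0 \<and>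
          (\<exists>\<mu>. kkt_multipliers A G E m g fw p0 \<mu>)
            \<longrightarrow> optimal_solution f X p0 \<and>
                (nonconstant_on fw X \<longrightarrow> strict_optimal_solution f X p0))"
proof -
  interpret complete_riemannian_manifold A G by fact
  have minimum: "h p0 \<le> h p"
    if "dir_differentiable_at A G E h p0" "convex_at A G E h p0" "kkt_multipliers A G E m g h p0 \<mu>" "p \<in> X"
    for h \<mu> p
    using assms(6-9) that unfolding X_def J_def by (intro kkt_imp_le[where h = h]) auto
  show ?thesis
  proof (intro conjI impI)
    assume *: "dir_differentiable_at A G E fc p0 \<and> convex_at A G E fc p0 \<and> nonconstant_on fc X \<and>
      (\<exists>\<mu>. kkt_multipliers A G E m g fc p0 \<mu>)"
    \<comment> \<open>Injectivity of \<open>fc\<close> on \<open>X\<close> makes the inequality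
      strict.\<close>
    have less: "fc p0 < fc p" if "p \<in> X" "p \<noteq> p0" for p
      using minimum[of fc _ p] * that \<open>p0 \<in> X\<close> unfolding nonconstant_on_def by (metis order_le_less)
    have "\<not> f p \<le>min f p0" if "p \<in> X" "p \<noteq> p0" for p
      using less[OF that] by (simp add: le_min_def fc_def)
    then show "strict_optimal_solution f X p0"
      unfolding strict_optimal_solution_def using \<open>p0 \<in> X\<close> by blast
  next
    assume *: "fc constant_on X \<and> dir_differentiable_at A G E fw p0 \<and> convex_at A G E fw p0 \<and>
      (\<exists>\<mu>. kkt_multipliers A G E m g fw p0 \<mu>)"
    have fw: "fw p0 \<le> fw p" if "p \<in> X" for p
      using minimum[of fw _ p] * that by blast
    \<comment> \<open>With all centers equal on \<open>X\<close>, the order is decided by the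
      half-widths.\<close>
    have fc: "fc p = fc p0" if "p \<in> X" for p
      using * that \<open>p0 \<in> X\<close> unfolding constant_on_def by metis
    show "optimal_solution f X p0"
      unfolding optimal_solution_def less_min_def le_min_def
    proof (intro conjI notI \<open>p0 \<in> X\<close>, elim bexE conjE)
      fix p assume p: "p \<in> X" "f p \<noteq> f p0"
        "center (f p) < center (f p0) \<or> center (f p) = center (f p0) \<and> half_width (f p) \<le> half_width (f p0)"
      then show False
        using fw[OF p(1)] fc[OF p(1)] interval_eq_iff_center_half_width[of "f p" "f p0"]
        by (simp add: fc_def fw_def)
    qed
    show "strict_optimal_solution f X p0" if "nonconstant_on fw X"
    proof -
      have less: "fw p0 < fw p" if "p \<in> X" "p \<noteq> p0" for p
        using fw[OF that(1)] \<open>nonconstant_on fw X\<close> that \<open>p0 \<in> X\<close> unfolding nonconstant_on_def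
        by (metis order_le_less)
      have "\<not> f p \<le>min f p0" if "p \<in> X" "p \<noteq> p0" for p
        using less[OF that] fc[OF that(1)] by (simp add: le_min_def fc_def fw_def)
      then show ?thesis
        unfolding strict_optimal_solution_def using \<open>p0 \<in> X\<close> by blast
    qed
  qed
qed

end
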